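(* Let $d\ge 3$ be an integer and let $\alpha_c(\kappa)$, $\kappa>-1$, be the critical value of loop percolation on the $d$-regular tree $\mathbb{T}_d$. Let $\kappa_c=\frac{2\sqrt{d-1}}{d}-1$. The function $\kappa\mapsto\alpha_c(\kappa)$ on $(-1,\infty)$ is continuous, differentiable at every $\kappa\ne\kappa_c$, and monotone (strictly) increasing for $\kappa\ge\kappa_c$. Furthermore, $$\alpha_c(\kappa)=\frac{2\sqrt d\,(d-1)^{3/4}}{d-2}\sqrt{\kappa-\kappa_c}+O_d(\kappa-\kappa_c)\quad\text{as }\kappa\downarrow\kappa_c,$$ and $$\alpha_c(\kappa)=d^2\log\Big(\frac{d-1}{d-2}\Big)(1+\kappa)^2+O_d(1)\quad\text{as }\kappa\to\infty.$$
   Context: $\mathbb{T}_d$ is the infinite $d$-regular tree with a fixed vertex $0$ (the root). A based loop is a nearest-neighbor path $\dot\ell=(v_1,\dots,v_n)$ on $\mathbb{T}_d$ ($n\ge 2$, consecutive vertices adjacent) with $v_n$ a neighbor of $v_1$. Loops are equivalence classes of based loops modulo cyclic shifts. For $\kappa>-1$, $\dot\mu_\kappa$ is the measure on based loops with $\dot\mu_\kappa(\dot\ell)=\frac1n\big(\frac1{1+\kappa}\big)^n\big(\frac1d\big)^n$ for $\dot\ell=(v_1,\dots,v_n)$, and $\mu_\kappa$ is its pushforward to loops. $\mathcal{L}_{\alpha,\kappa}$ is the Poisson point process of loops with intensity $\alpha\mu_\kappa$, $\alpha\ge 0$, with law $\mathbb{P}_{\alpha,\kappa}$. A loop is open if it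 occurs at least once in $\mathcal{L}_{\alpha,\kappa}$. Vertices $u,v$ are loop-connected if there are open loops $\ell_1,\dots,\ell_k$ with $u\in\ell_1$, $v\in\ell_k$ and each consecutive pair $\ell_{i-1},\ell_i$ sharing a vertex (a vertex is always loop-connected to itself). $\mathcal{C}(u)$ is the set of vertices loop-connected to $u$. $\theta(\alpha,\kappa)=\mathbb{P}_{\alpha,\kappa}(|\mathcal{C}(0)|=\infty)$ and $\alpha_c(\kappa)=\inf\{\alpha\ge 0:\theta(\alpha,\kappa)>0\}$. $O_d(\cdot)$ means that the implied constant may depend on $d$ only. *)

theory Defs
  imports "HOL-Probability.Probability" "HOL-Library.Landau_Symbols"
begin

section \<open>The regular tree\<close>

text \<open>
  The \<open>d\<close>-regular tree is realised as the Cayley graph of the free product of \<open>d\<close> copies of the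
  group of order two: a vertex is a reduced word over the letters \<open>0, \<dots>, d - 1\<close> (no letter is
  repeated immediately), and two vertices are adjacent iff one arises from the other by prepending
  a letter.  The lemmas of this section show that this graph is indeed infinite, simple,
  \<open>d\<close>-regular, connected and without cycles.
\<close>

definition tree_verts :: "nat \<Rightarrow> nat list set" where
  "tree_verts d = {w. set w \<subseteq> {..<d} \<and> distinct_adj w}"

definition tree_adj :: "nat \<Rightarrow> nat list \<Rightarrow> nat list \<Rightarrow> bool" where
  "tree_adj d u v \<longleftrightarrow> u \<in> tree_verts d \<and> v \<in> tree_verts d \<and> (\<exists>x. u = x # v \<or> v = x # u)"

definition tree_root :: "nat list" where
  "tree_root = []"

lemma tree_root_in_verts: "tree_root \<in> tree_verts d"
  by (simp add: tree_root_def tree_verts_def)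

lemma tree_adj_sym: "tree_adj d u v \<Longrightarrow> tree_adj d v u"
  by (auto simp: tree_adj_def)

lemma tree_adj_irrefl: "\<not> tree_adj d u u"
  by (auto simp: tree_adj_def)

lemma tree_regular:
  assumes "u \<in> tree_verts d"
  shows "card {v. tree_adj d u v} = d"
proof (cases u)
  case Nil
  then have "{v. tree_adj d u v} = (\<lambda>x. [x]) ` {..<d}"
    by (auto simp: tree_adj_def tree_verts_def)
  then show ?thesis by (simp add: card_image inj_on_def)
next
  case (Cons a w)
  have a: "a < d" and w: "w \<in> tree_verts d"
    using assms Cons by (auto simp: tree_verts_def dest: distinct_adj_ConsD)
  have eq: "{v. tree_adj d u v} = insert w ((\<lambda>x. x # u) ` ({..<d} - {a}))"
    using assms w Cons by (auto simp: tree_adj_def tree_verts_def)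
  have "w \<notin> (\<lambda>x. x # u) ` ({..<d} - {a})"
    using Cons by auto
  moreover have "card ((\<lambda>x. x # u) ` ({..<d} - {a})) = d - 1"
    using a by (simp add: card_image inj_on_def)
  ultimately show ?thesis
    unfolding eq using a by simp
qed

lemma tree_connected:
  assumes "u \<in> tree_verts d" "v \<in> tree_verts d"
  shows "(tree_adj d)\<^sup>*\<^sup>* u v"
proof -
  have *: "(tree_adj d)\<^sup>*\<^sup>* w []" if "w \<in> tree_verts d" for w
    using that
  proof (induction w)
    case (Cons a w)
    then have w: "w \<in> tree_verts d"
      by (auto simp: tree_verts_def dest: distinct_adj_ConsD)
    then have "tree_adj d (a # w) w"
      using Cons.prems by (simp add: tree_adj_def)
    with Cons.IH[OF w] show ?case by (rule converse_rtranclp_into_rtranclp[rotated])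
  qed simp
  have "symp (tree_adj d)\<^sup>*\<^sup>*"
    by (intro symp_rtranclp sympI) (rule tree_adj_sym)
  with *[OF assms(1)] *[OF assms(2)] show ?thesis
    by (meson rtranclp_trans sympD)
qed

lemma tree_acyclic:
  assumes "distinct c" "length c \<ge> 3" "successively (tree_adj d) c"
  shows "\<not> tree_adj d (last c) (hd c)"
proof
  assume cl: "tree_adj d (last c) (hd c)"
  define n where "n = length c"
  have n: "n \<ge> 3" using assms by (simp add: n_def)
  have adj: "tree_adj d (c ! i) (c ! (Suc i mod n))" if "i < n" for i
  proof (cases "Suc i < n")
    case True
    then show ?thesis using assms(3) by (simp add: successively_conv_nth n_def)
  next
    case False
    with that have i: "i = n - 1" by simp
    have "c \<noteq> []" using n by (auto simp: n_def)
    then show ?thesis using cl n by (simp add: i n_def last_conv_nth hd_conv_nth)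
  qed
  define m where "m = (ARG_MAX (\<lambda>i. length (c ! i)) i. i < n)"
  have m: "m < n \<and> (\<forall>i. i < n \<longrightarrow> length (c ! i) \<le> length (c ! m))"
    unfolding m_def
  proof (rule arg_max_nat_lemma[of _ 0 _ "Suc (Max ((\<lambda>i. length (c ! i)) ` {..<n}))"])
    show "\<forall>y. y < n \<longrightarrow> length (c ! y) < Suc (Max ((\<lambda>i. length (c ! i)) ` {..<n}))"
      by (auto simp: less_Suc_eq_le)
  qed (use n in simp)
  define p where "p = (if m = 0 then n - 1 else m - 1)"
  have p: "p < n" "Suc p mod n = m" using m n by (auto simp: p_def)
  have s: "Suc m mod n < n" using n by simp
  have tl: "x = tl (c ! m)" if "tree_adj d (c ! m) x" "length x \<le> length (c ! m)" for x
    using that by (auto simp: tree_adj_def)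
  have "c ! p = tl (c ! m)"
    using adj[OF p(1)] p m by (intro tl) (auto intro: tree_adj_sym)
  moreover have "c ! (Suc m mod n) = tl (c ! m)"
    using adj[of m] m s by (intro tl) auto
  ultimately have "p = Suc m mod n"
    using assms(1) p(1) s by (metis nth_eq_iff_index_eq n_def)
  then show False
    using m n by (auto simp: p_def mod_Suc split: if_splits)
qed

lemma tree_infinite:
  assumes "d \<ge> 2"
  shows "infinite (tree_verts d)"
proof
  assume fin: "finite (tree_verts d)"
  have "\<exists>w\<in>tree_verts d. length w = n" for n
  proof (induction n)
    case 0
    show ?case by (rule bexI[of _ "[]"]) (auto simp: tree_verts_def)
  next
    case (Suc n)
    then obtain w where w: "w \<in> tree_verts d" "length w = n" by blast
    define x :: nat where "x = (if w \<noteq> [] \<and> hd w = 0 then 1 else 0)"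
    have "x # w \<in> tree_verts d"
      using w assms by (auto simp: tree_verts_def x_def distinct_adj_Cons)
    with w show ?case by (intro bexI[of _ "x # w"]) auto
  qed
  then have "UNIV \<subseteq> length ` tree_verts d" by (metis image_eqI subsetI)
  with fin show False
    using finite_surj[OF fin] infinite_UNIV_nat by blast
qed


section \<open>Loops and the loop measure\<close>

definition based_loops :: "nat \<Rightarrow> nat list list set" where
  "based_loops d =
     {l. length l \<ge> 2 \<and> set l \<subseteq> tree_verts d \<and>
         successively (tree_adj d) l \<and> tree_adj d (last l) (hd l)}"

definition shift_rel :: "nat \<Rightarrow> (nat list list \<times> nat list list) set" where
  "shift_rel d = {(l, l'). l \<in> based_loops d \<and> (\<exists>k. l' = rotate k l)}"

text \<open>A loop is an equivalence class of based loops, that is, a set of based loops.\<close>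

definition loops :: "nat \<Rightarrow> nat list list set set" where
  "loops d = based_loops d // shift_rel d"

definition based_loop_measure :: "nat \<Rightarrow> real \<Rightarrow> nat list list measure" where
  "based_loop_measure d \<kappa> =
     density (count_space (based_loops d))
       (\<lambda>l. ennreal (1 / real (length l) * (1 / (1 + \<kappa>)) ^ length l * (1 / real d) ^ length l))"

definition loop_measure :: "nat \<Rightarrow> real \<Rightarrow> nat list list set measure" where
  "loop_measure d \<kappa> =
     distr (based_loop_measure d \<kappa>) (count_space (loops d)) (\<lambda>l. shift_rel d `` {l})"

definition loop_verts :: "nat list list set \<Rightarrow> nat list set" where
  "loop_verts \<gamma> = (\<Union>l\<in>\<gamma>. set l)"

lemma based_loops_rotate:
  assumes "l \<in> based_loops d"
  shows "rotate k l \<in> based_loops d"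
proof (induction k)
  case (Suc k)
  have "rotate1 r \<in> based_loops d" if r: "r \<in> based_loops d" for r
  proof (cases r)
    case (Cons x xs)
    then have "xs \<noteq> []" using r by (auto simp: based_loops_def)
    then show ?thesis
      using r Cons by (auto simp: based_loops_def successively_append_iff successively_Cons)
  qed (use r in \<open>auto simp: based_loops_def\<close>)
  with Suc show ?case by simp
qed (use assms in simp)

lemma equiv_shift_rel: "equiv (based_loops d) (shift_rel d)"
proof (rule equivI)
  show "shift_rel d \<subseteq> based_loops d \<times> based_loops d"
    by (auto simp: shift_rel_def based_loops_rotate)
  show "refl_on (based_loops d) (shift_rel d)"
    by (auto simp: refl_on_def shift_rel_def based_loops_rotate intro: exI[of _ 0])
  show "sym (shift_rel d)"
  proof (rule symI)
    fix l l' assume "(l, l') \<in> shift_rel d"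
    then obtain k where k: "l \<in> based_loops d" "l' = rotate k l"
      by (auto simp: shift_rel_def)
    define n where "n = length l"
    have n: "n > 0" using k by (auto simp: based_loops_def n_def)
    have "rotate (n - k mod n) l' = rotate (n - k mod n + k mod n) l"
      using k by (metis rotate_conv_mod rotate_rotate n_def)
    also have "\<dots> = l"
      using n by (simp add: less_imp_le n_def)
    finally show "(l', l) \<in> shift_rel d"
      using k based_loops_rotate by (metis (mono_tags, lifting) case_prodI mem_Collect_eq shift_rel_def)
  qed
  show "trans (shift_rel d)"
    by (rule transI) (auto simp: shift_rel_def rotate_rotate intro: exI)
qed

lemma countable_loops: "countable (loops d)"
proof -
  have "loops d = (\<lambda>l. shift_rel d `` {l}) ` based_loops d"
    by (auto simp: loops_def quotient_def)
  then show ?thesis by simp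
qed

lemma finite_loop:
  assumes "\<gamma> \<in> loops d"
  shows "finite \<gamma>"
proof -
  from assms obtain l where l: "l \<in> based_loops d" "\<gamma> = shift_rel d `` {l}"
    by (auto simp: loops_def elim: quotientE)
  have "\<gamma> \<subseteq> (\<lambda>k. rotate k l) ` {..<length l}"
  proof
    fix l' assume "l' \<in> \<gamma>"
    then obtain k where "l' = rotate (k mod length l) l"
      using l by (auto simp: shift_rel_def) (metis rotate_conv_mod)
    moreover have "length l > 0" using l by (auto simp: based_loops_def)
    ultimately show "l' \<in> (\<lambda>k. rotate k l) ` {..<length l}" by auto
  qed
  then show ?thesis by (rule finite_subset) simp
qed

lemma emeasure_loop_measure:
  assumes "\<gamma> \<in> loops d"
  shows "emeasure (loop_measure d \<kappa>) {\<gamma>} =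
           (\<Sum>l\<in>\<gamma>. ennreal (1 / real (length l) * (1 / (1 + \<kappa>)) ^ length l * (1 / real d) ^ length l))"
proof -
  have sub: "\<gamma> \<subseteq> based_loops d"
    using assms equiv_shift_rel in_quotient_imp_subset unfolding loops_def by blast
  have eq: "(\<lambda>l. shift_rel d `` {l}) -` {\<gamma>} \<inter> based_loops d = \<gamma>"
  proof (intro set_eqI iffI)
    fix l assume "l \<in> (\<lambda>l. shift_rel d `` {l}) -` {\<gamma>} \<inter> based_loops d"
    then show "l \<in> \<gamma>" using equiv_class_self[OF equiv_shift_rel] by blast
  next
    fix l assume l: "l \<in> \<gamma>"
    with assms have "\<gamma> = shift_rel d `` {l}"
      unfolding loops_def
      by (metis Image_singleton_iff equiv_class_eq equiv_shift_rel quotientE)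
    with l sub show "l \<in> (\<lambda>l. shift_rel d `` {l}) -` {\<gamma>} \<inter> based_loops d" by auto
  qed
  have "emeasure (loop_measure d \<kappa>) {\<gamma>} = emeasure (based_loop_measure d \<kappa>) \<gamma>"
    unfolding loop_measure_def
    using assms eq by (subst emeasure_distr)
      (auto simp: based_loop_measure_def loops_def quotientI)
  also have "\<dots> = (\<Sum>l\<in>\<gamma>. ennreal (1 / real (length l) * (1 / (1 + \<kappa>)) ^ length l * (1 / real d) ^ length l))"
    unfolding based_loop_measure_def using sub finite_loop[OF assms]
    by (subst emeasure_density)
       (auto simp: nn_integral_count_space_indicator[symmetric] nn_integral_count_space_finite
          simp flip: nn_integral_restrict_space simp: restrict_count_space Int_absorb2)
  finally show ?thesis .
qed


section \<open>Poisson point processes and loop percolation\<close>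

text \<open>The library's Poisson distribution is specified for positive rates only.\<close>

definition poisson_dist :: "real \<Rightarrow> nat pmf" where
  "poisson_dist r = (if r = 0 then return_pmf 0 else poisson_pmf r)"

text \<open>
  The law of the Poisson point process with intensity measure \<open>\<nu>\<close>, for a measure \<open>\<nu>\<close> on a discrete
  countable space that gives finite mass to each point.  A realisation \<open>\<omega>\<close> is recorded by the
  multiplicity \<open>\<omega> x\<close> of each point \<open>x\<close>; on such a space the process consists of independent
  multiplicities, that of \<open>x\<close> being Poisson distributed with mean \<open>\<nu> {x}\<close>.
  By \<open>countable_loops\<close>, \<open>finite_loop\<close> and \<open>emeasure_loop_measure\<close> above these conditions
  hold for the loop measure.
\<close>

definition poisson_point_process :: "'a measure \<Rightarrow> ('a \<Rightarrow> nat) measure" where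
  "poisson_point_process \<nu> =
     PiM (space \<nu>) (\<lambda>x. measure_pmf (poisson_dist (measure \<nu> {x})))"

definition loop_soup :: "nat \<Rightarrow> real \<Rightarrow> real \<Rightarrow> (nat list list set \<Rightarrow> nat) measure" where
  "loop_soup d \<alpha> \<kappa> = poisson_point_process (scale_measure (ennreal \<alpha>) (loop_measure d \<kappa>))"

definition open_loops :: "nat \<Rightarrow> (nat list list set \<Rightarrow> nat) \<Rightarrow> nat list list set set" where
  "open_loops d \<omega> = {\<gamma> \<in> loops d. \<omega> \<gamma> \<ge> 1}"

definition loop_connected ::
    "nat \<Rightarrow> (nat list list set \<Rightarrow> nat) \<Rightarrow> nat list \<Rightarrow> nat list \<Rightarrow> bool" where
  "loop_connected d \<omega> u v \<longleftrightarrow>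
     u = v \<or>
     (\<exists>ls. ls \<noteq> [] \<and> set ls \<subseteq> open_loops d \<omega> \<and>
           u \<in> loop_verts (hd ls) \<and> v \<in> loop_verts (last ls) \<and>
           successively (\<lambda>\<gamma> \<gamma>'. loop_verts \<gamma> \<inter> loop_verts \<gamma>' \<noteq> {}) ls)"

definition cluster :: "nat \<Rightarrow> (nat list list set \<Rightarrow> nat) \<Rightarrow> nat list \<Rightarrow> nat list set" where
  "cluster d \<omega> u = {v \<in> tree_verts d. loop_connected d \<omega> u v}"

definition \<theta> :: "nat \<Rightarrow> real \<Rightarrow> real \<Rightarrow> real" where
  "\<theta> d \<alpha> \<kappa> =
     measure (loop_soup d \<alpha> \<kappa>)
       {\<omega> \<in> space (loop_soup d \<alpha> \<kappa>). infinite (cluster d \<omega> tree_root)}"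

definition alpha_c :: "nat \<Rightarrow> real \<Rightarrow> real" where
  "alpha_c d \<kappa> = Inf {\<alpha>. \<alpha> \<ge> 0 \<and> \<theta> d \<alpha> \<kappa> > 0}"

definition kappa_c :: "nat \<Rightarrow> real" where
  "kappa_c d = 2 * sqrt (real d - 1) / real d - 1"

lemma space_loop_measure: "space (loop_measure d \<kappa>) = loops d"
  by (simp add: loop_measure_def)

lemma prob_space_loop_soup: "prob_space (loop_soup d \<alpha> \<kappa>)"
  unfolding loop_soup_def poisson_point_process_def
  by (intro prob_space_PiM prob_space_measure_pmf)

text \<open>The event in the definition of \<^const>\<open>\<theta>\<close> is measurable.\<close>

lemma infinite_cluster_measurable:
  "{\<omega> \<in> space (loop_soup d \<alpha> \<kappa>). infinite (cluster d \<omega> u)} \<in> sets (loop_soup d \<alpha> \<kappa>)"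
proof -
  let ?M = "loop_soup d \<alpha> \<kappa>"
  have open1: "{\<omega> \<in> space ?M. \<omega> \<gamma> \<ge> 1} \<in> sets ?M" if "\<gamma> \<in> loops d" for \<gamma>
  proof -
    have "(\<lambda>\<omega>. \<omega> \<gamma>) \<in> measurable ?M (count_space UNIV)"
      unfolding loop_soup_def poisson_point_process_def
      using that by (simp add: space_scale_measure space_loop_measure
          measurable_component_singleton flip: measurable_pmf_measure2)
    then have "(\<lambda>\<omega>. \<omega> \<gamma>) -` {1..} \<inter> space ?M \<in> sets ?M"
      by (rule measurable_sets) simp
    also have "(\<lambda>\<omega>. \<omega> \<gamma>) -` {1..} \<inter> space ?M = {\<omega> \<in> space ?M. \<omega> \<gamma> \<ge> 1}" by auto
    finally show ?thesis .
  qed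
  have open_list: "{\<omega> \<in> space ?M. \<forall>\<gamma>\<in>set ls. \<omega> \<gamma> \<ge> 1} \<in> sets ?M" if "set ls \<subseteq> loops d" for ls
    using that open1 by (intro sets.sets_Collect_finite_All) auto
  define L where "L v = {ls \<in> lists (loops d). ls \<noteq> [] \<and> u \<in> loop_verts (hd ls) \<and>
      v \<in> loop_verts (last ls) \<and>
      successively (\<lambda>\<gamma> \<gamma>'. loop_verts \<gamma> \<inter> loop_verts \<gamma>' \<noteq> {}) ls}" for v
  have L: "countable (L v)" "\<And>ls. ls \<in> L v \<Longrightarrow> set ls \<subseteq> loops d" for v
    using countable_loops[of d]
    by (auto simp: L_def in_lists_conv_set intro: countable_subset[of _ "lists (loops d)"])
  have conn: "loop_connected d \<omega> u v \<longleftrightarrow> u = v \<or> (\<exists>ls\<in>L v. \<forall>\<gamma>\<in>set ls. \<omega> \<gamma> \<ge> 1)" for \<omega> v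
    unfolding loop_connected_def L_def open_loops_def by (auto simp: in_lists_conv_set; blast)
  have conn_meas: "{\<omega> \<in> space ?M. loop_connected d \<omega> u v} \<in> sets ?M" for v
    unfolding conn using L open_list
    by (intro sets.sets_Collect_disj sets.sets_Collect_countable_Ex' sets.sets_Collect_const) auto
  have inf: "infinite (cluster d \<omega> u) \<longleftrightarrow>
      (\<forall>F\<in>{F. finite F \<and> F \<subseteq> (UNIV :: nat list set)}. \<exists>v\<in>tree_verts d - F. loop_connected d \<omega> u v)" for \<omega>
    unfolding cluster_def
    by (auto; metis (mono_tags, lifting) Diff_iff finite_subset mem_Collect_eq subsetI)
  show ?thesis
    unfolding inf using conn_meas
    by (intro sets.sets_Collect_countable_All' sets.sets_Collect_countable_Ex'
          countable_Collect_finite_subset) auto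
qed

end

theory Submission
  imports Defs "HOL-Library.Sublist"
begin

text \<open>
  In a tree, the cluster of the root is the set of vertices all of whose ancestral edges are
  crossed by open loops. Along a ray, a closed edge splits the soup into independent pieces, so
  the closed edges form a renewal process, and the decay rate of the probability that the first
  \<open>n\<close> edges are open is determined by the probabilities that single edges are closed. These are
  \<open>exp (- \<alpha> m)\<close>, with \<open>m\<close> the mass of the loops crossing the edge, a difference of logarithms of
  Green functions of subtrees. With \<open>(1 + \<kappa>) d = (1 + (d - 1) \<rho>) / \<surd>\<rho>\<close> all Green functions become
  rational in \<open>\<rho>\<close>, and the probability that the \<open>n\<close>-th edge is closed is
  \<open>((1 - \<rho>) / (1 - \<rho>\<^sup>n\<^sup>+\<^sup>1))\<^sup>\<alpha>\<close>. Comparing the decay rate with the growth rate \<open>d - 1\<close> of the tree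
  (Borel-Cantelli on one side, an embedded branching process on the other) shows that the critical
  \<open>\<alpha>\<close> solves \<open>(d - 2) \<Sum>\<^sub>k (d - 1)\<^sup>k ((1 - \<rho>\<^sup>k\<^sup>+\<^sup>1)\<^sup>-\<^sup>\<alpha> - 1) = 1\<close>. The left side is increasing in \<open>\<alpha>\<close> and in
  \<open>\<rho>\<close>, which gives monotonicity, differentiability and both expansions. Below \<open>\<kappa>\<^sub>c\<close> the loops
  crossing an edge have infinite mass, so all edges are open.
\<close>

section \<open>Sums of extended nonnegative reals\<close>

text \<open>One loop may cover many edges, so open edges on different branches are dependent. The
  root is kept apart, having d children where other vertices have b = d - 1. Let U(k) be the
  probability that the edge k levels below \<open>v\<close> is closed, U(0) = 1. The expected number
  t(n) of vertices reached at depth n obeys a renewal equation with weights b^(k+1) (U(k) - U(k+1)),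
  so t is summable if the total weight is below 1 and exceeds 1 somewhere if it is above. Summation
  by parts turns total weight 1 into the equation for \<alpha>. The square root at
  \<open>kappa_c d\<close> is that of the discriminant of the quadratic equation for sqrt \<rho>:
  1/\<rho> - b has order sqrt(\<kappa> - \<open>kappa_c d\<close>), and the root \<alpha> is close
  to (1/\<rho> - b)/(b - 1). For large \<kappa> the term k = 0 dominates and gives \<alpha> ~
  ln(b/(b - 1))/\<rho>.\<close>

lemma nn_integral_count_space_Sigma:
  fixes f :: "'a \<times> 'b \<Rightarrow> ennreal"
  shows "(\<integral>\<^sup>+p. f p \<partial>count_space (Sigma A B)) =
         (\<integral>\<^sup>+x. \<integral>\<^sup>+y. f (x, y) \<partial>count_space (B x) \<partial>count_space A)"
proof -
  have "(\<integral>\<^sup>+p. f p \<partial>count_space (Sigma A B)) =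
        (\<integral>\<^sup>+p. f p * indicator (Sigma A B) p \<partial>count_space UNIV)"
    by (rule nn_integral_count_space_indicator) simp
  also have "\<dots> = (\<integral>\<^sup>+x. \<integral>\<^sup>+y. f (x, y) * indicator (Sigma A B) (x, y) \<partial>count_space UNIV \<partial>count_space UNIV)"
    by (rule nn_integral_fst_count_space[symmetric])
  also have "\<dots> = (\<integral>\<^sup>+x. (\<integral>\<^sup>+y. f (x, y) * indicator (B x) y \<partial>count_space UNIV) * indicator A x \<partial>count_space UNIV)"
    by (intro nn_integral_cong) (auto simp: indicator_def)
  also have "\<dots> = (\<integral>\<^sup>+x. \<integral>\<^sup>+y. f (x, y) * indicator (B x) y \<partial>count_space UNIV \<partial>count_space A)"
    by (rule nn_integral_count_space_indicator[symmetric]) simp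
  also have "\<dots> = (\<integral>\<^sup>+x. \<integral>\<^sup>+y. f (x, y) \<partial>count_space (B x) \<partial>count_space A)"
    by (intro nn_integral_cong nn_integral_count_space_indicator[symmetric]) simp
  finally show ?thesis .
qed

lemma ennreal_suminf_of_bool_eq: "(\<Sum>m. of_bool (k = m) * f m) = (f k :: ennreal)" for k :: nat
proof -
  have "(\<Sum>m. of_bool (k = m) * f m) = (\<Sum>m\<in>{k}. of_bool (k = m) * f m)"
    by (rule suminf_finite) auto
  then show ?thesis by simp
qed

section \<open>Closed walks in the tree\<close>

text \<open>As for based loops, the final return to the starting point is not listed; the empty list is
  the walk without steps.\<close>

definition closed_walks :: "nat \<Rightarrow> nat list set \<Rightarrow> nat list \<Rightarrow> nat list list set" where
  "closed_walks d H x = {l. l = [] \<or> (hd l = x \<and> set l \<subseteq> H \<and> successively (tree_adj d) l \<and> tree_adj d (last l) x)}"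

definition nbrs :: "nat \<Rightarrow> nat list set \<Rightarrow> nat list \<Rightarrow> nat list set" where
  "nbrs d H x = {y \<in> H. tree_adj d x y}"

text \<open>The Green function of the walk killed outside \<open>H\<close>, with weight
  \<open>z\<close> per step. Values in \<open>ennreal\<close> turn divergence into the value
  infinity, so identities hold without summability conditions.\<close>

definition green :: "nat \<Rightarrow> ennreal \<Rightarrow> nat list set \<Rightarrow> nat list \<Rightarrow> ennreal" where
  "green d z H x = (\<integral>\<^sup>+l. z ^ length l \<partial>count_space (closed_walks d H x))"

text \<open>Excursions from \<open>x\<close>: a step to \<open>y\<close>, a closed walk at
  \<open>y\<close> avoiding \<open>x\<close>, a step back. In a tree the return uses the same
  neighbour as the departure.\<close>

definition first_return :: "nat \<Rightarrow> ennreal \<Rightarrow> nat list set \<Rightarrow> nat list \<Rightarrow> ennreal" where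
  "first_return d z H x = (\<Sum>y\<in>nbrs d H x. z\<^sup>2 * green d z (H - {x}) y)"

definition below :: "nat \<Rightarrow> nat list \<Rightarrow> nat list set" where
  "below d v = {w \<in> tree_verts d. suffix v w}"

lemma finite_nbrs [simp]: "finite (nbrs d H x)"
proof -
  have "nbrs d H x \<subseteq> insert (tl x) ((\<lambda>a. a # x) ` {..<d})"
    by (auto simp: nbrs_def tree_adj_def tree_verts_def)
  then show ?thesis by (rule finite_subset) auto
qed

text \<open>Letters are prepended, so the subtree below \<open>v\<close> consists of the words
  ending in \<open>v\<close>, and the edge from \<open>v\<close> to \<open>tl v\<close> is its only
  exit; \<open>not_suffix_step\<close> is the same edge seen from outside.\<close>

lemma suffix_step:
  assumes "suffix v u" "tree_adj d u u'" "v \<noteq> []" "u' \<noteq> tl v"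
  shows "suffix v u'"
  using assms by (auto simp: tree_adj_def suffix_Cons)

lemma not_suffix_step:
  assumes "\<not> suffix v u" "tree_adj d u u'" "v \<noteq> []" "u' \<noteq> v"
  shows "\<not> suffix v u'"
  using assms by (auto simp: tree_adj_def suffix_Cons)

lemma successively_invariant:
  assumes "successively R p" "p \<noteq> []" "P (hd p)" "\<And>u v. u \<in> set p \<Longrightarrow> v \<in> set p \<Longrightarrow> R u v \<Longrightarrow> P u \<Longrightarrow> P v"
  shows "\<forall>u\<in>set p. P u"
  using assms
proof (induction p)
  case (Cons a p)
  show ?case
  proof (cases "p = []")
    case False
    with Cons.prems have R: "R a (hd p)" "successively R p"
      by (auto simp: successively_Cons)
    have "P (hd p)"
      using Cons.prems(4)[of a "hd p"] R False Cons.prems(3) by auto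
    with Cons.IH R(2) False Cons.prems(4) have "\<forall>u\<in>set p. P u" by auto
    with Cons.prems(3) show ?thesis by simp
  qed (use Cons in auto)
qed simp

text \<open>Deleting \<open>x\<close> leaves one component per neighbour of \<open>x\<close>, and a
  path that avoids \<open>x\<close> stays in one of them. The cases are a child and the parent of
  \<open>x\<close>.\<close>

lemma tree_path_returns_to_nbr:
  assumes "successively (tree_adj d) p" "p \<noteq> []" "x \<notin> set p" "tree_adj d x (hd p)" "tree_adj d (last p) x"
  shows "last p = hd p"
proof -
  from assms(4) consider c where "hd p = c # x" | c where "x = c # hd p"
    by (auto simp: tree_adj_def)
  then show ?thesis
  proof cases
    case 1
    have "\<forall>u\<in>set p. suffix (c # x) u"
      by (rule successively_invariant[OF assms(1,2)])
         (use 1 assms(3) suffix_step[of "c # x"] in auto)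
    then have "suffix (c # x) (last p)" using assms(2) by simp
    moreover have "\<not> suffix (c # x) x" using suffix_length_le[of "c # x" x] by auto
    ultimately show ?thesis using assms(5) 1
      by (auto simp: tree_adj_def suffix_Cons dest: suffix_length_le)
  next
    case 2
    have "\<forall>u\<in>set p. \<not> suffix x u"
    proof (rule successively_invariant[OF assms(1,2)])
      show "\<not> suffix x (hd p)" using 2 suffix_length_le[of x "hd p"] by auto
      show "\<not> suffix x v" if "v \<in> set p" "tree_adj d u v" "\<not> suffix x u" for u v
        using not_suffix_step[of x u d v] that assms(3) 2 by auto
    qed
    then have "\<not> suffix x (last p)" using assms(2) by simp
    then show ?thesis using assms(5) 2
      by (auto simp: tree_adj_def suffix_Cons)
  qed
qed

text \<open>First-return decomposition. The excursion is the closed walk \<open>l\<close> at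
  \<open>y\<close> followed by the final \<open>y\<close>, which closed walks do not list;
  \<open>w\<close> is the rest of the walk, empty or starting with the next visit to
  \<open>x\<close>.\<close>

lemma closed_walks_decomp:
  assumes x: "x \<in> H"
  shows "bij_betw (\<lambda>(y, l, w). x # l @ y # w)
           (SIGMA y:nbrs d H x. closed_walks d (H - {x}) y \<times> closed_walks d H x)
           (closed_walks d H x - {[]})"
proof (rule bij_betwI')
  let ?S = "SIGMA y:nbrs d H x. closed_walks d (H - {x}) y \<times> closed_walks d H x"
  have avoid: "x \<notin> set l" "y \<noteq> x" if "y \<in> nbrs d H x" "l \<in> closed_walks d (H - {x}) y" for l y
    using that by (auto simp: closed_walks_def nbrs_def tree_adj_irrefl)
  \<comment> \<open>The next visit to \<open>x\<close> marks where \<open>w\<close> begins, so the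
    three parts can be read off: this is injectivity.\<close>
  have head: "takeWhile (\<lambda>u. u \<noteq> x) (l @ y # w) = l @ [y] \<and> dropWhile (\<lambda>u. u \<noteq> x) (l @ y # w) = w"
    if "y \<in> nbrs d H x" "l \<in> closed_walks d (H - {x}) y" "w \<in> closed_walks d H x" for y l w
  proof -
    have 1: "l @ y # w = (l @ [y]) @ w" by simp
    have 2: "\<And>u. u \<in> set (l @ [y]) \<Longrightarrow> u \<noteq> x" using avoid[OF that(1,2)] by auto
    have "takeWhile (\<lambda>u. u \<noteq> x) w = [] \<and> dropWhile (\<lambda>u. u \<noteq> x) w = w"
      using that(3) by (cases w) (auto simp: closed_walks_def)
    with 2 show ?thesis unfolding 1
      by (subst takeWhile_append2, force, subst dropWhile_append2, force) simp
  qed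
  fix p q assume p: "p \<in> ?S" and q: "q \<in> ?S"
  show "((case p of (y, l, w) \<Rightarrow> x # l @ y # w) = (case q of (y, l, w) \<Rightarrow> x # l @ y # w)) = (p = q)"
  proof (cases p, cases q)
    fix y l w y' l' w' assume pq: "p = (y, l, w)" "q = (y', l', w')"
    show ?thesis
      using head[of y l w] head[of y' l' w'] p q unfolding pq by auto
  qed
next
  fix p assume "p \<in> (SIGMA y:nbrs d H x. closed_walks d (H - {x}) y \<times> closed_walks d H x)"
  then obtain y l w where p: "p = (y, l, w)" and y: "y \<in> H" "tree_adj d x y"
    and l: "l \<in> closed_walks d (H - {x}) y" and w: "w \<in> closed_walks d H x"
    by (auto simp: nbrs_def)
  show "(case p of (y, l, w) \<Rightarrow> x # l @ y # w) \<in> closed_walks d H x - {[]}"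
  proof -
    have yx: "tree_adj d y x" using y(2) by (rule tree_adj_sym)
    have w': "set w \<subseteq> H" "successively (tree_adj d) (y # w)" "tree_adj d (last (y # w)) x"
      using w yx by (auto simp: closed_walks_def successively_Cons)
    have l': "set l \<subseteq> H" "successively (tree_adj d) (x # l)" "tree_adj d (last (x # l)) y"
      using l y(2) by (auto simp: closed_walks_def successively_Cons)
    have "successively (tree_adj d) ((x # l) @ y # w)"
      unfolding successively_append_iff using w'(2) l'(2,3) by auto
    then show ?thesis
      using w' l' x y(1) by (simp add: p closed_walks_def)
  qed
next
  fix s assume s: "s \<in> closed_walks d H x - {[]}"
  then obtain r where sr: "s = x # r" by (cases s) (auto simp: closed_walks_def)
  have r: "set r \<subseteq> H" "successively (tree_adj d) (x # r)" "tree_adj d (last (x # r)) x"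
    using s sr by (auto simp: closed_walks_def)
  have r0: "r \<noteq> []" using r(3) tree_adj_irrefl by auto
  define p where "p = takeWhile (\<lambda>u. u \<noteq> x) r"
  define w where "w = dropWhile (\<lambda>u. u \<noteq> x) r"
  have pw: "r = p @ w" by (simp add: p_def w_def)
  have hr: "tree_adj d x (hd r)" using r(2) r0 by (simp add: successively_Cons)
  have xp: "x \<notin> set p" using set_takeWhileD[of x "\<lambda>u. u \<noteq> x" r] by (auto simp: p_def)
  have "hd r \<noteq> x" using hr tree_adj_irrefl by metis
  then have p0: "p \<noteq> []" using r0 by (cases r) (auto simp: p_def)
  have wx: "w = [] \<or> hd w = x" using hd_dropWhile[of "\<lambda>u. u \<noteq> x" r] by (auto simp: w_def)
  have sp: "successively (tree_adj d) p" and sw: "successively (tree_adj d) w"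
    using r(2) r0 by (auto simp: pw successively_append_iff successively_Cons split: if_splits)
  have lp: "tree_adj d (last p) x"
    using r(2,3) p0 wx by (cases "w = []") (auto simp: pw successively_append_iff successively_Cons)
  have eq: "last p = hd p"
    by (rule tree_path_returns_to_nbr[OF sp p0 xp _ lp]) (use hr p0 pw in simp)
  define l where "l = butlast p"
  have pl: "p = l @ [last p]" using p0 by (simp add: l_def)
  have "l \<in> closed_walks d (H - {x}) (last p)"
  proof (cases "l = []")
    case False
    have "hd l = last p" using eq pl False by (metis hd_append2)
    moreover have "successively (tree_adj d) l" "tree_adj d (last l) (last p)"
      using sp pl False by (metis successively_append_iff list.discI list.sel(1))+
    moreover have "set l \<subseteq> H - {x}"
      using r(1) xp in_set_butlastD[of _ p] by (auto simp: pw l_def)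
    ultimately show ?thesis by (simp add: closed_walks_def)
  qed (simp add: closed_walks_def)
  moreover have "w \<in> closed_walks d H x"
    using wx sw r(1,3) by (auto simp: closed_walks_def pw)
  moreover have "last p \<in> nbrs d H x"
    using lp r(1) p0 by (auto simp: nbrs_def pw intro: tree_adj_sym)
  moreover have "s = x # l @ last p # w"
    using sr pw pl by simp
  ultimately show "\<exists>q\<in>SIGMA y:nbrs d H x. closed_walks d (H - {x}) y \<times> closed_walks d H x.
      s = (case q of (y, l, w) \<Rightarrow> x # l @ y # w)"
    by (intro bexI[of _ "(last p, l, w)"]) auto
qed

text \<open>Kept general in \<open>F\<close>, since it is applied to the plain weight, to walks with
  a given number of visits and to walks of bounded length.\<close>

lemma nn_integral_closed_walks:
  fixes F :: "nat list list \<Rightarrow> ennreal"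
  assumes "x \<in> H"
  shows "(\<integral>\<^sup>+l. F l \<partial>count_space (closed_walks d H x)) =
     F [] + (\<Sum>y\<in>nbrs d H x. \<integral>\<^sup>+l. \<integral>\<^sup>+w. F (x # l @ y # w) \<partial>count_space (closed_walks d H x)
                 \<partial>count_space (closed_walks d (H - {x}) y))"
proof -
  have e: "[] \<in> closed_walks d H x" by (simp add: closed_walks_def)
  have "(\<integral>\<^sup>+l. F l \<partial>count_space (closed_walks d H x)) =
        (\<integral>\<^sup>+l. F l * indicator {[]} l + F l * indicator (closed_walks d H x - {[]}) l \<partial>count_space (closed_walks d H x))"
    by (intro nn_integral_cong) (auto simp: indicator_def)
  also have "\<dots> = (\<integral>\<^sup>+l. F l * indicator {[]} l \<partial>count_space (closed_walks d H x)) +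
        (\<integral>\<^sup>+l. F l * indicator (closed_walks d H x - {[]}) l \<partial>count_space (closed_walks d H x))"
    by (rule nn_integral_add) auto
  also have "(\<integral>\<^sup>+l. F l * indicator {[]} l \<partial>count_space (closed_walks d H x)) = F []"
    using e by (subst nn_integral_count_space'[where A = "{[]}"]) auto
  also have "(\<integral>\<^sup>+l. F l * indicator (closed_walks d H x - {[]}) l \<partial>count_space (closed_walks d H x)) =
      (\<integral>\<^sup>+l. F l \<partial>count_space (closed_walks d H x - {[]}))"
    by (subst (2) nn_integral_count_space_indicator, simp)
       (auto simp: nn_integral_count_space_indicator indicator_def intro!: nn_integral_cong)
  also have "\<dots> = (\<integral>\<^sup>+p. F (case p of (y, l, w) \<Rightarrow> x # l @ y # w) \<partial>count_space
           (SIGMA y:nbrs d H x. closed_walks d (H - {x}) y \<times> closed_walks d H x))"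
    by (rule nn_integral_bij_count_space[OF closed_walks_decomp[OF assms], symmetric])
  also have "\<dots> = (\<Sum>y\<in>nbrs d H x. \<integral>\<^sup>+l. \<integral>\<^sup>+w. F (x # l @ y # w) \<partial>count_space (closed_walks d H x)
                 \<partial>count_space (closed_walks d (H - {x}) y))"
    by (simp add: nn_integral_count_space_Sigma nn_integral_count_space_finite)
  finally show ?thesis .
qed

lemma closed_walks_not_visited:
  assumes "l \<in> closed_walks d (H - {x}) y"
  shows "count_list l x = 0"
  using assms by (auto simp: closed_walks_def count_list_0_iff)

text \<open>Every visit to \<open>x\<close> opens one excursion. The decomposition removes the first
  one, which contributes a factor \<open>first_return d z H x\<close>.\<close>

lemma nn_integral_closed_walks_visits:
  assumes "x \<in> H"
  shows "(\<integral>\<^sup>+l. z ^ length l * of_bool (count_list l x = m) \<partial>count_space (closed_walks d H x)) =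
         first_return d z H x ^ m"
proof (induction m)
  case 0
  have *: "z ^ length l * of_bool (count_list l x = 0) = of_bool (l = [])"
    if "l \<in> closed_walks d H x" for l
    using that by (cases l) (auto simp: closed_walks_def count_list_0_iff)
  have "(\<integral>\<^sup>+l. z ^ length l * of_bool (count_list l x = 0) \<partial>count_space (closed_walks d H x)) =
        (\<integral>\<^sup>+l. of_bool (l = []) \<partial>count_space (closed_walks d H x))"
    by (intro nn_integral_cong) (auto simp: *)
  also have "\<dots> = 1"
    by (subst nn_integral_count_space'[where A = "{[]}"]) (auto simp: closed_walks_def)
  finally show ?case by simp
next
  case (Suc m)
  let ?G = "closed_walks d H x"
  have "(\<integral>\<^sup>+l. z ^ length l * of_bool (count_list l x = Suc m) \<partial>count_space ?G) =
     (\<Sum>y\<in>nbrs d H x. \<integral>\<^sup>+l. \<integral>\<^sup>+w. z ^ length (x # l @ y # w) * of_bool (count_list (x # l @ y # w) x = Suc m)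
         \<partial>count_space ?G \<partial>count_space (closed_walks d (H - {x}) y))"
    by (subst nn_integral_closed_walks[OF assms]) simp
  also have "\<dots> = (\<Sum>y\<in>nbrs d H x. \<integral>\<^sup>+l. \<integral>\<^sup>+w. (z\<^sup>2 * z ^ length l) * (z ^ length w * of_bool (count_list w x = m))
         \<partial>count_space ?G \<partial>count_space (closed_walks d (H - {x}) y))"
  proof (intro sum.cong refl nn_integral_cong)
    fix y l w
    assume y: "y \<in> nbrs d H x" and l: "l \<in> space (count_space (closed_walks d (H - {x}) y))"
    have "y \<noteq> x" using y by (auto simp: nbrs_def tree_adj_irrefl)
    then show "z ^ length (x # l @ y # w) * of_bool (count_list (x # l @ y # w) x = Suc m) =
        (z\<^sup>2 * z ^ length l) * (z ^ length w * of_bool (count_list w x = m))"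
      using closed_walks_not_visited[of l d H x y] l
      by (simp add: power_add power2_eq_square mult_ac)
  qed
  also have "\<dots> = (\<Sum>y\<in>nbrs d H x. \<integral>\<^sup>+l. (z\<^sup>2 * z ^ length l) * first_return d z H x ^ m
         \<partial>count_space (closed_walks d (H - {x}) y))"
    by (subst nn_integral_cmult) (auto simp: Suc.IH)
  also have "\<dots> = first_return d z H x * first_return d z H x ^ m"
    by (subst nn_integral_multc, simp, subst nn_integral_cmult, simp)
       (simp add: first_return_def sum_distrib_right green_def)
  finally show ?case by simp
qed

lemma green_eq_suminf:
  assumes "x \<in> H"
  shows "green d z H x = (\<Sum>m. first_return d z H x ^ m)"
proof -
  have "green d z H x = (\<integral>\<^sup>+l. (\<Sum>m. z ^ length l * of_bool (count_list l x = m)) \<partial>count_space (closed_walks d H x))"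
    unfolding green_def
    using ennreal_suminf_of_bool_eq[of _ "\<lambda>_. z ^ _"]
    by (intro nn_integral_cong) (simp add: mult.commute)
  also have "\<dots> = (\<Sum>m. \<integral>\<^sup>+l. z ^ length l * of_bool (count_list l x = m) \<partial>count_space (closed_walks d H x))"
    by (rule nn_integral_suminf) auto
  finally show ?thesis by (simp add: nn_integral_closed_walks_visits[OF assms])
qed

section \<open>The mass of the loops through a vertex\<close>

definition loops_through :: "nat \<Rightarrow> nat list set \<Rightarrow> nat list \<Rightarrow> nat list list set" where
  "loops_through d H x = {l \<in> based_loops d. set l \<subseteq> H \<and> x \<in> set l}"

lemma loops_through_rotate: "l \<in> loops_through d H x \<Longrightarrow> rotate k l \<in> loops_through d H x"
  by (auto simp: loops_through_def based_loops_rotate)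

lemma loops_through_hd: "{l \<in> loops_through d H x. hd l = x} = closed_walks d H x - {[]}"
proof (intro set_eqI iffI)
  fix l assume "l \<in> {l \<in> loops_through d H x. hd l = x}"
  then show "l \<in> closed_walks d H x - {[]}"
    by (auto simp: loops_through_def based_loops_def closed_walks_def)
next
  fix l assume l: "l \<in> closed_walks d H x - {[]}"
  then obtain y r where yr: "l = x # y # r"
    by (cases l rule: remdups_adj.cases) (auto simp: closed_walks_def tree_adj_irrefl)
  have s: "successively (tree_adj d) l" using l by (auto simp: closed_walks_def)
  have "u \<in> tree_verts d" if "u \<in> set l" for u
  proof -
    have "\<forall>u\<in>set l. u \<in> tree_verts d"
      by (rule successively_invariant[OF s]) (use s in \<open>auto simp: yr tree_adj_def\<close>)
    with that show ?thesis by blast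
  qed
  with l yr show "l \<in> {l \<in> loops_through d H x. hd l = x}"
    by (auto simp: loops_through_def based_loops_def closed_walks_def)
qed

lemma count_list_rotate: "count_list (rotate k l) x = count_list l x"
proof (induction k)
  case (Suc k)
  have "count_list (rotate1 l') x = count_list l' x" for l' by (cases l') auto
  with Suc show ?case by simp
qed simp

lemma card_visits: "card {i. i < length l \<and> l ! i = x} = count_list l x"
proof -
  have "count_list l x = length (filter (\<lambda>u. u = x) l)"
    by (simp add: count_list_eq_length_filter) (metis (mono_tags, lifting))
  then show ?thesis by (simp add: length_filter_conv_card)
qed

text \<open>A loop with a marked visit to \<open>x\<close> becomes, after rotation to the mark, a
  closed walk from \<open>x\<close>. Keeping the index of the mark makes this reversible, and the
  index is then arbitrary below the length.\<close>

lemma bij_rotate_visits: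
  "bij_betw (\<lambda>(l, i). (rotate i l, i))
     (SIGMA l:loops_through d H x. {i. i < length l \<and> l ! i = x})
     (SIGMA l:closed_walks d H x - {[]}. {..<length l})"
proof (rule bij_betw_byWitness[where f' = "\<lambda>(l, i). (rotate (length l - i) l, i)"])
  have back1: "rotate (length l - i) (rotate i l) = l" if "i < length l" for l :: "nat list list" and i
    using that by (simp add: rotate_rotate)
  have back2: "rotate i (rotate (length l - i) l) = l" if "i < length l" for l :: "nat list list" and i
    using that by (simp add: rotate_rotate)
  show "\<forall>a\<in>SIGMA l:loops_through d H x. {i. i < length l \<and> l ! i = x}.
      (case (case a of (l, i) \<Rightarrow> (rotate i l, i)) of (l, i) \<Rightarrow> (rotate (length l - i) l, i)) = a"
    using back1 back2 by auto
  show "\<forall>a\<in>SIGMA l:closed_walks d H x - {[]}. {..<length l}.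
      (case (case a of (l, i) \<Rightarrow> (rotate (length l - i) l, i)) of (l, i) \<Rightarrow> (rotate i l, i)) = a"
    using back1 back2 by auto
  show "(\<lambda>(l, i). (rotate i l, i)) ` (SIGMA l:loops_through d H x. {i. i < length l \<and> l ! i = x})
      \<subseteq> (SIGMA l:closed_walks d H x - {[]}. {..<length l})"
  proof (rule image_subsetI)
    fix p assume "p \<in> (SIGMA l:loops_through d H x. {i. i < length l \<and> l ! i = x})"
    then obtain l i where p: "p = (l, i)" and l: "l \<in> loops_through d H x" and i: "i < length l" "x = l ! i"
      by auto
    have "hd (rotate i l) = x"
      using i by (subst hd_rotate_conv_nth) auto
    with l have "rotate i l \<in> {l \<in> loops_through d H x. hd l = x}"
      by (auto intro: loops_through_rotate)
    then show "(case p of (l, i) \<Rightarrow> (rotate i l, i)) \<in> (SIGMA l:closed_walks d H x - {[]}. {..<length l})"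
      using i unfolding loops_through_hd p by auto
  qed
  show "(\<lambda>(l, i). (rotate (length l - i) l, i)) ` (SIGMA l:closed_walks d H x - {[]}. {..<length l})
      \<subseteq> (SIGMA l:loops_through d H x. {i. i < length l \<and> l ! i = x})"
  proof (rule image_subsetI)
    fix p assume "p \<in> (SIGMA l:closed_walks d H x - {[]}. {..<length l})"
    then obtain l i where p: "p = (l, i)" and l: "l \<in> closed_walks d H x - {[]}" and i: "i < length l"
      by auto
    have "l \<in> {l \<in> loops_through d H x. hd l = x}" using l unfolding loops_through_hd by auto
    then have "rotate (length l - i) l \<in> loops_through d H x" by (auto intro: loops_through_rotate)
    moreover have "rotate (length l - i) l ! i = l ! ((length l - i + i) mod length l)"
      using i by (subst nth_rotate) auto
    then have "rotate (length l - i) l ! i = x"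
      using i l by (auto simp: closed_walks_def hd_conv_nth)
    ultimately show "(case p of (l, i) \<Rightarrow> (rotate (length l - i) l, i))
        \<in> (SIGMA l:loops_through d H x. {i. i < length l \<and> l ! i = x})"
      using i by (simp add: p)
  qed
qed

definition loop_weight :: "ennreal \<Rightarrow> nat list list \<Rightarrow> ennreal" where
  "loop_weight z l = z ^ length l * ennreal (1 / real (length l))"

definition loop_mass :: "nat \<Rightarrow> ennreal \<Rightarrow> nat list set \<Rightarrow> nat list \<Rightarrow> ennreal" where
  "loop_mass d z H x = (\<integral>\<^sup>+l. loop_weight z l \<partial>count_space (loops_through d H x))"

lemma of_nat_ennreal_cancel: "n > 0 \<Longrightarrow> of_nat n * (a * ennreal (1 / real n)) = a"
proof -
  assume "n > 0"
  then have "of_nat n * ennreal (1 / real n) = 1"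
    by (simp add: ennreal_of_nat_eq_real_of_nat flip: ennreal_mult)
  then show ?thesis by (metis mult.left_commute mult.right_neutral)
qed

text \<open>Each loop with \<open>m\<close> visits to \<open>x\<close> is counted once for each visit, with weight \<open>1/m\<close>; a rotation
  brings the visit to the front, and the factor \<open>1/n\<close> cancels against the \<open>n\<close> possible rotations.\<close>

lemma loop_mass_eq_suminf:
  assumes "x \<in> H"
  shows "loop_mass d z H x = (\<Sum>m. first_return d z H x ^ m * ennreal (1 / real m))"
proof -
  define h where "h l = loop_weight z l * ennreal (1 / real (count_list l x))" for l
  have "loop_mass d z H x = (\<integral>\<^sup>+l. \<integral>\<^sup>+i. h l \<partial>count_space {i. i < length l \<and> l ! i = x} \<partial>count_space (loops_through d H x))"
    unfolding loop_mass_def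
  proof (intro nn_integral_cong)
    fix l assume "l \<in> space (count_space (loops_through d H x))"
    then have "count_list l x > 0" using count_list_0_iff[of l x] by (auto simp: loops_through_def)
    moreover have "(\<integral>\<^sup>+i. h l \<partial>count_space {i. i < length l \<and> l ! i = x}) = of_nat (count_list l x) * h l"
      by (simp add: nn_integral_count_space_finite card_visits mult.commute)
    ultimately show "loop_weight z l = (\<integral>\<^sup>+i. h l \<partial>count_space {i. i < length l \<and> l ! i = x})"
      by (simp add: h_def of_nat_ennreal_cancel)
  qed
  also have "\<dots> = (\<integral>\<^sup>+p. h (fst p) \<partial>count_space (SIGMA l:loops_through d H x. {i. i < length l \<and> l ! i = x}))"
    by (simp add: nn_integral_count_space_Sigma)
  also have "\<dots> = (\<integral>\<^sup>+p. h (fst (case p of (l, i) \<Rightarrow> (rotate i l, i))) \<partial>count_space (SIGMA l:loops_through d H x. {i. i < length l \<and> l ! i = x}))"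
    by (intro nn_integral_cong) (auto simp: h_def loop_weight_def count_list_rotate)
  also have "\<dots> = (\<integral>\<^sup>+p. h (fst p) \<partial>count_space (SIGMA l:closed_walks d H x - {[]}. {..<length l}))"
    by (rule nn_integral_bij_count_space[OF bij_rotate_visits])
  also have "\<dots> = (\<integral>\<^sup>+l. of_nat (length l) * h l \<partial>count_space (closed_walks d H x - {[]}))"
    by (simp add: nn_integral_count_space_Sigma nn_integral_count_space_finite mult.commute)
  also have "\<dots> = (\<integral>\<^sup>+l. z ^ length l * ennreal (1 / real (count_list l x)) \<partial>count_space (closed_walks d H x - {[]}))"
  proof (intro nn_integral_cong)
    fix l assume "l \<in> space (count_space (closed_walks d H x - {[]}))"
    then have "length l > 0" by auto
    from of_nat_ennreal_cancel[OF this, of "z ^ length l * ennreal (1 / real (count_list l x))"]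
    show "of_nat (length l) * h l = z ^ length l * ennreal (1 / real (count_list l x))"
      by (simp add: h_def loop_weight_def mult_ac)
  qed
  also have "\<dots> = (\<integral>\<^sup>+l. z ^ length l * ennreal (1 / real (count_list l x)) \<partial>count_space (closed_walks d H x))"
    by (rule nn_integral_count_space_eq) auto
  also have "\<dots> = (\<integral>\<^sup>+l. (\<Sum>m. z ^ length l * of_bool (count_list l x = m) * ennreal (1 / real m)) \<partial>count_space (closed_walks d H x))"
    using ennreal_suminf_of_bool_eq[of _ "\<lambda>m. ennreal (1 / real m)"]
    by (intro nn_integral_cong) (simp add: mult.assoc)
  also have "\<dots> = (\<Sum>m. \<integral>\<^sup>+l. z ^ length l * of_bool (count_list l x = m) * ennreal (1 / real m) \<partial>count_space (closed_walks d H x))"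
    by (rule nn_integral_suminf) auto
  also have "\<dots> = (\<Sum>m. first_return d z H x ^ m * ennreal (1 / real m))"
    by (subst nn_integral_multc) (auto simp: nn_integral_closed_walks_visits[OF assms])
  finally show ?thesis .
qed

section \<open>Green functions of subtrees\<close>

text \<open>Splits off one excursion instead of summing a geometric series, and so covers the case
  of an infinite Green function.\<close>

lemma green_eq: "x \<in> H \<Longrightarrow> green d z H x = 1 + first_return d z H x * green d z H x"
proof -
  assume x: "x \<in> H"
  have eq: "(\<integral>\<^sup>+l. \<integral>\<^sup>+w. z ^ length (x # l @ y # w) \<partial>count_space (closed_walks d H x)
              \<partial>count_space (closed_walks d (H - {x}) y)) =
            z\<^sup>2 * green d z (H - {x}) y * green d z H x" for y
  proof -
    have "(\<integral>\<^sup>+l. \<integral>\<^sup>+w. z ^ length (x # l @ y # w) \<partial>count_space (closed_walks d H x)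
              \<partial>count_space (closed_walks d (H - {x}) y)) =
          (\<integral>\<^sup>+l. \<integral>\<^sup>+w. z\<^sup>2 * z ^ length l * z ^ length w \<partial>count_space (closed_walks d H x)
              \<partial>count_space (closed_walks d (H - {x}) y))"
      by (intro nn_integral_cong) (simp add: power_add power2_eq_square mult_ac)
    also have "\<dots> = (\<integral>\<^sup>+l. z\<^sup>2 * z ^ length l * green d z H x \<partial>count_space (closed_walks d (H - {x}) y))"
      by (subst nn_integral_cmult) (auto simp: green_def)
    also have "\<dots> = z\<^sup>2 * green d z (H - {x}) y * green d z H x"
      by (subst nn_integral_multc, simp, subst nn_integral_cmult, simp) (simp add: green_def)
    finally show ?thesis .
  qed
  have "green d z H x = 1 + (\<Sum>y\<in>nbrs d H x. z\<^sup>2 * green d z (H - {x}) y * green d z H x)"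
    unfolding eq[symmetric] by (subst green_def, subst nn_integral_closed_walks[OF x]) simp
  then show ?thesis by (simp add: first_return_def sum_distrib_right)
qed

section \<open>Subtrees: confinement of walks, neighbours and children\<close>

lemma closed_walks_mono: "H \<subseteq> K \<Longrightarrow> closed_walks d H x \<subseteq> closed_walks d K x"
  by (auto simp: closed_walks_def)

lemma closed_walks_restrict:
  assumes "P x" "\<And>u v. u \<in> K \<Longrightarrow> v \<in> K \<Longrightarrow> tree_adj d u v \<Longrightarrow> P u \<Longrightarrow> P v"
  shows "closed_walks d K x = closed_walks d {u \<in> K. P u} x"
proof
  show "closed_walks d K x \<subseteq> closed_walks d {u \<in> K. P u} x"
  proof
    fix l assume l: "l \<in> closed_walks d K x"
    show "l \<in> closed_walks d {u \<in> K. P u} x"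
    proof (cases "l = []")
      case False
      have "\<forall>u\<in>set l. P u"
        by (rule successively_invariant[of "tree_adj d"])
           (use l False assms in \<open>auto simp: closed_walks_def\<close>)
      with l show ?thesis by (auto simp: closed_walks_def)
    qed (simp add: closed_walks_def)
  qed
qed (rule closed_walks_mono, blast)

lemma below_subset_verts: "below d v \<subseteq> tree_verts d"
  by (auto simp: below_def)

lemma below_self: "v \<in> tree_verts d \<Longrightarrow> v \<in> below d v"
  by (simp add: below_def)

lemma below_mono: "suffix v w \<Longrightarrow> below d w \<subseteq> below d v"
  by (auto simp: below_def intro: suffix_order.trans)

text \<open>With \<open>x\<close> deleted, a walk from its child cannot leave the subtree of the
  child. \<open>green_parent\<close> treats the other end of the edge.\<close>

lemma green_child:
  assumes "a # x \<in> tree_verts d" "below d (a # x) \<subseteq> H" "H \<subseteq> tree_verts d"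
  shows "green d z (H - {x}) (a # x) = green d z (below d (a # x)) (a # x)"
proof -
  have "closed_walks d (H - {x}) (a # x) = closed_walks d {u \<in> H - {x}. suffix (a # x) u} (a # x)"
    by (rule closed_walks_restrict) (auto intro: suffix_step)
  also have "{u \<in> H - {x}. suffix (a # x) u} = below d (a # x)"
    using assms by (auto simp: below_def dest: suffix_length_le)
  finally show ?thesis by (simp add: green_def)
qed

lemma green_parent:
  assumes "a # x \<in> H" "H \<subseteq> tree_verts d"
  shows "green d z (H - {a # x}) x = green d z (H - below d (a # x)) x"
proof -
  have "closed_walks d (H - {a # x}) x = closed_walks d {u \<in> H - {a # x}. \<not> suffix (a # x) u} x"
  proof (rule closed_walks_restrict)
    show "\<not> suffix (a # x) x" by (auto dest: suffix_length_le)
    show "\<not> suffix (a # x) v" if "v \<in> H - {a # x}" "tree_adj d u v" "\<not> suffix (a # x) u" for u v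
      using not_suffix_step[OF that(3,2)] that(1) by blast
  qed
  also have "{u \<in> H - {a # x}. \<not> suffix (a # x) u} = H - below d (a # x)"
    using assms by (auto simp: below_def)
  finally show ?thesis by (simp add: green_def)
qed

definition children :: "nat \<Rightarrow> nat list \<Rightarrow> nat list set" where
  "children d x = {y. tree_adj d x y \<and> length y = Suc (length x)}"

lemma children_eq: "x \<in> tree_verts d \<Longrightarrow> children d x = (\<lambda>a. a # x) ` {a. a < d \<and> (x = [] \<or> a \<noteq> hd x)}"
  by (auto simp: children_def tree_adj_def tree_verts_def distinct_adj_Cons)

lemma finite_children [simp]: "finite (children d x)"
  by (rule finite_subset[OF _ finite_nbrs[of d UNIV x]]) (auto simp: children_def nbrs_def)

lemma card_children:
  assumes "x \<in> tree_verts d"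
  shows "card (children d x) = (if x = [] then d else d - 1)"
proof (cases "x = []")
  case False
  have "{a. a < d \<and> a \<noteq> hd x} = {..<d} - {hd x}" by auto
  moreover have "hd x < d" using assms False by (cases x) (auto simp: tree_verts_def)
  ultimately show ?thesis using assms False
    by (simp add: children_eq card_image inj_on_def)
qed (use assms in \<open>simp add: children_eq card_image inj_on_def flip: lessThan_def\<close>)

lemma in_childrenD:
  assumes "y \<in> children d x"
  obtains a where "y = a # x" "a # x \<in> tree_verts d" "x \<in> tree_verts d"
  using assms by (auto simp: children_def tree_adj_def)

lemma nbrs_below_top:
  assumes "v \<in> tree_verts d" "v \<noteq> []"
  shows "nbrs d (below d v) v = children d v"
  using assms by (auto simp: nbrs_def children_def below_def tree_adj_def suffix_Cons dest: suffix_length_le)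

lemma nbrs_below:
  assumes "x \<in> below d v" "x \<noteq> v"
  shows "nbrs d (below d v) x = insert (tl x) (children d x)" "tl x \<in> below d v" "tl x \<notin> children d x"
proof -
  obtain a y where x: "x = a # y" and s: "suffix v y" "a # y \<in> tree_verts d"
    using assms by (cases x) (auto simp: below_def suffix_Cons)
  have y: "y \<in> tree_verts d" using s by (auto simp: tree_verts_def dest: distinct_adj_ConsD)
  show "nbrs d (below d v) x = insert (tl x) (children d x)" "tl x \<in> below d v" "tl x \<notin> children d x"
    using s y by (auto simp: nbrs_def children_def below_def tree_adj_def x suffix_Cons)
qed

lemma nbrs_verts: "nbrs d (tree_verts d) [] = children d []"
  by (auto simp: nbrs_def children_def tree_adj_def)

lemma ennreal_suminf_geometric:
  assumes "0 \<le> r" "r < 1"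
  shows "(\<Sum>m. ennreal r ^ m) = ennreal (1 / (1 - r))"
proof -
  have "(\<Sum>m. ennreal (r ^ m)) = ennreal (1 / (1 - r))"
    by (rule suminf_ennreal_eq) (use assms geometric_sums[of r] in auto)
  then show ?thesis by (simp only: ennreal_power[OF assms(1)])
qed

text \<open>The logarithmic series. Its term for m = 0 vanishes because division by zero yields 0;
  the same convention drops the empty walk in \<open>loop_mass_eq_suminf\<close>.\<close>

lemma ennreal_suminf_log:
  assumes "0 \<le> r" "r < 1"
  shows "(\<Sum>m. ennreal r ^ m * ennreal (1 / real m)) = ennreal (- ln (1 - r))"
proof -
  have "(\<lambda>n. - ((- (- r)) ^ n) / of_nat n) sums ln (1 + - r)"
    using ln_series'[of "- r"] assms by simp
  from sums_minus[OF this] have "(\<lambda>m. r ^ m * (1 / real m)) sums (- ln (1 - r))"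
    by simp
  then have "(\<Sum>m. ennreal (r ^ m * (1 / real m))) = ennreal (- ln (1 - r))"
    by (rule suminf_ennreal_eq[rotated]) (use assms in auto)
  then show ?thesis using assms by (simp only: ennreal_power ennreal_mult zero_le_power zero_le_divide_1_iff of_nat_0_le_iff)
qed

lemma green_real:
  assumes "x \<in> H" "first_return d z H x = ennreal r" "0 \<le> r" "r < 1"
  shows "green d z H x = ennreal (1 / (1 - r))" "loop_mass d z H x = ennreal (- ln (1 - r))"
  using assms by (simp_all add: green_eq_suminf ennreal_suminf_geometric loop_mass_eq_suminf ennreal_suminf_log)

lemma first_return_top:
  assumes "v \<in> tree_verts d" "v \<noteq> []"
  shows "first_return d z (below d v) v = (\<Sum>y\<in>children d v. z\<^sup>2 * green d z (below d y) y)"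
  unfolding first_return_def nbrs_below_top[OF assms]
proof (intro sum.cong refl)
  fix y assume "y \<in> children d v"
  then obtain a where y: "y = a # v" "a # v \<in> tree_verts d" by (rule in_childrenD)
  have "below d (a # v) \<subseteq> below d v" by (rule below_mono) (simp add: suffix_ConsI)
  then show "z\<^sup>2 * green d z (below d v - {v}) y = z\<^sup>2 * green d z (below d y) y"
    using green_child[OF y(2) _ below_subset_verts] y by simp
qed

lemma first_return_root:
  "first_return d z (tree_verts d) [] = (\<Sum>y\<in>children d []. z\<^sup>2 * green d z (below d y) y)"
proof -
  show ?thesis
    unfolding first_return_def nbrs_verts
  proof (intro sum.cong refl)
    fix y assume "y \<in> children d []"
    then obtain a where y: "y = a # []" "a # [] \<in> tree_verts d" by (rule in_childrenD)
    then show "z\<^sup>2 * green d z (tree_verts d - {[]}) y = z\<^sup>2 * green d z (below d y) y"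
      using green_child[OF y(2) below_subset_verts] by simp
  qed
qed

text \<open>Truncating by length makes the quadratic equation for the Green function an induction:
  any supersolution of it is an upper bound.\<close>

lemma green_top_le:
  assumes G: "1 + of_nat (d - 1) * z\<^sup>2 * G\<^sup>2 \<le> G" and v: "v \<in> tree_verts d" "v \<noteq> []"
  shows "green d z (below d v) v \<le> G"
proof -
  define T where "T N H x = (\<integral>\<^sup>+l. z ^ length l * of_bool (length l < N) \<partial>count_space (closed_walks d H x))"
    for N :: nat and H x
  have T: "T N (below d v) v \<le> G" if "v \<in> tree_verts d" "v \<noteq> []" for N v
    using that
  proof (induction N arbitrary: v)
    case (Suc N)
    let ?H = "below d v"
    have v: "v \<in> ?H" using Suc.prems by (simp add: below_self)
    have "T (Suc N) ?H v = 1 + (\<Sum>y\<in>children d v. \<integral>\<^sup>+l. \<integral>\<^sup>+w. z ^ length (v # l @ y # w) * of_bool (length (v # l @ y # w) < Suc N)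
        \<partial>count_space (closed_walks d ?H v) \<partial>count_space (closed_walks d (?H - {v}) y))"
      unfolding T_def nbrs_below_top[OF Suc.prems, symmetric]
      by (subst nn_integral_closed_walks[OF v]) simp
    \<comment> \<open>Both \<open>l\<close> and \<open>w\<close> are shorter than \<open>N\<close>,
      so the truncation splits over the two factors.\<close>
    also have "\<dots> \<le> 1 + (\<Sum>y\<in>children d v. \<integral>\<^sup>+l. \<integral>\<^sup>+w. (z\<^sup>2 * (z ^ length l * of_bool (length l < N))) * (z ^ length w * of_bool (length w < N))
        \<partial>count_space (closed_walks d ?H v) \<partial>count_space (closed_walks d (?H - {v}) y))"
      by (intro add_left_mono sum_mono nn_integral_mono)
         (auto simp: power_add power2_eq_square mult_ac)
    also have "\<dots> = 1 + (\<Sum>y\<in>children d v. z\<^sup>2 * T N (?H - {v}) y * T N ?H v)"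
      by (simp add: nn_integral_cmult nn_integral_multc T_def)
    also have "\<dots> \<le> 1 + (\<Sum>y\<in>children d v. z\<^sup>2 * G * G)"
    proof (intro add_left_mono sum_mono mult_mono order_refl)
      fix y assume "y \<in> children d v"
      then obtain a where y: "y = a # v" "a # v \<in> tree_verts d" by (rule in_childrenD)
      have "closed_walks d (?H - {v}) y = closed_walks d {u \<in> ?H - {v}. suffix y u} y"
        unfolding y by (rule closed_walks_restrict) (auto intro: suffix_step)
      also have "\<dots> \<subseteq> closed_walks d (below d y) y"
        by (rule closed_walks_mono) (auto simp: below_def)
      finally have "T N (?H - {v}) y \<le> T N (below d y) y"
        unfolding T_def by (auto simp: nn_integral_count_space_indicator intro!: nn_integral_mono split: split_indicator)
      also have "\<dots> \<le> G" using y by (intro Suc.IH) auto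
      finally show "T N (?H - {v}) y \<le> G" .
      show "T N ?H v \<le> G" by (rule Suc.IH[OF Suc.prems])
    qed auto
    also have "\<dots> = 1 + of_nat (d - 1) * z\<^sup>2 * G\<^sup>2"
      using Suc.prems by (simp add: card_children power2_eq_square mult_ac)
    also have "\<dots> \<le> G" by fact
    finally show ?case .
  qed (simp add: T_def)
  have "green d z (below d v) v = (\<integral>\<^sup>+l. (SUP N. z ^ length l * of_bool (length l < N)) \<partial>count_space (closed_walks d (below d v) v))"
    unfolding green_def
  proof (intro nn_integral_cong antisym)
    fix l :: "nat list list"
    show "z ^ length l \<le> (SUP N. z ^ length l * of_bool (length l < N))"
      by (rule SUP_upper2[of "Suc (length l)"]) auto
    show "(SUP N. z ^ length l * of_bool (length l < N)) \<le> z ^ length l"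
      by (rule SUP_least) auto
  qed
  also have "\<dots> = (SUP N. T N (below d v) v)"
    unfolding T_def
    by (rule nn_integral_monotone_convergence_SUP) (auto simp: incseq_def le_fun_def)
  also have "\<dots> \<le> G" using T[OF v] by (intro SUP_least)
  finally show ?thesis .
qed

text \<open>Taking the infimum over all subtrees avoids showing that they are isomorphic. Bounding
  every child from below by \<open>I\<close> in the recursion shows that \<open>I\<close> is
  infinite or lies between the roots of the quadratic.\<close>

lemma green_top_ge:
  fixes d :: nat and I z :: ennreal
  defines "I \<equiv> (INF v\<in>{v \<in> tree_verts d. v \<noteq> []}. green d z (below d v) v)"
  shows "1 + of_nat (d - 1) * z\<^sup>2 * I\<^sup>2 \<le> I"
proof -
  have I: "I \<le> green d z (below d v) v" if "v \<in> tree_verts d" "v \<noteq> []" for v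
    unfolding I_def using that by (intro INF_lower) auto
  have "1 + of_nat (d - 1) * z\<^sup>2 * I\<^sup>2 \<le> green d z (below d v) v" if v: "v \<in> tree_verts d" "v \<noteq> []" for v
  proof -
    have "of_nat (d - 1) * z\<^sup>2 * I\<^sup>2 = (\<Sum>y\<in>children d v. z\<^sup>2 * I) * I"
      using v by (simp add: card_children power2_eq_square mult_ac)
    also have "\<dots> \<le> first_return d z (below d v) v * green d z (below d v) v"
      unfolding first_return_top[OF v]
    proof (intro mult_mono sum_mono order_refl)
      fix y assume "y \<in> children d v"
      then obtain a where y: "y = a # v" "a # v \<in> tree_verts d" by (rule in_childrenD)
      then show "I \<le> green d z (below d y) y" by (intro I) auto
    qed (use I v in auto)
    finally show ?thesis
      by (subst green_eq) (use v in \<open>auto simp: below_self\<close>)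
  qed
  then show ?thesis unfolding I_def by (intro INF_greatest) auto
qed

text \<open>The quadratic b z^2 i^2 - i + 1, with b = d - 1, then has negative discriminant, so no
  finite infimum satisfies the inequality of \<open>green_top_ge\<close>.\<close>

lemma green_top_infinite:
  assumes z: "4 * (real d - 1) * z\<^sup>2 > 1" "z > 0" and d: "d \<ge> 1" and v: "v \<in> tree_verts d" "v \<noteq> []"
  shows "green d (ennreal z) (below d v) v = \<infinity>"
proof -
  define I where "I = (INF v\<in>{v \<in> tree_verts d. v \<noteq> []}. green d (ennreal z) (below d v) v)"
  have I: "1 + of_nat (d - 1) * (ennreal z)\<^sup>2 * I\<^sup>2 \<le> I"
    unfolding I_def by (rule green_top_ge)
  have "I = \<infinity>"
  proof (cases I)
    case (real i)
    have "ennreal (1 + (real d - 1) * z\<^sup>2 * i\<^sup>2) \<le> ennreal i"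
      using I real z d by (simp add: ennreal_of_nat_eq_real_of_nat ennreal_power of_nat_diff flip: ennreal_mult ennreal_1 ennreal_plus)
    then have le: "1 + (real d - 1) * z\<^sup>2 * i\<^sup>2 \<le> i" using real by simp
    then have "i > 0" using d by (smt (verit) mult_nonneg_nonneg of_nat_1 of_nat_le_iff zero_le_power2)
    then have "(4 * (real d - 1) * z\<^sup>2) * i\<^sup>2 > 1 * i\<^sup>2"
      by (intro mult_strict_right_mono) (use z in auto)
    moreover have "(i / 2 - 1)\<^sup>2 \<ge> 0" by simp
    ultimately show ?thesis using le by (simp add: power2_eq_square algebra_simps)
  qed simp
  moreover have "I \<le> green d (ennreal z) (below d v) v"
    unfolding I_def using v by (intro INF_lower) auto
  ultimately show ?thesis by (simp add: top_unique)
qed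

text \<open>The parametrisation of the weight per step by \<open>\<rho> = z\<^sup>2 g\<^sup>2\<close>, where \<open>g\<close> is the Green function
  of the subtree below a vertex, rationalises all Green functions.\<close>

definition step_weight :: "nat \<Rightarrow> real \<Rightarrow> real" where
  "step_weight d \<rho> = sqrt \<rho> / (1 + (real d - 1) * \<rho>)"

text \<open>The weight is the same for \<rho> and 1/(b^2 \<rho>) with b = d - 1. The bound
  \<open>rho_le\<close> selects the smaller value, which belongs to the smaller root of the
  quadratic, that is, to the Green function; equality is the critical weight.\<close>

locale rho_tree =
  fixes d :: nat and \<rho> :: real
  assumes d_ge: "d \<ge> 3" and rho_pos: "\<rho> > 0" and rho_le: "(real d - 1) * \<rho> \<le> 1"
begin

abbreviation "z \<equiv> step_weight d \<rho>"

abbreviation "g \<equiv> 1 + (real d - 1) * \<rho>"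

lemma g_pos: "g > 0"
  using d_ge rho_pos by (intro add_pos_nonneg) auto

lemma z_pos: "z > 0"
  using g_pos rho_pos by (simp add: step_weight_def)

lemma z2_g: "z\<^sup>2 * g = \<rho> / g" "z\<^sup>2 * g\<^sup>2 = \<rho>"
  using g_pos rho_pos by (simp_all add: step_weight_def power_divide power2_eq_square)

lemma rho_lt1: "\<rho> < 1"
proof -
  have "2 * \<rho> \<le> (real d - 1) * \<rho>" using d_ge rho_pos by (intro mult_right_mono) auto
  then show ?thesis using rho_le rho_pos by linarith
qed

text \<open>\<open>g\<close> solves the quadratic, so it is an upper bound by
  \<open>green_top_le\<close>; the infimum over subtrees cannot be smaller, because \<open>g\<close>
  is the smaller root.\<close>

lemma green_top:
  assumes v: "v \<in> tree_verts d" "v \<noteq> []"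
  shows "green d z (below d v) v = ennreal g"
proof -
  define I where "I = (INF v\<in>{v \<in> tree_verts d. v \<noteq> []}. green d (ennreal z) (below d v) v)"
  have I: "1 + of_nat (d - 1) * (ennreal z)\<^sup>2 * I\<^sup>2 \<le> I"
    unfolding I_def by (rule green_top_ge)
  have Iv: "I \<le> green d (ennreal z) (below d v) v"
    unfolding I_def using v by (intro INF_lower) auto
  have conv: "1 + of_nat (d - 1) * (ennreal z)\<^sup>2 * (ennreal i)\<^sup>2 = ennreal (1 + (real d - 1) * z\<^sup>2 * i\<^sup>2)" if "i \<ge> 0" for i
    using that z_pos d_ge by (simp add: ennreal_of_nat_eq_real_of_nat ennreal_power of_nat_diff flip: ennreal_mult ennreal_1 ennreal_plus)
  have fix_g: "(real d - 1) * z\<^sup>2 * g\<^sup>2 = (real d - 1) * \<rho>"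
    using z2_g(2) by (metis mult.assoc)
  have upper: "green d z (below d v) v \<le> ennreal g"
    using g_pos by (intro green_top_le v) (simp only: conv less_imp_le fix_g order_refl)
  then have "I \<le> ennreal g" using Iv by (rule order_trans[rotated])
  then obtain i where i: "I = ennreal i" "i \<ge> 0" "i \<le> g"
    using g_pos by (cases I) (auto simp: top_unique)
  have "1 + (real d - 1) * z\<^sup>2 * i\<^sup>2 \<le> i"
    using I i unfolding i(1) conv[OF i(2)] by simp
  then have "g\<^sup>2 * (1 + (real d - 1) * z\<^sup>2 * i\<^sup>2) \<le> g\<^sup>2 * i" by (intro mult_left_mono) auto
  also have "g\<^sup>2 * (1 + (real d - 1) * z\<^sup>2 * i\<^sup>2) = g\<^sup>2 + (real d - 1) * (z\<^sup>2 * g\<^sup>2) * i\<^sup>2"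
    by (simp only: algebra_simps)
  \<comment> \<open>The factors show the roots \<open>g\<close> and g/((d - 1) \<rho>), the second
    at least \<open>g\<close> by \<open>rho_le\<close>.\<close>
  finally have "(i - g) * (((real d - 1) * \<rho>) * i - g) \<le> 0"
    unfolding z2_g by (simp add: power2_eq_square algebra_simps)
  moreover have "((real d - 1) * \<rho>) * i \<le> 1 * i" using rho_le i by (intro mult_right_mono) auto
  ultimately have "i \<ge> g" using mult_neg_neg[of "i - g" "((real d - 1) * \<rho>) * i - g"] by force
  with i Iv upper show ?thesis by auto
qed

text \<open>The Green function at a vertex \<open>n\<close> levels below the top of a subtree, with
  the branch of one child of that vertex removed, as \<open>green_branch\<close> shows.\<close>

definition branch_green :: "nat \<Rightarrow> real" where
  "branch_green n = g * (1 - \<rho> ^ (n + 1)) / (1 - \<rho> ^ (n + 2))"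

lemma rho_power_lt1: "n > 0 \<Longrightarrow> \<rho> ^ n < 1"
  using rho_lt1 rho_pos power_Suc_less_one[of \<rho>] by (cases n) (auto simp: power_Suc_less_one)

lemma branch_green_pos: "branch_green n > 0"
  unfolding branch_green_def using g_pos rho_power_lt1[of "n + 1"] rho_power_lt1[of "n + 2"]
  by (intro divide_pos_pos mult_pos_pos) auto

text \<open>One minus the first-return function at depth n + 1 in a full subtree: d - 1 child
  branches contribute z^2 \<open>g\<close> each, the parent contributes the other term.\<close>

lemma branch_green_aux:
  "1 - (real d - 1) * (z\<^sup>2 * g) - z\<^sup>2 * branch_green n = (1 - \<rho>) / (1 - \<rho> ^ (n + 2)) / g"
proof -
  have q: "1 - \<rho> ^ (n + 2) > 0" using rho_power_lt1[of "n + 2"] by simp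
  have "z\<^sup>2 * branch_green n = \<rho> / g * ((1 - \<rho> ^ (n + 1)) / (1 - \<rho> ^ (n + 2)))"
    unfolding branch_green_def z2_g(1)[symmetric] by simp
  moreover have "1 - (real d - 1) * (z\<^sup>2 * g) = 1 / g"
    unfolding z2_g using g_pos by (simp add: field_simps)
  ultimately have "1 - (real d - 1) * (z\<^sup>2 * g) - z\<^sup>2 * branch_green n = (1 - \<rho> * ((1 - \<rho> ^ (n + 1)) / (1 - \<rho> ^ (n + 2)))) / g"
    by (simp add: diff_divide_distrib)
  also have "1 - \<rho> * ((1 - \<rho> ^ (n + 1)) / (1 - \<rho> ^ (n + 2))) = (1 - \<rho>) / (1 - \<rho> ^ (n + 2))"
    using q by (simp add: field_simps)
  finally show ?thesis .
qed

lemma sum_children_green: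
  assumes "C \<subseteq> children d x"
  shows "(\<Sum>y\<in>C. (ennreal z)\<^sup>2 * green d z (below d y) y) = ennreal (real (card C) * (z\<^sup>2 * g))"
proof -
  have "(ennreal z)\<^sup>2 * green d z (below d y) y = ennreal (z\<^sup>2 * g)" if "y \<in> C" for y
  proof -
    have "y \<in> tree_verts d" "y \<noteq> []" using that assms by (auto elim!: in_childrenD dest!: subsetD)
    then show ?thesis using g_pos z_pos by (simp add: green_top ennreal_power flip: ennreal_mult)
  qed
  then show ?thesis using g_pos z_pos
    by (simp add: ennreal_of_nat_eq_real_of_nat flip: ennreal_mult)
qed

text \<open>\<open>K\<close> is the removed part: the branch of one child in
  \<open>green_branch\<close>, nothing in \<open>loop_mass_below\<close>. Children outside
  \<open>K\<close> keep their full branches; there is a parent unless \<open>x\<close> is the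
  top.\<close>

lemma first_return_below:
  assumes v: "v \<noteq> []" and x: "x \<in> below d v" and H: "H = below d v - K" "x \<notin> K"
    "\<And>y. y \<in> children d x \<Longrightarrow> y \<notin> K \<Longrightarrow> below d y \<inter> K = {}" "K \<inter> {tl x} = {}"
  shows "first_return d z H x =
    ennreal (real (card (children d x - K)) * (z\<^sup>2 * g)) +
    (if x = v then 0 else (ennreal z)\<^sup>2 * green d z (H - below d x) (tl x))"
proof -
  have xv: "x \<in> tree_verts d" "suffix v x" using x by (auto simp: below_def)
  have HT: "H \<subseteq> tree_verts d" using below_subset_verts H by blast
  have child: "green d z (H - {x}) y = green d z (below d y) y" if y: "y \<in> children d x - K" for y
  proof -
    from y obtain a where a: "y = a # x" "a # x \<in> tree_verts d" by (auto elim: in_childrenD)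
    have "below d y \<subseteq> below d v" unfolding a using xv by (intro below_mono) (simp add: suffix_ConsI)
    then have "below d y \<subseteq> H" using H(1,3) y by auto
    with a HT show ?thesis using green_child by blast
  qed
  have nb: "nbrs d H x = nbrs d (below d v) x - K" using H by (auto simp: nbrs_def)
  show ?thesis
  proof (cases "x = v")
    case True
    then have "nbrs d H x = children d x - K"
      using nb nbrs_below_top[OF xv(1)] v by auto
    then have "first_return d z H x = (\<Sum>y\<in>children d x - K. (ennreal z)\<^sup>2 * green d z (below d y) y)"
      by (simp add: first_return_def child)
    with True show ?thesis using sum_children_green[of "children d x - K" x] by simp
  next
    case False
    have x0: "x \<noteq> []" using xv v by auto
    have eq: "nbrs d H x = insert (tl x) (children d x - K)"
      using nb nbrs_below(1)[OF x False] H(4) by auto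
    have par: "green d z (H - {x}) (tl x) = green d z (H - below d x) (tl x)"
      using green_parent[of "hd x" "tl x" H d] HT x0 x H by auto
    have "first_return d z H x = (ennreal z)\<^sup>2 * green d z (H - below d x) (tl x) +
        (\<Sum>y\<in>children d x - K. (ennreal z)\<^sup>2 * green d z (below d y) y)"
      unfolding first_return_def eq using nbrs_below(3)[OF x False]
      by (subst sum.insert) (auto simp: child par)
    with False show ?thesis using sum_children_green[of "children d x - K" x] by (simp add: add.commute)
  qed
qed

text \<open>Induction on the depth of \<open>x\<close>: seen from \<open>x\<close>, the parent is a
  vertex one level higher with the branch of \<open>x\<close> removed, so its Green function is
  known.\<close>

lemma green_branch:
  assumes "v \<noteq> []" "x \<in> below d v" "y \<in> children d x" "length x = length v + n"
  shows "green d z (below d v - below d y) x = ennreal (branch_green n)"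
  using assms
proof (induction n arbitrary: x y)
  \<comment> \<open>Common part of both cases; \<open>e\<close> is the contribution of the parent,
    zero at the top.\<close>
  have step: "green d z (below d v - below d y) x = ennreal (branch_green n)"
    if x: "x \<in> below d v" "y \<in> children d x" and v: "v \<noteq> []"
      and e: "(if x = v then 0 else (ennreal z)\<^sup>2 * green d z (below d v - below d y - below d x) (tl x)) = ennreal e"
      and e2: "e \<ge> 0" "1 - (real d - 1) * (z\<^sup>2 * g) - e + z\<^sup>2 * g = 1 / branch_green n"
    for x y n e
  proof -
    obtain a where a: "y = a # x" "a # x \<in> tree_verts d" using x(2) by (rule in_childrenD)
    have xv: "x \<in> tree_verts d" "suffix v x" "x \<noteq> []" using x v by (auto simp: below_def)
    have nsuf: "\<not> suffix (a # x) x" by (auto dest: suffix_length_le)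
    then have "u \<notin> below d y" if "u \<in> children d x" "u \<noteq> y" for u
      using that a by (auto simp: children_def below_def tree_adj_def suffix_Cons)
    moreover have "y \<in> below d y" using a by (simp add: below_self)
    ultimately have K: "children d x - below d y = children d x - {y}" by blast
    have disj: "below d u \<inter> below d y = {}" if "u \<in> children d x" "u \<notin> below d y" for u
    proof (rule ccontr)
      assume "below d u \<inter> below d y \<noteq> {}"
      then obtain w where "suffix u w" "suffix y w" by (auto simp: below_def)
      moreover have "length u = length y" using that a by (auto simp: children_def)
      ultimately have "u = y" by (metis suffix_same_cases suffix_length_le suffix_order.antisym
            length_append same_suffix_suffix order_refl suffix_length_suffix)
      then show False using that a by (simp add: below_self)
    qed
    have "first_return d z (below d v - below d y) x = ennreal (real (card (children d x - below d y)) * (z\<^sup>2 * g)) + ennreal e"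
      unfolding e[symmetric]
    proof (rule first_return_below[OF v x(1) refl _ disj])
      show "x \<notin> below d y" "below d y \<inter> {tl x} = {}"
        unfolding a by (auto simp: below_def dest: suffix_length_le)
    qed
    also have "card (children d x - below d y) = d - 2"
      unfolding K using x(2) xv by (simp add: card_children)
    also have "ennreal (real (d - 2) * (z\<^sup>2 * g)) + ennreal e = ennreal (real (d - 2) * (z\<^sup>2 * g) + e)"
      using e2 g_pos by (subst ennreal_plus) auto
    also have "real (d - 2) * (z\<^sup>2 * g) + e = 1 - 1 / branch_green n"
      using e2 d_ge by (simp add: of_nat_diff algebra_simps)
    finally have fr: "first_return d z (below d v - below d y) x = ennreal (1 - 1 / branch_green n)" .
    have "1 - 1 / branch_green n = real (d - 2) * (z\<^sup>2 * g) + e"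
      using e2 d_ge by (simp add: of_nat_diff algebra_simps)
    also have "\<dots> \<ge> 0" using e2 g_pos by auto
    finally have "1 - 1 / branch_green n \<ge> 0" .
    moreover have "x \<in> below d v - below d y" using x(1) unfolding a by (auto simp: below_def dest: suffix_length_le)
    ultimately show ?thesis
      using green_real(1)[OF _ fr] branch_green_pos[of n] by simp
  qed
  have inv: "1 / branch_green n = (1 - \<rho> ^ (n + 2)) / (1 - \<rho> ^ (n + 1)) / g" for n
    unfolding branch_green_def by (simp add: field_simps)
  have one: "1 - (real d - 1) * (z\<^sup>2 * g) = 1 / g"
    unfolding z2_g using g_pos by (simp add: field_simps)
  {
    case 0
    then have "x = v" by (auto simp: below_def suffix_def)
    moreover have "1 - \<rho> ^ (0 + 2) = (1 - \<rho>) * (1 + \<rho>)"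
      by (simp add: power2_eq_square algebra_simps)
    then have "1 - (real d - 1) * (z\<^sup>2 * g) - 0 + z\<^sup>2 * g = 1 / branch_green 0"
      unfolding inv one unfolding z2_g using rho_lt1 by (simp add: add_divide_distrib)
    ultimately show ?case using 0 by (intro step[of x y 0]) auto
  next
    case (Suc n)
    have xv: "x \<noteq> v" "x \<noteq> []" using Suc.prems by auto
    have x: "x \<in> tree_verts d" using Suc.prems by (auto simp: below_def)
    have t: "tl x \<in> below d v" using nbrs_below(2) Suc.prems xv by blast
    have "x \<in> children d (tl x)" using xv x t
      by (cases x) (auto simp: children_def tree_adj_def below_def)
    then have IH: "green d z (below d v - below d x) (tl x) = ennreal (branch_green n)"
      using Suc.prems t by (intro Suc.IH) auto
    have "below d v - below d y - below d x = below d v - below d x"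
      using Suc.prems(3) below_mono[of x y d] by (auto elim!: in_childrenD simp: suffix_ConsI)
    then have e: "(if x = v then 0 else (ennreal z)\<^sup>2 * green d z (below d v - below d y - below d x) (tl x)) = ennreal (z\<^sup>2 * branch_green n)"
      using xv IH z_pos branch_green_pos[of n] by (simp add: ennreal_power ennreal_mult less_imp_le)
    have "1 - (real d - 1) * (z\<^sup>2 * g) - z\<^sup>2 * branch_green n + z\<^sup>2 * g = 1 / branch_green (Suc n)"
    proof -
      have "1 - \<rho> ^ (n + 2) > 0" using rho_power_lt1[of "n + 2"] by simp
      then have "(1 - \<rho>) / (1 - \<rho> ^ (n + 2)) + \<rho> = (1 - \<rho> ^ (Suc n + 2)) / (1 - \<rho> ^ (Suc n + 1))"
        by (simp add: field_simps)
      then show ?thesis unfolding branch_green_aux inv unfolding z2_g by (simp only: add_divide_distrib[symmetric])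
    qed
    then show ?case
      using Suc.prems branch_green_pos[of n] by (intro step[OF _ _ _ e]) auto
  }
qed

lemma loop_mass_top:
  assumes "v \<in> tree_verts d" "v \<noteq> []"
  shows "loop_mass d z (below d v) v = ennreal (ln g)"
proof -
  have "first_return d z (below d v) v = ennreal (real (d - 1) * (z\<^sup>2 * g))"
    unfolding first_return_top[OF assms] using assms
    by (simp add: sum_children_green[OF order_refl] card_children)
  also have "real (d - 1) * (z\<^sup>2 * g) = 1 - 1 / g"
    unfolding z2_g using g_pos d_ge by (simp add: of_nat_diff field_simps)
  finally have fr: "first_return d z (below d v) v = ennreal (1 - 1 / g)" .
  have "g \<ge> 1" using d_ge rho_pos by auto
  then show ?thesis using green_real(2)[OF below_self[OF assms(1)] fr] by (simp add: ln_div)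
qed

lemma loop_mass_below:
  assumes "v \<noteq> []" "x \<in> below d v" "length x = length v + Suc n"
  shows "loop_mass d z (below d v) x = ennreal (ln g + ln ((1 - \<rho> ^ (n + 2)) / (1 - \<rho>)))"
proof -
  have xv: "x \<noteq> v" "x \<noteq> []" using assms by auto
  have x: "x \<in> tree_verts d" using assms by (auto simp: below_def)
  have t: "tl x \<in> below d v" using nbrs_below(2) assms xv by blast
  have "x \<in> children d (tl x)" using xv x t
    by (cases x) (auto simp: children_def tree_adj_def below_def)
  then have G: "green d z (below d v - below d x) (tl x) = ennreal (branch_green n)"
    using assms t by (intro green_branch) auto
  have "first_return d z (below d v) x = ennreal (real (card (children d x - {})) * (z\<^sup>2 * g)) +
     (if x = v then 0 else (ennreal z)\<^sup>2 * green d z (below d v - below d x) (tl x))"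
    by (rule first_return_below) (use assms in auto)
  also have "\<dots> = ennreal (real (d - 1) * (z\<^sup>2 * g)) + ennreal (z\<^sup>2 * branch_green n)"
    using xv x G z_pos branch_green_pos[of n] by (simp add: card_children ennreal_power ennreal_mult less_imp_le)
  also have "\<dots> = ennreal (real (d - 1) * (z\<^sup>2 * g) + z\<^sup>2 * branch_green n)"
    using branch_green_pos[of n] g_pos by (subst ennreal_plus) auto
  also have "real (d - 1) * (z\<^sup>2 * g) + z\<^sup>2 * branch_green n = 1 - (1 - \<rho>) / (1 - \<rho> ^ (n + 2)) / g"
    using branch_green_aux[of n] d_ge by (simp add: of_nat_diff)
  finally have fr: "first_return d z (below d v) x = ennreal (1 - (1 - \<rho>) / (1 - \<rho> ^ (n + 2)) / g)" .
  have q: "1 - \<rho> > 0" "1 - \<rho> ^ (n + 2) > 0" using rho_lt1 rho_power_lt1[of "n + 2"] by auto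
  have "\<rho> ^ (n + 2) \<le> \<rho> ^ 1" using rho_pos rho_lt1 by (intro power_decreasing) auto
  then have "(1 - \<rho>) / (1 - \<rho> ^ (n + 2)) \<le> 1" using q by simp
  also have "1 \<le> g" using d_ge rho_pos by auto
  finally have "(1 - \<rho>) / (1 - \<rho> ^ (n + 2)) / g \<le> 1" using g_pos by (simp only: divide_le_eq_1_pos)
  then have "loop_mass d z (below d v) x = ennreal (- ln (1 - (1 - (1 - \<rho>) / (1 - \<rho> ^ (n + 2)) / g)))"
    using q g_pos by (intro green_real(2)[OF assms(2) fr]) auto
  also have "- ln (1 - (1 - (1 - \<rho>) / (1 - \<rho> ^ (n + 2)) / g)) = ln g + ln ((1 - \<rho> ^ (n + 2)) / (1 - \<rho>))"
    using q g_pos by (simp add: ln_div ln_mult)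
  finally show ?thesis .
qed

text \<open>Makes the number of open loops through the root finite. After clearing \<open>g\<close>
  the condition on the first-return function reads \<rho> < 1, so it holds up to and including the
  critical weight.\<close>

lemma loop_mass_root_finite:
  "loop_mass d z (tree_verts d) [] < \<infinity>"
proof -
  have r: "[] \<in> tree_verts d" by (simp add: tree_verts_def)
  have "first_return d z (tree_verts d) [] = ennreal (real d * (z\<^sup>2 * g))"
    unfolding first_return_root using r by (simp add: sum_children_green[OF order_refl] card_children)
  moreover have "real d * (z\<^sup>2 * g) < 1"
    unfolding z2_g using g_pos rho_lt1 by (simp add: field_simps)
  ultimately show ?thesis using green_real(2)[OF r] g_pos by simp
qed

end

section \<open>Random sets with independent membership\<close>

text \<open>Clusters depend only on which loops occur, not on how often. So the soup is reduced to
  independent events of probability 1 - exp(- m), the chance that a Poisson variable with mean m is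
  positive.\<close>

locale random_set = prob_space M for M :: "'a measure" +
  fixes I :: "'i set" and ev :: "'i \<Rightarrow> 'a set" and m :: "'i \<Rightarrow> real"
  assumes countable_I: "countable I"
    and indep_ev: "indep_events ev I"
    and prob_ev: "i \<in> I \<Longrightarrow> prob (ev i) = 1 - exp (- m i)"
    and m_nonneg: "i \<in> I \<Longrightarrow> m i \<ge> 0"
begin

text \<open>The events decided by the members of \<open>A\<close>. Disjoint index sets give
  independent sigma-algebras, which is the source of every product formula below.\<close>

definition info :: "'i set \<Rightarrow> 'a set set" where
  "info A = sigma_sets (space M) (ev ` A)"

definition hit :: "'i set \<Rightarrow> 'a set" where
  "hit A = \<Union>(ev ` A)"

lemma ev_sets: "i \<in> I \<Longrightarrow> ev i \<in> events"
  using indep_ev by (auto simp: indep_events_def)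

lemma info_events: "A \<subseteq> I \<Longrightarrow> X \<in> info A \<Longrightarrow> X \<in> events"
  unfolding info_def using ev_sets sets.sigma_sets_subset[of "ev ` A" M] by blast

lemma sigma_algebra_info: "A \<subseteq> I \<Longrightarrow> sigma_algebra (space M) (info A)"
  unfolding info_def using ev_sets sets.sets_into_space by (intro sigma_algebra_sigma_sets) blast

lemma info_mono: "A \<subseteq> B \<Longrightarrow> info A \<subseteq> info B"
  unfolding info_def by (intro sigma_sets_mono') auto

lemma space_info: "space M \<in> info A"
  unfolding info_def by (rule sigma_sets_top)

lemma info_compl: "X \<in> info A \<Longrightarrow> space M - X \<in> info A"
  unfolding info_def by (rule sigma_sets.Compl)

lemma info_UN:
  assumes "A \<subseteq> I" "countable J" "\<And>j. j \<in> J \<Longrightarrow> X j \<in> info A"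
  shows "\<Union>(X ` J) \<in> info A"
proof -
  interpret sigma_algebra "space M" "info A" by (rule sigma_algebra_info) fact
  show ?thesis using assms by (intro countable_UN') auto
qed

lemma info_INT:
  assumes "A \<subseteq> I" "finite J" "\<And>j. j \<in> J \<Longrightarrow> X j \<in> info A"
  shows "space M \<inter> \<Inter>(X ` J) \<in> info A"
proof -
  interpret sigma_algebra "space M" "info A" by (rule sigma_algebra_info) fact
  show ?thesis using assms(2,3)
  proof induction
    case (insert j J)
    have "space M \<inter> \<Inter>(X ` insert j J) = X j \<inter> (space M \<inter> \<Inter>(X ` J))" by auto
    then show ?case using insert by auto
  qed auto
qed

lemma info_Int: "A \<subseteq> I \<Longrightarrow> X \<in> info A \<Longrightarrow> Y \<in> info A \<Longrightarrow> X \<inter> Y \<in> info A"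
proof -
  assume "A \<subseteq> I" and X: "X \<in> info A" "Y \<in> info A"
  then interpret sigma_algebra "space M" "info A" by (intro sigma_algebra_info)
  show ?thesis using X by (rule Int)
qed

lemma info_hit:
  assumes "B \<subseteq> A" "A \<subseteq> I"
  shows "hit B \<in> info A"
  unfolding hit_def
proof (rule info_UN[OF assms(2)])
  show "countable B" using assms countable_I by (meson countable_subset subset_trans)
  show "ev j \<in> info A" if "j \<in> B" for j using that assms by (auto simp: info_def)
qed

lemma hit_events: "A \<subseteq> I \<Longrightarrow> hit A \<in> events"
  using info_hit[of A A] info_events by blast

text \<open>Intersecting with the space also covers the empty family, whose bare intersection would
  be \<open>UNIV\<close>.\<close>

lemma prob_info_INT:
  assumes "finite J" "disjoint_family_on A J" "\<And>j. j \<in> J \<Longrightarrow> A j \<subseteq> I" "\<And>j. j \<in> J \<Longrightarrow> X j \<in> info (A j)"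
  shows "prob (space M \<inter> \<Inter>(X ` J)) = (\<Prod>j\<in>J. prob (X j))"
proof (cases "J = {}")
  case False
  have "indep_sets (\<lambda>j. sigma_sets (space M) (\<Union>i\<in>A j. {ev i})) J"
  proof (rule indep_sets_collect_sigma)
    show "indep_sets (\<lambda>i. {ev i}) (\<Union>j\<in>J. A j)"
      using indep_ev[unfolded indep_events_def_alt] by (rule indep_sets_mono_index[rotated]) (use assms(3) in auto)
  qed (use assms in \<open>auto simp: Int_stable_def\<close>)
  moreover have "(\<Union>i\<in>A j. {ev i}) = ev ` A j" for j by auto
  ultimately have "indep_sets (\<lambda>j. info (A j)) J" by (simp add: info_def)
  then have "prob (\<Inter>(X ` J)) = (\<Prod>j\<in>J. prob (X j))"
    using assms False by (intro indep_setsD) auto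
  moreover have "\<Inter>(X ` J) \<subseteq> space M"
    using False info_events[OF assms(3,4)] sets.sets_into_space by blast
  ultimately show ?thesis by (simp add: Int_absorb1)
qed (simp add: prob_space)

lemma prob_info_Int:
  assumes "A \<inter> B = {}" "A \<subseteq> I" "B \<subseteq> I" "X \<in> info A" "Y \<in> info B"
  shows "prob (X \<inter> Y) = prob X * prob Y"
proof -
  have "disjoint_family_on (case_bool A B) UNIV"
    using assms by (auto simp: disjoint_family_on_def split: bool.splits)
  then have "prob (space M \<inter> \<Inter>(case_bool X Y ` UNIV)) = (\<Prod>j\<in>UNIV. prob (case_bool X Y j))"
    using assms by (intro prob_info_INT[of _ "case_bool A B"]) (auto split: bool.splits)
  moreover have "space M \<inter> (X \<inter> Y) = X \<inter> Y"
    using info_events[OF assms(2,4)] sets.sets_into_space by blast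
  ultimately show ?thesis by (simp add: UNIV_bool Int_commute mult.commute)
qed

lemma prob_no_hit_finite:
  assumes "finite A" "A \<subseteq> I"
  shows "prob (space M - hit A) = exp (- (\<Sum>i\<in>A. m i))"
proof -
  have "space M - hit A = space M \<inter> \<Inter>((\<lambda>i. space M - ev i) ` A)"
    by (auto simp: hit_def)
  also have "prob \<dots> = (\<Prod>i\<in>A. prob (space M - ev i))"
  proof (rule prob_info_INT[where A = "\<lambda>i. {i}"])
    show "space M - ev j \<in> info {j}" for j
      by (rule info_compl) (auto simp: info_def)
  qed (use assms in \<open>auto simp: disjoint_family_on_def\<close>)
  also have "\<dots> = (\<Prod>i\<in>A. exp (- m i))"
    using assms(2) by (intro prod.cong) (auto simp: prob_compl ev_sets prob_ev)
  also have "\<dots> = exp (- (\<Sum>i\<in>A. m i))"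
    using assms(1) by (simp add: exp_sum flip: sum_negf)
  finally show ?thesis .
qed

text \<open>The void probability of a Poisson process. An infinite \<open>A\<close> is exhausted by
  finite sets; continuity from above passes to the limit, which is 0 when the total mass
  diverges.\<close>

lemma prob_no_hit:
  assumes A: "A \<subseteq> I" and t: "(\<integral>\<^sup>+i. ennreal (m i) \<partial>count_space A) = t"
  shows "prob (space M - hit A) = (if t = \<infinity> then 0 else exp (- enn2real t))"
proof (cases "finite A")
  case True
  have "t = ennreal (\<Sum>i\<in>A. m i)"
    unfolding t[symmetric] using True A m_nonneg by (subst nn_integral_count_space_finite) (auto simp: sum_ennreal subset_eq)
  moreover have "(\<Sum>i\<in>A. m i) \<ge> 0" using A m_nonneg by (intro sum_nonneg) auto
  ultimately show ?thesis using prob_no_hit_finite[OF True A] by simp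
next
  case False
  have cA: "countable A" using A countable_I by (rule countable_subset)
  let ?f = "from_nat_into A"
  note bij = bij_betw_from_nat_into[OF cA False]
  have fA: "?f n \<in> A" for n using False by (intro from_nat_into) auto
  have mf: "m (?f n) \<ge> 0" for n using fA A m_nonneg by blast
  define B where "B n = space M - hit (?f ` {..<n})" for n
  have "(\<lambda>n. prob (B n)) \<longlonglongrightarrow> prob (\<Inter>n. B n)"
  proof (rule finite_Lim_measure_decseq)
    show "range B \<subseteq> events" unfolding B_def using fA A by (auto intro!: sets.compl_sets hit_events)
    show "decseq B" by (auto simp: decseq_def B_def hit_def)
  qed
  moreover have "(\<Inter>n. B n) = space M - hit A"
  proof -
    have "hit A = (\<Union>n. hit (?f ` {..<n}))"
    proof
      show "hit A \<subseteq> (\<Union>n. hit (?f ` {..<n}))"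
      proof
        fix x assume "x \<in> hit A"
        then obtain i where i: "i \<in> A" "x \<in> ev i" by (auto simp: hit_def)
        then obtain n where "i = ?f n" using bij by (metis bij_betw_imp_surj_on imageE)
        then have "x \<in> hit (?f ` {..<Suc n})" using i unfolding hit_def by blast
        then show "x \<in> (\<Union>n. hit (?f ` {..<n}))" by blast
      qed
      show "(\<Union>n. hit (?f ` {..<n})) \<subseteq> hit A" using fA unfolding hit_def by blast
    qed
    then show ?thesis unfolding B_def by blast
  qed
  moreover have "prob (B n) = exp (- (\<Sum>i<n. m (?f i)))" for n
  proof -
    have "inj_on ?f {..<n}" using bij by (auto simp: bij_betw_def intro: inj_on_subset)
    then have "(\<Sum>i\<in>?f ` {..<n}. m i) = (\<Sum>i<n. m (?f i))" by (simp add: sum.reindex)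
    then show ?thesis unfolding B_def using fA A by (subst prob_no_hit_finite) auto
  qed
  ultimately have lim: "(\<lambda>n. exp (- (\<Sum>i<n. m (?f i)))) \<longlonglongrightarrow> prob (space M - hit A)" by simp
  have t': "t = (\<Sum>n. ennreal (m (?f n)))"
    unfolding t[symmetric] nn_integral_bij_count_space[OF bij, symmetric] nn_integral_count_space_nat ..
  have "(\<lambda>n. \<Sum>i<n. ennreal (m (?f i))) \<longlonglongrightarrow> t"
    unfolding t' by (rule summable_LIMSEQ[OF summableI])
  moreover have "(\<Sum>i<n. ennreal (m (?f i))) = ennreal (\<Sum>i<n. m (?f i))" for n
    by (rule sum_ennreal) (rule mf)
  ultimately have tl: "(\<lambda>n. ennreal (\<Sum>i<n. m (?f i))) \<longlonglongrightarrow> t" by simp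
  show ?thesis
  proof (cases t)
    case (real r)
    have "(\<lambda>n. \<Sum>i<n. m (?f i)) \<longlonglongrightarrow> r"
    proof (rule tendsto_ennrealD)
      show "(\<lambda>n. ennreal (\<Sum>i<n. m (?f i))) \<longlonglongrightarrow> ennreal r" using tl real by simp
    qed (use real mf in \<open>auto intro!: always_eventually sum_nonneg\<close>)
    then have "(\<lambda>n. exp (- (\<Sum>i<n. m (?f i)))) \<longlonglongrightarrow> exp (- r)" by (intro tendsto_intros)
    with lim real show ?thesis by (auto dest: LIMSEQ_unique)
  next
    case top
    have "filterlim (\<lambda>n. \<Sum>i<n. m (?f i)) at_top sequentially"
      unfolding filterlim_at_top_dense
    proof
      fix Z :: real
      have "eventually (\<lambda>n. ennreal Z < ennreal (\<Sum>i<n. m (?f i))) sequentially"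
        by (rule order_tendstoD(1)[OF tl]) (simp add: top)
      then show "eventually (\<lambda>n. Z < (\<Sum>i<n. m (?f i))) sequentially"
        by eventually_elim (metis ennreal_leI not_le)
    qed
    then have "filterlim (\<lambda>n. - (\<Sum>i<n. m (?f i))) at_bot sequentially"
      by (simp only: filterlim_uminus_at_top)
    then have "(\<lambda>n. exp (- (\<Sum>i<n. m (?f i)))) \<longlonglongrightarrow> 0"
      by (rule filterlim_compose[OF exp_at_bot])
    with lim top show ?thesis by (auto dest: LIMSEQ_unique)
  qed
qed

end

section \<open>Sets of loops\<close>

lemma loop_verts_class: "l \<in> based_loops d \<Longrightarrow> loop_verts (shift_rel d `` {l}) = set l"
  by (auto simp: loop_verts_def shift_rel_def intro: exI[of _ 0])

lemma loopsE:
  assumes "\<gamma> \<in> loops d"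
  obtains l where "l \<in> based_loops d" "\<gamma> = shift_rel d `` {l}" "loop_verts \<gamma> = set l"
  using assms loop_verts_class by (auto simp: loops_def elim!: quotientE)

lemma loop_verts_subset: "\<gamma> \<in> loops d \<Longrightarrow> loop_verts \<gamma> \<subseteq> tree_verts d"
  by (auto elim!: loopsE simp: based_loops_def)

text \<open>Read as a path from \<open>u\<close>, the loop cannot leave the subtree of
  \<open>s\<close> without visiting \<open>tl s\<close>; read as a path from \<open>u'\<close>, it
  cannot enter without visiting \<open>s\<close>.\<close>

lemma based_loop_crosses:
  assumes l: "l \<in> based_loops d" and u: "u \<in> set l" "suffix s u" and u': "u' \<in> set l" "\<not> suffix s u'"
  shows "s \<in> set l \<and> tl s \<in> set l"
proof -
  have s0: "s \<noteq> []" using u' by auto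
  have rot: "\<exists>p. successively (tree_adj d) p \<and> p \<noteq> [] \<and> hd p = w \<and> set p = set l" if "w \<in> set l" for w
  proof -
    obtain i where i: "i < length l" "l ! i = w" using \<open>w \<in> set l\<close> unfolding in_set_conv_nth by blast
    then have "hd (rotate i l) = w" by (subst hd_rotate_conv_nth) auto
    moreover have "rotate i l \<in> based_loops d" by (rule based_loops_rotate) fact
    ultimately show ?thesis using i by (intro exI[of _ "rotate i l"]) (auto simp: based_loops_def)
  qed
  obtain p where p: "successively (tree_adj d) p" "p \<noteq> []" "hd p = u" "set p = set l"
    using rot[OF u(1)] by blast
  obtain q where q: "successively (tree_adj d) q" "q \<noteq> []" "hd q = u'" "set q = set l"
    using rot[OF u'(1)] by blast
  have "tl s \<in> set l"
  proof (rule ccontr)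
    assume n: "tl s \<notin> set l"
    have "\<forall>w\<in>set p. suffix s w"
      using successively_invariant[OF p(1,2), of "suffix s"] p u n suffix_step[OF _ _ s0] by metis
    with u' p show False by auto
  qed
  moreover have "s \<in> set l"
  proof (rule ccontr)
    assume n: "s \<notin> set l"
    have "\<forall>w\<in>set q. \<not> suffix s w"
      using successively_invariant[OF q(1,2), of "\<lambda>w. \<not> suffix s w"] q u' n not_suffix_step[OF _ _ s0] by metis
    with u q show False by auto
  qed
  ultimately show ?thesis by blast
qed

text \<open>An edge is named by its lower endpoint \<open>s\<close>, the upper one being
  \<open>tl s\<close>. A loop through \<open>s\<close> that leaves the subtree of \<open>s\<close>
  must use this edge.\<close>

definition cross :: "nat \<Rightarrow> nat list \<Rightarrow> nat list list set set" where
  "cross d s = {\<gamma> \<in> loops d. s \<in> loop_verts \<gamma> \<and> \<not> loop_verts \<gamma> \<subseteq> below d s}"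

definition inside :: "nat \<Rightarrow> nat list \<Rightarrow> nat list list set set" where
  "inside d v = {\<gamma> \<in> loops d. loop_verts \<gamma> \<subseteq> below d v}"

lemma cross_subset: "cross d s \<subseteq> loops d" and inside_subset: "inside d v \<subseteq> loops d"
  by (auto simp: cross_def inside_def)

lemma inside_mono: "suffix v w \<Longrightarrow> inside d w \<subseteq> inside d v"
  using below_mono by (fastforce simp: inside_def)

lemma loop_crosses:
  assumes "\<gamma> \<in> loops d" "u \<in> loop_verts \<gamma>" "u \<in> below d s" "u' \<in> loop_verts \<gamma>" "u' \<notin> below d s"
  shows "\<gamma> \<in> cross d s"
  using assms(1)
proof (rule loopsE)
  fix l assume l: "l \<in> based_loops d" "loop_verts \<gamma> = set l"
  have "\<not> suffix s u'" using assms loop_verts_subset[OF assms(1)] by (auto simp: below_def)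
  then have "s \<in> set l" using assms l based_loop_crosses[OF l(1)] by (auto simp: below_def)
  with assms l show ?thesis by (auto simp: cross_def)
qed

lemma cross_tl:
  assumes "\<gamma> \<in> cross d s"
  shows "tl s \<in> loop_verts \<gamma>"
proof -
  from assms have g: "\<gamma> \<in> loops d" "s \<in> loop_verts \<gamma>" by (auto simp: cross_def)
  from assms obtain u' where "u' \<in> loop_verts \<gamma>" "u' \<notin> below d s" by (auto simp: cross_def)
  with g show ?thesis
    by (elim loopsE) (use based_loop_crosses[of _ d s s u'] in \<open>auto simp: below_def based_loops_def\<close>)
qed

text \<open>The origin of the renewal structure: below a closed edge \<open>s\<close>, a lower edge
  \<open>t\<close> can only be covered by loops contained in the subtree of
  \<open>s\<close>.\<close>

lemma cross_inside_reduce: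
  assumes "suffix v s" "suffix s t" "t \<in> tree_verts d"
  shows "inside d v \<inter> cross d t \<subseteq> (inside d v \<inter> cross d s) \<union> (inside d s \<inter> cross d t)"
proof
  fix \<gamma> assume g: "\<gamma> \<in> inside d v \<inter> cross d t"
  then have "t \<in> loop_verts \<gamma>" "\<gamma> \<in> loops d" by (auto simp: cross_def)
  moreover have "t \<in> below d s" using assms by (simp add: below_def)
  ultimately have "loop_verts \<gamma> \<subseteq> below d s \<or> \<gamma> \<in> cross d s"
    using loop_crosses by blast
  with g show "\<gamma> \<in> (inside d v \<inter> cross d s) \<union> (inside d s \<inter> cross d t)"
    by (auto simp: inside_def)
qed

definition weight_mass :: "nat \<Rightarrow> ennreal \<Rightarrow> (nat list set \<Rightarrow> bool) \<Rightarrow> ennreal" where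
  "weight_mass d z P = (\<integral>\<^sup>+l. loop_weight z l \<partial>count_space {l \<in> based_loops d. P (set l)})"

text \<open>The vertex set of a loop does not depend on the base point, so any mass defined by a
  condition on it can be computed over based loops.\<close>

lemma nn_integral_loop_measure:
  assumes k: "\<kappa> > -1" and d: "d > 0"
  shows "(\<integral>\<^sup>+\<gamma>. ennreal (measure (loop_measure d \<kappa>) {\<gamma>}) \<partial>count_space {\<gamma> \<in> loops d. P (loop_verts \<gamma>)}) =
    weight_mass d (ennreal (1 / ((1 + \<kappa>) * real d))) P"
proof -
  let ?A = "{\<gamma> \<in> loops d. P (loop_verts \<gamma>)}"
  let ?z = "1 / ((1 + \<kappa>) * real d)"
  let ?N = "loop_measure d \<kappa>"
  have cA: "countable ?A" using countable_loops[of d] by (rule countable_subset[rotated]) auto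
  have w: "ennreal (1 / real (length l) * (1 / (1 + \<kappa>)) ^ length l * (1 / real d) ^ length l) = loop_weight ?z l" for l
  proof -
    have "(1 / (1 + \<kappa>)) ^ length l * (1 / real d) ^ length l = ?z ^ length l"
      by (simp flip: power_mult_distrib)
    then have "1 / real (length l) * (1 / (1 + \<kappa>)) ^ length l * (1 / real d) ^ length l = ?z ^ length l * (1 / real (length l))"
      by simp
    moreover have "?z \<ge> 0" using k by simp
    ultimately show ?thesis
      by (simp only: loop_weight_def ennreal_mult ennreal_power zero_le_power zero_le_divide_1_iff of_nat_0_le_iff)
  qed
  have fin: "emeasure ?N {\<gamma>} = ennreal (measure ?N {\<gamma>})" if "\<gamma> \<in> loops d" for \<gamma>
  proof -
    have "emeasure ?N {\<gamma>} < \<infinity>" using that finite_loop[OF that] by (simp add: emeasure_loop_measure)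
    then show ?thesis by (simp add: emeasure_eq_ennreal_measure)
  qed
  have "(\<integral>\<^sup>+\<gamma>. ennreal (measure ?N {\<gamma>}) \<partial>count_space ?A) = (\<integral>\<^sup>+\<gamma>. emeasure ?N {\<gamma>} \<partial>count_space ?A)"
    by (intro nn_integral_cong) (auto simp: fin)
  also have "\<dots> = emeasure ?N ?A"
    using cA by (intro emeasure_countable_singleton[symmetric]) (auto simp: loop_measure_def)
  also have "\<dots> = emeasure (based_loop_measure d \<kappa>) ((\<lambda>l. shift_rel d `` {l}) -` ?A \<inter> space (based_loop_measure d \<kappa>))"
    unfolding loop_measure_def
    by (rule emeasure_distr) (auto simp: based_loop_measure_def loops_def quotientI)
  also have "(\<lambda>l. shift_rel d `` {l}) -` ?A \<inter> space (based_loop_measure d \<kappa>) = {l \<in> based_loops d. P (set l)}"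
    by (auto simp: based_loop_measure_def loop_verts_class loops_def quotientI)
  also have "emeasure (based_loop_measure d \<kappa>) {l \<in> based_loops d. P (set l)} =
      (\<integral>\<^sup>+l. loop_weight ?z l * indicator {l \<in> based_loops d. P (set l)} l \<partial>count_space (based_loops d))"
    unfolding based_loop_measure_def w by (subst emeasure_density) auto
  also have "\<dots> = (\<integral>\<^sup>+l. loop_weight ?z l * indicator {l \<in> based_loops d. P (set l)} l \<partial>count_space {l \<in> based_loops d. P (set l)})"
    by (intro nn_integral_count_space_eq) auto
  also have "\<dots> = weight_mass d ?z P"
    unfolding weight_mass_def by (intro nn_integral_cong) auto
  finally show ?thesis .
qed

lemma nn_integral_count_space_mono:
  fixes f :: "'a \<Rightarrow> ennreal"
  assumes "A \<subseteq> B"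
  shows "(\<integral>\<^sup>+x. f x \<partial>count_space A) \<le> (\<integral>\<^sup>+x. f x \<partial>count_space B)"
proof -
  have "(\<integral>\<^sup>+x. f x \<partial>count_space A) = (\<integral>\<^sup>+x. f x * indicator A x \<partial>count_space UNIV)"
    by (rule nn_integral_count_space_indicator) simp
  also have "\<dots> \<le> (\<integral>\<^sup>+x. f x * indicator B x \<partial>count_space UNIV)"
    using assms by (intro nn_integral_mono mult_left_mono) (auto simp: indicator_def)
  also have "\<dots> = (\<integral>\<^sup>+x. f x \<partial>count_space B)"
    by (rule nn_integral_count_space_indicator[symmetric]) simp
  finally show ?thesis .
qed

lemma loop_mass_eq_weight_mass: "loop_mass d z H x = weight_mass d z (\<lambda>V. V \<subseteq> H \<and> x \<in> V)"
  by (simp add: loop_mass_def weight_mass_def loops_through_def)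

definition cross_mass :: "nat \<Rightarrow> ennreal \<Rightarrow> nat list \<Rightarrow> nat list \<Rightarrow> ennreal" where
  "cross_mass d z v s = weight_mass d z (\<lambda>V. V \<subseteq> below d v \<and> s \<in> V \<and> \<not> V \<subseteq> below d s)"

lemma inside_cross_eq:
  "inside d v \<inter> cross d s = {\<gamma> \<in> loops d. loop_verts \<gamma> \<subseteq> below d v \<and> s \<in> loop_verts \<gamma> \<and> \<not> loop_verts \<gamma> \<subseteq> below d s}"
  by (auto simp: inside_def cross_def)

lemma loop_mass_split:
  assumes "suffix v s"
  shows "loop_mass d z (below d v) s = loop_mass d z (below d s) s + cross_mass d z v s"
proof -
  let ?S = "{l \<in> based_loops d. set l \<subseteq> below d v \<and> s \<in> set l}"
  let ?A = "{l \<in> based_loops d. set l \<subseteq> below d s \<and> s \<in> set l}"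
  let ?B = "{l \<in> based_loops d. set l \<subseteq> below d v \<and> s \<in> set l \<and> \<not> set l \<subseteq> below d s}"
  have S: "?S = ?A \<union> ?B" "?A \<inter> ?B = {}" using below_mono[OF assms] by auto
  have "(\<integral>\<^sup>+l. loop_weight z l \<partial>count_space ?S) =
        (\<integral>\<^sup>+l. loop_weight z l * indicator ?A l + loop_weight z l * indicator ?B l \<partial>count_space UNIV)"
    by (subst nn_integral_count_space_indicator, simp, intro nn_integral_cong) (use S in \<open>auto simp: indicator_def\<close>)
  also have "\<dots> = (\<integral>\<^sup>+l. loop_weight z l \<partial>count_space ?A) + (\<integral>\<^sup>+l. loop_weight z l \<partial>count_space ?B)"
    by (subst nn_integral_add, simp, simp,
        subst (1 2) nn_integral_count_space_indicator[symmetric], simp, simp, rule refl)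
  finally show ?thesis
    by (simp add: loop_mass_eq_weight_mass cross_mass_def weight_mass_def)
qed

text \<open>Of the mass of the loops through \<open>s\<close>, the part that stays below
  \<open>s\<close> is ln \<open>g\<close>, as at the top of any subtree; the rest is carried by the
  loops crossing the edge.\<close>

lemma (in rho_tree) cross_mass_eq:
  assumes "v \<noteq> []" "s \<in> below d v" "length s = length v + Suc n"
  shows "cross_mass d z v s = ennreal (ln ((1 - \<rho> ^ (n + 2)) / (1 - \<rho>)))"
proof -
  have s: "s \<in> tree_verts d" "s \<noteq> []" "suffix v s" using assms by (auto simp: below_def)
  have q: "1 - \<rho> > 0" "1 - \<rho> ^ (n + 2) > 0" using rho_lt1 rho_power_lt1[of "n + 2"] by auto
  have "\<rho> ^ (n + 2) \<le> \<rho> ^ 1" using rho_pos rho_lt1 by (intro power_decreasing) auto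
  then have "(1 - \<rho> ^ (n + 2)) / (1 - \<rho>) \<ge> 1" using q by (simp add: field_simps)
  then have l: "ln ((1 - \<rho> ^ (n + 2)) / (1 - \<rho>)) \<ge> 0" by simp
  have "g \<ge> 1" using d_ge rho_pos by auto
  then have lg: "ln g \<ge> 0" by simp
  have "ennreal (ln g) + ennreal (ln ((1 - \<rho> ^ (n + 2)) / (1 - \<rho>))) = ennreal (ln g) + cross_mass d z v s"
    using loop_mass_split[OF s(3), of d z] loop_mass_below[OF assms] loop_mass_top[OF s(1,2)] l lg by simp
  then show ?thesis by (subst (asm) ennreal_add_left_cancel) auto
qed

text \<open>Already the loops through \<open>v\<close> that stay in \<open>v\<close> and the subtree
  of \<open>s\<close> have infinite mass: there \<open>s\<close> is the only neighbour of
  \<open>v\<close> and its Green function is infinite, so the term m = 1 of the series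
  diverges.\<close>

lemma cross_mass_infinite:
  assumes z: "4 * (real d - 1) * z\<^sup>2 > 1" "z > 0" and d: "d \<ge> 1" and v: "v \<in> tree_verts d" "v \<noteq> []"
    and s: "s \<in> children d v"
  shows "cross_mass d (ennreal z) v s = \<infinity>"
proof -
  from s obtain a where a: "s = a # v" "a # v \<in> tree_verts d" by (rule in_childrenD)
  let ?H = "insert v (below d s)"
  have H: "?H \<subseteq> below d v"
    using v below_mono[of v s d] a by (auto simp: below_self suffix_ConsI)
  have "\<not> suffix s v" unfolding a by (auto dest: suffix_length_le)
  then have "nbrs d ?H v = {s}"
    using a v by (auto simp: nbrs_def below_def tree_adj_def suffix_Cons)
  then have "first_return d z ?H v = (ennreal z)\<^sup>2 * green d z (?H - {v}) s"
    by (simp add: first_return_def)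
  also have "green d z (?H - {v}) s = green d z (below d s) s"
    unfolding a using H a below_subset_verts v by (intro green_child) auto
  also have "\<dots> = \<infinity>"
    using z d a by (intro green_top_infinite) auto
  also have "(ennreal z)\<^sup>2 * \<infinity> = \<infinity>"
    using z by (simp add: ennreal_power ennreal_mult_top)
  finally have fr: "first_return d z ?H v = \<infinity>" .
  have "loop_mass d z ?H v = (\<Sum>m. first_return d z ?H v ^ m * ennreal (1 / real m))"
    by (rule loop_mass_eq_suminf) simp
  also have "\<dots> \<ge> (\<Sum>m\<in>{1}. first_return d z ?H v ^ m * ennreal (1 / real m))"
    by (rule sum_le_suminf) auto
  finally have "loop_mass d z ?H v = \<infinity>" using fr by (simp add: top_unique)
  moreover have "loop_mass d z ?H v \<le> cross_mass d z v s"
  proof -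
    have "{l \<in> based_loops d. set l \<subseteq> ?H \<and> v \<in> set l} \<subseteq>
          {l \<in> based_loops d. set l \<subseteq> below d v \<and> s \<in> set l \<and> \<not> set l \<subseteq> below d s}"
    proof clarify
      fix l assume l: "l \<in> based_loops d" "set l \<subseteq> ?H" "v \<in> set l"
      have v': "v \<notin> below d s" unfolding a by (auto simp: below_def dest: suffix_length_le)
      have "hd l \<noteq> last l" "hd l \<in> set l" "last l \<in> set l"
        using l(1) tree_adj_irrefl[of d "hd l"] by (cases l; auto simp: based_loops_def)+
      then obtain u where u: "u \<in> set l" "u \<in> below d s" using l(2) by blast
      then have "s \<in> set l"
        using based_loop_crosses[OF l(1), of u s v] l(3) v' v by (auto simp: below_def)
      with l H v' show "set l \<subseteq> below d v \<and> s \<in> set l \<and> \<not> set l \<subseteq> below d s" by blast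
    qed
    then show ?thesis
      unfolding loop_mass_eq_weight_mass cross_mass_def weight_mass_def
      by (rule nn_integral_count_space_mono)
  qed
  ultimately show ?thesis by (simp add: top_unique)
qed

section \<open>The loop soup\<close>

definition open_ev :: "nat \<Rightarrow> real \<Rightarrow> real \<Rightarrow> nat list list set \<Rightarrow> (nat list list set \<Rightarrow> nat) set" where
  "open_ev d \<alpha> \<kappa> \<gamma> = {\<omega> \<in> space (loop_soup d \<alpha> \<kappa>). \<omega> \<gamma> \<ge> 1}"

definition loop_rate :: "nat \<Rightarrow> real \<Rightarrow> real \<Rightarrow> nat list list set \<Rightarrow> real" where
  "loop_rate d \<alpha> \<kappa> \<gamma> = \<alpha> * measure (loop_measure d \<kappa>) {\<gamma>}"

lemma measure_poisson_dist_pos: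
  assumes "r \<ge> 0"
  shows "measure (measure_pmf (poisson_dist r)) {1..} = 1 - exp (- r)"
proof -
  have "{1..} = UNIV - {0::nat}" by auto
  then have "measure (measure_pmf (poisson_dist r)) {1..} = 1 - pmf (poisson_dist r) 0"
    using measure_pmf.prob_compl[of "{0}" "poisson_dist r"] by (simp add: measure_pmf_single)
  then show ?thesis using assms by (simp add: poisson_dist_def)
qed

lemma loop_soup_random_set:
  assumes a: "\<alpha> \<ge> 0"
  shows "random_set (loop_soup d \<alpha> \<kappa>) (loops d) (open_ev d \<alpha> \<kappa>) (loop_rate d \<alpha> \<kappa>)"
proof -
  let ?M = "\<lambda>\<gamma>. measure_pmf (poisson_dist (loop_rate d \<alpha> \<kappa> \<gamma>))"
  interpret L: prob_space "loop_soup d \<alpha> \<kappa>" by (rule prob_space_loop_soup)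
  interpret product_prob_space ?M "loops d" by unfold_locales
  have soup: "loop_soup d \<alpha> \<kappa> = PiM (loops d) ?M"
    unfolding loop_soup_def poisson_point_process_def loop_rate_def
    using a by (intro PiM_cong) (auto simp: space_scale_measure space_loop_measure measure_def enn2real_mult)
  have J: "L.prob (space (loop_soup d \<alpha> \<kappa>) \<inter> (\<Inter>j\<in>J. open_ev d \<alpha> \<kappa> j)) = (\<Prod>j\<in>J. 1 - exp (- loop_rate d \<alpha> \<kappa> j))"
    if "finite J" "J \<subseteq> loops d" for J
  proof -
    have "space (loop_soup d \<alpha> \<kappa>) \<inter> (\<Inter>j\<in>J. open_ev d \<alpha> \<kappa> j) = {x \<in> space (PiM (loops d) ?M). \<forall>i\<in>J. x i \<in> {1..}}"
      by (auto simp: open_ev_def soup)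
    moreover have "emeasure (PiM (loops d) ?M) {x \<in> space (PiM (loops d) ?M). \<forall>i\<in>J. x i \<in> {1..}} =
        (\<Prod>j\<in>J. emeasure (?M j) {1..})"
      using that by (intro emeasure_PiM_Collect) auto
    moreover have "emeasure (?M j) {1..} = ennreal (1 - exp (- loop_rate d \<alpha> \<kappa> j))" for j
      using measure_poisson_dist_pos[of "loop_rate d \<alpha> \<kappa> j"] a
      by (simp add: measure_pmf.emeasure_eq_measure loop_rate_def)
    moreover have "loop_rate d \<alpha> \<kappa> j \<ge> 0" for j using a by (simp add: loop_rate_def)
    ultimately show ?thesis
      by (simp add: measure_def soup prod_ennreal prod_nonneg)
  qed
  have ev: "open_ev d \<alpha> \<kappa> \<gamma> \<in> L.events" if "\<gamma> \<in> loops d" for \<gamma>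
  proof -
    have "(\<lambda>\<omega>. \<omega> \<gamma>) \<in> measurable (PiM (loops d) ?M) (count_space UNIV)"
      using that by (simp add: measurable_component_singleton flip: measurable_pmf_measure2)
    then have "(\<lambda>\<omega>. \<omega> \<gamma>) -` {1..} \<inter> space (PiM (loops d) ?M) \<in> sets (PiM (loops d) ?M)"
      by (rule measurable_sets) simp
    also have "(\<lambda>\<omega>. \<omega> \<gamma>) -` {1..} \<inter> space (PiM (loops d) ?M) = open_ev d \<alpha> \<kappa> \<gamma>"
      by (auto simp: open_ev_def soup)
    finally show ?thesis by (simp add: soup)
  qed
  have sp: "space (loop_soup d \<alpha> \<kappa>) \<inter> open_ev d \<alpha> \<kappa> j = open_ev d \<alpha> \<kappa> j" for j
    by (auto simp: open_ev_def)
  have one: "L.prob (open_ev d \<alpha> \<kappa> \<gamma>) = 1 - exp (- loop_rate d \<alpha> \<kappa> \<gamma>)" if "\<gamma> \<in> loops d" for \<gamma>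
    using J[of "{\<gamma>}"] that by (simp add: sp)
  show ?thesis
  proof
    show "countable (loops d)" by (rule countable_loops)
    show "L.indep_events (open_ev d \<alpha> \<kappa>) (loops d)"
    proof (rule L.indep_eventsI)
      show "L.prob (\<Inter>i\<in>J. open_ev d \<alpha> \<kappa> i) = (\<Prod>i\<in>J. L.prob (open_ev d \<alpha> \<kappa> i))"
        if "J \<subseteq> loops d" "finite J" "J \<noteq> {}" for J
      proof -
        have "space (loop_soup d \<alpha> \<kappa>) \<inter> (\<Inter>j\<in>J. open_ev d \<alpha> \<kappa> j) = (\<Inter>j\<in>J. open_ev d \<alpha> \<kappa> j)"
          using that by (auto simp: open_ev_def)
        then show ?thesis using J[of J] that one by (simp add: subset_eq)
      qed
    qed (use ev in auto)
    show "L.prob (open_ev d \<alpha> \<kappa> i) = 1 - exp (- loop_rate d \<alpha> \<kappa> i)" if "i \<in> loops d" for i by (rule one) fact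
    show "loop_rate d \<alpha> \<kappa> i \<ge> 0" for i using a by (simp add: loop_rate_def)
  qed
qed

section \<open>A renewal equation\<close>

text \<open>The probability that \<open>n\<close> successive edges below a vertex are open. The sum
  runs over the lowest closed edge, at distance \<open>k\<close>: it is closed with probability
  \<open>U k\<close>, and the n - k edges beneath it are open.\<close>

function renewal :: "(nat \<Rightarrow> real) \<Rightarrow> nat \<Rightarrow> real" where
  "renewal U n = 1 - (\<Sum>k\<in>{1..n}. U k * renewal U (n - k))"
  by pat_completeness auto
termination by (relation "Wellfounded.measure snd") auto

declare renewal.simps [simp del]

locale renewal_eq =
  fixes U :: "nat \<Rightarrow> real" and b :: real
  assumes U_0: "U 0 = 1" and U_decseq: "decseq U" and U_nonneg: "U n \<ge> 0" and b_pos: "b > 0"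
begin

abbreviation "S \<equiv> renewal U"

text \<open>The decrements of \<open>U\<close> act as a step distribution, possibly defective; the
  power of \<open>b\<close> accounts for the growth of the tree. Comparing their total with 1
  separates the two phases.\<close>

definition A :: "nat \<Rightarrow> real" where
  "A k = (U k - U (Suc k)) * b ^ Suc k"

text \<open>With \<open>b = d - 1\<close>, the expected number of vertices \<open>n\<close> levels below a vertex that it reaches by
  open edges.\<close>

definition t :: "nat \<Rightarrow> real" where
  "t n = b ^ n * S n"

lemma A_nonneg: "A k \<ge> 0"
  using U_decseq b_pos unfolding A_def decseq_Suc_iff by (intro mult_nonneg_nonneg) auto

lemma renewal_sum: "(\<Sum>k\<le>n. U k * S (n - k)) = 1"
proof -
  have "{..n} = insert 0 {1..n}" by auto
  then have "(\<Sum>k\<le>n. U k * S (n - k)) = S n + (\<Sum>k\<in>{1..n}. U k * S (n - k))"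
    by (simp add: U_0)
  then show ?thesis by (subst (asm) renewal.simps) simp
qed

lemma renewal_tail:
  assumes "i \<le> n"
  shows "1 - (\<Sum>k\<in>{Suc i..n}. U k * S (n - k)) = (\<Sum>k\<le>i. U k * S (n - k))"
proof -
  have "{..n} = {..i} \<union> {Suc i..n}" using assms by auto
  then have "(\<Sum>k\<le>n. U k * S (n - k)) = (\<Sum>k\<le>i. U k * S (n - k)) + (\<Sum>k\<in>{Suc i..n}. U k * S (n - k))"
    by (simp add: sum.union_disjoint)
  then show ?thesis by (simp add: renewal_sum)
qed

text \<open>The difference of \<open>renewal_sum\<close> at n + 1 and at n. Unlike the definition it
  has nonnegative coefficients.\<close>

lemma renewal_Suc: "S (Suc n) = (\<Sum>k\<le>n. (U k - U (Suc k)) * S (n - k))"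
proof -
  have "(\<Sum>k\<le>Suc n. U k * S (Suc n - k)) = U 0 * S (Suc n) + (\<Sum>k\<le>n. U (Suc k) * S (n - k))"
    by (subst sum.atMost_Suc_shift) simp
  with renewal_sum[of n] renewal_sum[of "Suc n"] show ?thesis
    by (simp add: U_0 left_diff_distrib sum_subtractf)
qed

lemma t_Suc: "t (Suc n) = (\<Sum>k\<le>n. A k * t (n - k))"
  unfolding t_def renewal_Suc sum_distrib_left
proof (intro sum.cong refl)
  fix k assume "k \<in> {..n}"
  then have "b ^ Suc n = b ^ Suc k * b ^ (n - k)" by (simp flip: power_add)
  then show "b ^ Suc n * ((U k - U (Suc k)) * S (n - k)) = A k * (b ^ (n - k) * S (n - k))"
    using b_pos by (simp add: A_def)
qed

lemma t_0: "t 0 = 1"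
  unfolding t_def by (subst renewal.simps) simp

lemma t_nonneg: "t n \<ge> 0"
proof (induction n rule: less_induct)
  case (less n)
  then show ?case
    by (cases n) (auto simp: t_0 t_Suc intro!: sum_nonneg mult_nonneg_nonneg A_nonneg)
qed

lemma S_nonneg: "S n \<ge> 0"
  using t_nonneg[of n] zero_less_power[OF b_pos, of n] by (auto simp: t_def zero_le_mult_iff)

lemma sum_t: "(\<Sum>n<Suc N. t n) = 1 + (\<Sum>k<N. A k * (\<Sum>j<N - k. t j))"
proof -
  have "(\<Sum>n<Suc N. t n) = 1 + (\<Sum>n<N. \<Sum>k\<le>n. A k * t (n - k))"
    by (subst sum.lessThan_Suc_shift) (simp add: t_0 t_Suc)
  also have "(\<Sum>n<N. \<Sum>k\<le>n. A k * t (n - k)) = (\<Sum>k<N. A k * (\<Sum>j<N - k. t j))"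
    unfolding sum_distrib_left
    by (subst (1 2) sum.Sigma, simp, simp, simp, simp)
       (rule sum.reindex_bij_witness[of _ "\<lambda>(k, j). (k + j, k)" "\<lambda>(n, k). (k, n - k)"], auto)
  finally show ?thesis .
qed

text \<open>With partial sums T and total weight at most q < 1, the renewal equation gives T \<le> 1
  + q T.\<close>

lemma summable_t:
  assumes "q < 1" "\<And>K. (\<Sum>k<K. A k) \<le> q"
  shows "summable t"
proof (rule summableI_nonneg_bounded[OF t_nonneg])
  fix N
  let ?T = "\<lambda>N. \<Sum>n<N. t n"
  have mono: "?T m \<le> ?T n" if "m \<le> n" for m n
    using that by (intro sum_mono2) (auto simp: t_nonneg)
  have "?T (Suc N) \<le> 1 + (\<Sum>k<N. A k * ?T (Suc N))"
    unfolding sum_t[of N] by (intro add_left_mono sum_mono mult_left_mono A_nonneg, subst sum_t[symmetric], rule mono) auto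
  also have "\<dots> \<le> 1 + q * ?T (Suc N)"
    unfolding sum_distrib_right[symmetric]
    using assms(2) by (intro add_left_mono mult_right_mono sum_nonneg t_nonneg)
  finally have "?T (Suc N) * (1 - q) \<le> 1" by (simp add: algebra_simps)
  then have "?T (Suc N) \<le> 1 / (1 - q)" using assms by (simp add: field_simps)
  with mono[of N "Suc N"] show "?T N \<le> 1 / (1 - q)" by linarith
qed

text \<open>If all t(n) were at most 1, K + 1 further terms would raise the partial sums T by at
  most K + 1, while the equation forces T(N + K + 1) \<ge> 1 + q T(N) with q > 1. So T is bounded,
  and its limit violates the inequality.\<close>

lemma ex_t_gt_1:
  assumes K: "(\<Sum>k<K. A k) > 1"
  shows "\<exists>n. t n > 1"
proof (rule ccontr)
  assume "\<not> (\<exists>n. t n > 1)"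
  then have le1: "t n \<le> 1" for n by (simp add: not_less)
  define q where "q = (\<Sum>k<K. A k)"
  have q: "q > 1" using K by (simp add: q_def)
  let ?T = "\<lambda>N. \<Sum>n<N. t n"
  have mono: "?T m \<le> ?T n" if "m \<le> n" for m n
    using that by (intro sum_mono2) (auto simp: t_nonneg)
  have ge: "?T (Suc (N + K)) \<ge> 1 + q * ?T N" for N
  proof -
    have "q * ?T N = (\<Sum>k<K. A k * ?T N)" by (simp add: q_def sum_distrib_right)
    also have "\<dots> \<le> (\<Sum>k<K. A k * ?T (N + K - k))"
      by (intro sum_mono mult_left_mono A_nonneg mono) auto
    also have "\<dots> \<le> (\<Sum>k<N + K. A k * ?T (N + K - k))"
      by (intro sum_mono2) (auto intro!: mult_nonneg_nonneg A_nonneg sum_nonneg t_nonneg)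
    finally show ?thesis unfolding sum_t[of "N + K"] by simp
  qed
  have sumt: "summable t"
  proof (rule summableI_nonneg_bounded[OF t_nonneg])
    fix N
    have "?T (Suc (N + K)) = ?T N + (\<Sum>n=N..<Suc (N + K). t n)"
      by (simp add: sum.atLeastLessThan_concat[symmetric] lessThan_atLeast0
          sum.atLeastLessThan_concat[of 0 N "Suc (N + K)", symmetric])
    also have "(\<Sum>n=N..<Suc (N + K). t n) \<le> of_nat (card {N..<Suc (N + K)}) * 1"
      by (intro sum_bounded_above le1)
    finally have "?T (Suc (N + K)) \<le> ?T N + real (Suc K)" by simp
    with ge[of N] have "(q - 1) * ?T N \<le> real (Suc K)" by (simp add: algebra_simps)
    then show "?T N \<le> real (Suc K) / (q - 1)" using q by (simp add: field_simps)
  qed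
  have l: "?T \<longlonglongrightarrow> suminf t" using sumt by (rule summable_LIMSEQ)
  have l2: "(\<lambda>N. ?T (Suc (N + K))) \<longlonglongrightarrow> suminf t"
    using LIMSEQ_ignore_initial_segment[OF l, of "Suc K"] by simp
  have l1: "(\<lambda>N. 1 + q * ?T N) \<longlonglongrightarrow> 1 + q * suminf t" by (intro tendsto_intros l)
  have "1 + q * suminf t \<le> suminf t"
    by (rule LIMSEQ_le[OF l1 l2]) (use ge in blast)
  moreover have "suminf t \<ge> 0" using sumt t_nonneg by (intro suminf_nonneg)
  then have "1 * suminf t \<le> q * suminf t" using q by (intro mult_right_mono) auto
  ultimately show False by simp
qed

end

section \<open>Open edges along a path\<close>

context random_set
begin

text \<open>The expected number of occurring members of \<open>A\<close> is at most the sum of the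
  \<open>m i\<close>.\<close>

lemma AE_finite_hits:
  assumes A: "A \<subseteq> I" and fin: "(\<integral>\<^sup>+i. ennreal (m i) \<partial>count_space A) < \<infinity>"
  shows "AE \<omega> in M. finite {i \<in> A. \<omega> \<in> ev i}"
proof -
  have cA: "countable A" using A countable_I by (rule countable_subset)
  have ev: "ev i \<in> events" if "i \<in> A" for i using that A ev_sets by blast
  have "(\<integral>\<^sup>+\<omega>. \<integral>\<^sup>+i. indicator (ev i) \<omega> \<partial>count_space A \<partial>M) = (\<integral>\<^sup>+i. \<integral>\<^sup>+\<omega>. indicator (ev i) \<omega> \<partial>M \<partial>count_space A)"
    using ev by (intro nn_integral_count_space_nn_integral cA) auto
  also have "\<dots> = (\<integral>\<^sup>+i. emeasure M (ev i) \<partial>count_space A)"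
    using ev by (intro nn_integral_cong) auto
  also have "\<dots> \<le> (\<integral>\<^sup>+i. ennreal (m i) \<partial>count_space A)"
  proof (intro nn_integral_mono)
    fix i assume "i \<in> space (count_space A)"
    then have i: "i \<in> I" using A by auto
    have "1 - exp (- m i) \<le> m i" using exp_ge_add_one_self[of "- m i"] by linarith
    then show "emeasure M (ev i) \<le> ennreal (m i)"
      by (simp add: emeasure_eq_measure prob_ev i ennreal_leI)
  qed
  finally have lt: "(\<integral>\<^sup>+\<omega>. \<integral>\<^sup>+i. indicator (ev i) \<omega> \<partial>count_space A \<partial>M) \<noteq> \<infinity>" using fin by auto
  have "(\<lambda>\<omega>. \<integral>\<^sup>+i. indicator (ev i) \<omega> \<partial>count_space A) \<in> borel_measurable M"
  proof (cases "finite A")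
    case True
    then show ?thesis using ev by (simp add: nn_integral_count_space_finite)
  next
    case False
    note bij = bij_betw_from_nat_into[OF cA False]
    have "from_nat_into A n \<in> A" for n using False by (intro from_nat_into) auto
    then have "(\<lambda>\<omega>. \<Sum>n. indicator (ev (from_nat_into A n)) \<omega> :: ennreal) \<in> borel_measurable M"
      using ev by (intro borel_measurable_suminf_order borel_measurable_indicator) auto
    then show ?thesis
      by (simp add: nn_integral_bij_count_space[OF bij, symmetric] nn_integral_count_space_nat)
  qed
  from nn_integral_PInf_AE[OF this lt]
  show ?thesis
  proof eventually_elim
    fix \<omega> assume ne: "(\<integral>\<^sup>+i. indicator (ev i) \<omega> \<partial>count_space A) \<noteq> \<infinity>"
    have "(\<integral>\<^sup>+i. indicator (ev i) \<omega> \<partial>count_space A) = (\<integral>\<^sup>+i. indicator {i \<in> A. \<omega> \<in> ev i} i \<partial>count_space A)"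
      by (intro nn_integral_cong) (auto simp: indicator_def)
    also have "\<dots> = emeasure (count_space A) {i \<in> A. \<omega> \<in> ev i}" by (rule nn_integral_indicator) simp
    finally show "finite {i \<in> A. \<omega> \<in> ev i}"
      using ne by (metis (no_types, lifting) emeasure_count_space_infinite infinity_ennreal_def mem_Collect_eq subsetI)
  qed
qed

end

section \<open>Levels, branches and paths of the tree\<close>

definition level :: "nat \<Rightarrow> nat \<Rightarrow> nat list \<Rightarrow> nat list set" where
  "level d n v = {x \<in> below d v. length x = length v + n}"

lemma below_cases:
  assumes "x \<in> below d v" "x \<noteq> v"
  shows "x \<noteq> []" "tl x \<in> below d v" "length (tl x) \<ge> length v"
proof -
  obtain a y where x: "x = a # y" and s: "suffix v y" "a # y \<in> tree_verts d"
    using assms by (cases x) (auto simp: below_def suffix_Cons)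
  then have "y \<in> tree_verts d" by (auto simp: tree_verts_def dest: distinct_adj_ConsD)
  with x s show "x \<noteq> []" "tl x \<in> below d v" "length (tl x) \<ge> length v"
    by (auto simp: below_def suffix_length_le)
qed

lemma level_0: "v \<in> tree_verts d \<Longrightarrow> level d 0 v = {v}"
  by (auto simp: level_def below_def suffix_def)

lemma level_Suc: "v \<in> tree_verts d \<Longrightarrow> level d (Suc n) v = (\<Union>x\<in>level d n v. children d x)"
proof (intro set_eqI iffI)
  fix y assume y: "y \<in> level d (Suc n) v"
  then have yv: "y \<in> below d v" "y \<noteq> v" by (auto simp: level_def)
  note b = below_cases[OF yv]
  have "y \<in> children d (tl y)" using b yv(1)
    by (cases y) (auto simp: children_def tree_adj_def below_def)
  moreover have "tl y \<in> level d n v" using b y by (auto simp: level_def)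
  ultimately show "y \<in> (\<Union>x\<in>level d n v. children d x)" by blast
next
  fix y assume "y \<in> (\<Union>x\<in>level d n v. children d x)"
  then obtain x where "x \<in> level d n v" "y \<in> children d x" by blast
  then show "y \<in> level d (Suc n) v"
    by (auto elim!: in_childrenD simp: level_def below_def suffix_ConsI)
qed

lemma level_nonempty_word: "v \<noteq> [] \<Longrightarrow> x \<in> level d n v \<Longrightarrow> x \<noteq> [] \<and> x \<in> tree_verts d \<and> suffix v x"
  by (auto simp: level_def below_def)

lemma finite_level [simp]: "finite (level d n v)"
proof (cases "v \<in> tree_verts d")
  case True
  then show ?thesis by (induction n) (auto simp: level_0 level_Suc)
next
  case False
  have "level d n v = {}"
  proof (rule ccontr)
    assume "level d n v \<noteq> {}"
    then obtain x where "x \<in> tree_verts d" "suffix v x" by (auto simp: level_def below_def)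
    then show False using False by (auto simp: tree_verts_def suffix_def)
  qed
  then show ?thesis by simp
qed

lemma card_level:
  assumes "v \<in> tree_verts d" "v \<noteq> []"
  shows "card (level d n v) = (d - 1) ^ n"
proof (induction n)
  case (Suc n)
  have "card (level d (Suc n) v) = (\<Sum>x\<in>level d n v. card (children d x))"
    unfolding level_Suc[OF assms(1)]
    by (rule card_UN_disjoint) (auto elim!: in_childrenD)
  also have "\<dots> = (\<Sum>x\<in>level d n v. d - 1)"
  proof (intro sum.cong refl)
    fix x assume "x \<in> level d n v"
    from level_nonempty_word[OF assms(2) this] show "card (children d x) = d - 1"
      by (simp add: card_children)
  qed
  finally show ?case by (simp add: Suc.IH)
qed (use assms in \<open>simp add: level_0\<close>)

lemma below_disjoint:
  assumes "length x = length y" "x \<noteq> y"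
  shows "below d x \<inter> below d y = {}"
proof (rule ccontr)
  assume "below d x \<inter> below d y \<noteq> {}"
  then obtain w where "suffix x w" "suffix y w" by (auto simp: below_def)
  then have "suffix x y \<or> suffix y x" by (rule suffix_same_cases)
  with assms show False by (auto simp: suffix_def)
qed

lemma loop_verts_nonempty: "\<gamma> \<in> loops d \<Longrightarrow> loop_verts \<gamma> \<noteq> {}"
  by (auto elim!: loopsE simp: based_loops_def)

lemma inside_disjoint: "length x = length y \<Longrightarrow> x \<noteq> y \<Longrightarrow> inside d x \<inter> inside d y = {}"
  using below_disjoint loop_verts_nonempty by (fastforce simp: inside_def)

definition path_edges :: "nat \<Rightarrow> nat list \<Rightarrow> nat list set" where
  "path_edges i x = {s. suffix s x \<and> length s > i}"

lemma finite_path_edges [simp]: "finite (path_edges i x)"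
  by (rule finite_subset[of _ "set (suffixes x)"]) (auto simp: path_edges_def)

lemma path_edges_eq:
  assumes "length x = m + n" "i \<le> n"
  shows "path_edges (m + i) x = (\<lambda>k. drop (n - k) x) ` {Suc i..n}"
proof (intro set_eqI iffI)
  fix s assume "s \<in> path_edges (m + i) x"
  then have s: "suffix s x" "length s > m + i" by (auto simp: path_edges_def)
  then obtain p where p: "x = p @ s" by (auto simp: suffix_def)
  define k where "k = length s - m"
  have "k \<in> {Suc i..n}" "length p = n - k" using s p assms by (auto simp: k_def)
  then show "s \<in> (\<lambda>k. drop (n - k) x) ` {Suc i..n}"
    using p by (intro image_eqI[of _ _ k]) auto
next
  fix s assume "s \<in> (\<lambda>k. drop (n - k) x) ` {Suc i..n}"
  then obtain k where "k \<in> {Suc i..n}" "s = drop (n - k) x" by blast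
  with assms show "s \<in> path_edges (m + i) x" by (auto simp: path_edges_def suffix_drop)
qed

lemma tree_verts_suffix: "suffix s x \<Longrightarrow> x \<in> tree_verts d \<Longrightarrow> s \<in> tree_verts d"
  by (auto simp: suffix_def tree_verts_def)

section \<open>Open edges of the soup restricted to a subtree\<close>

locale loop_percolation =
  fixes d :: nat and \<alpha> \<kappa> :: real
  assumes d_ge3: "d \<ge> 3" and alpha_nonneg: "\<alpha> \<ge> 0" and kappa_gt: "\<kappa> > -1"

sublocale loop_percolation \<subseteq> random_set "loop_soup d \<alpha> \<kappa>" "loops d" "open_ev d \<alpha> \<kappa>" "loop_rate d \<alpha> \<kappa>"
  by (rule loop_soup_random_set) (rule alpha_nonneg)

context loop_percolation
begin

abbreviation "MM \<equiv> loop_soup d \<alpha> \<kappa>"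

abbreviation "w \<equiv> ennreal (1 / ((1 + \<kappa>) * real d))"

text \<open>Only loops inside the subtree of \<open>v\<close> count, so an edge crossed by an open
  loop can still be closed in this sense. The restriction is what makes disjoint subtrees
  independent.\<close>

definition edge_open :: "nat list \<Rightarrow> nat list \<Rightarrow> (nat list list set \<Rightarrow> nat) set" where
  "edge_open v s = hit (inside d v \<inter> cross d s)"

definition path_open :: "nat list \<Rightarrow> nat \<Rightarrow> nat list \<Rightarrow> (nat list list set \<Rightarrow> nat) set" where
  "path_open v i x = space MM \<inter> (\<Inter>s\<in>path_edges i x. edge_open v s)"

text \<open>The case \<alpha> = 0 stands first because it has to win over an infinite mass.\<close>

lemma prob_closed:
  "prob (space MM - edge_open v s) =
     (if \<alpha> = 0 then 1 else if cross_mass d w v s = \<infinity> then 0 else exp (- (\<alpha> * enn2real (cross_mass d w v s))))"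
proof -
  have "(\<integral>\<^sup>+\<gamma>. ennreal (loop_rate d \<alpha> \<kappa> \<gamma>) \<partial>count_space (inside d v \<inter> cross d s)) = ennreal \<alpha> * cross_mass d w v s"
    using nn_integral_loop_measure[OF kappa_gt, of d "\<lambda>V. V \<subseteq> below d v \<and> s \<in> V \<and> \<not> V \<subseteq> below d s"]
      d_ge3 alpha_nonneg unfolding loop_rate_def cross_mass_def inside_cross_eq
    by (simp add: ennreal_mult nn_integral_cmult)
  from prob_no_hit[OF _ this] have "prob (space MM - edge_open v s) =
     (if ennreal \<alpha> * cross_mass d w v s = \<infinity> then 0 else exp (- enn2real (ennreal \<alpha> * cross_mass d w v s)))"
    unfolding edge_open_def using cross_subset by blast
  then show ?thesis using alpha_nonneg
    by (auto simp: ennreal_mult_eq_top_iff enn2real_mult)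
qed

lemma edge_open_mono: "suffix v v' \<Longrightarrow> edge_open v' s \<subseteq> edge_open v s"
  using inside_mono[of v v' d] unfolding edge_open_def hit_def by blast

lemma edge_open_info: "inside d v \<inter> cross d s \<subseteq> A \<Longrightarrow> A \<subseteq> loops d \<Longrightarrow> edge_open v s \<in> info A"
  unfolding edge_open_def by (rule info_hit)

lemma path_open_info:
  assumes "A \<subseteq> loops d" "\<And>s. s \<in> path_edges i x \<Longrightarrow> inside d v \<inter> cross d s \<subseteq> A"
  shows "path_open v i x \<in> info A"
  unfolding path_open_def using assms by (intro info_INT edge_open_info) auto

lemma path_open_info_inside: "path_open v i x \<in> info (inside d v)"
  by (rule path_open_info) (auto simp: inside_subset)

lemma path_open_events: "path_open v i x \<in> events"
  using info_events[OF inside_subset path_open_info_inside] .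

lemma edge_open_events: "edge_open v s \<in> events"
  unfolding edge_open_def using inside_subset by (intro hit_events) auto

text \<open>Splits the failure event by the lowest closed edge \<open>e k\<close>. By
  \<open>cross_inside_reduce\<close> the edges beneath it are covered by loops inside the subtree of
  \<open>e k\<close>; none of these crosses \<open>e k\<close>, so both parts of \<open>R k\<close>
  use disjoint sets of loops.\<close>

lemma last_closed_edge:
  assumes v: "v \<noteq> []" and x: "x \<in> below d v" "length x = length v + n" and i: "i \<le> n"
  defines "e \<equiv> \<lambda>k. drop (n - k) x"
  defines "R \<equiv> \<lambda>k. (space MM - edge_open v (e k)) \<inter> path_open (e k) (length (e k)) x"
  shows "space MM - path_open v (length v + i) x = (\<Union>k\<in>{Suc i..n}. R k)"
    and "disjoint_family_on R {Suc i..n}"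
proof -
  have len: "length (e k) = length v + k" "suffix (e k) x" "suffix v (e k)" if "k \<le> n" for k
  proof -
    show "length (e k) = length v + k" "suffix (e k) x"
      using that x by (auto simp: e_def suffix_drop)
    moreover have "suffix v x" using x by (auto simp: below_def)
    ultimately show "suffix v (e k)" by (metis le_add1 suffix_length_suffix)
  qed
  have suf: "suffix (e k) (e j)" if "k \<le> j" "j \<le> n" for k j
  proof (rule suffix_length_suffix)
    show "suffix (e k) x" "suffix (e j) x" using that by (auto intro: len(2))
    show "length (e k) \<le> length (e j)" using that by (simp add: len(1))
  qed
  have path: "path_open u (length (e k)) x = space MM \<inter> (\<Inter>j\<in>{Suc k..n}. edge_open u (e j))" if "k \<le> n" for u k
    unfolding path_open_def len(1)[OF that] path_edges_eq[OF x(2) that] by (simp add: e_def)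
  have ev: "e k \<in> tree_verts d" if "k \<le> n" for k
    using x len(2)[OF that] by (auto simp: below_def intro: tree_verts_suffix)
  show "disjoint_family_on R {Suc i..n}"
  proof -
    have "R k \<inter> R j = {}" if "k < j" "j \<le> n" for k j
    proof -
      have "R k \<subseteq> edge_open (e k) (e j)" using that by (auto simp: R_def path)
      also have "\<dots> \<subseteq> edge_open v (e j)" using that by (intro edge_open_mono len) auto
      finally show ?thesis by (auto simp: R_def)
    qed
    then show ?thesis unfolding disjoint_family_on_def
      by (metis Int_commute atLeastAtMost_iff linorder_neqE_nat)
  qed
  have base: "path_open v (length v + i) x = space MM \<inter> (\<Inter>j\<in>{Suc i..n}. edge_open v (e j))"
    unfolding path_open_def path_edges_eq[OF x(2) i] by (simp add: e_def)
  show "space MM - path_open v (length v + i) x = (\<Union>k\<in>{Suc i..n}. R k)"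
  proof (intro set_eqI iffI)
    fix \<omega> assume "\<omega> \<in> (\<Union>k\<in>{Suc i..n}. R k)"
    then show "\<omega> \<in> space MM - path_open v (length v + i) x" by (auto simp: R_def base)
  next
    fix \<omega> assume w: "\<omega> \<in> space MM - path_open v (length v + i) x"
    define K where "K = {k \<in> {Suc i..n}. \<omega> \<notin> edge_open v (e k)}"
    have "K \<noteq> {}" "finite K" using w by (auto simp: base K_def)
    define k where "k = Max K"
    have "k \<in> K" unfolding k_def by (rule Max_in) fact+
    then have k: "k \<in> {Suc i..n}" "\<omega> \<notin> edge_open v (e k)" by (auto simp: K_def)
    have "\<omega> \<in> edge_open (e k) (e j)" if j: "j \<in> {Suc k..n}" for j
    proof -
      have "j \<notin> K" using Max_ge[OF \<open>finite K\<close>, of j] j by (auto simp: k_def)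
      then have "\<omega> \<in> edge_open v (e j)" using j k by (auto simp: K_def)
      then obtain \<gamma> where g: "\<gamma> \<in> inside d v \<inter> cross d (e j)" "\<omega> \<in> open_ev d \<alpha> \<kappa> \<gamma>"
        by (auto simp: edge_open_def hit_def)
      have "\<gamma> \<in> (inside d v \<inter> cross d (e k)) \<union> (inside d (e k) \<inter> cross d (e j))"
        using g(1) cross_inside_reduce[of v "e k" "e j" d] len[of k] suf[of k j] ev[of j] j k by auto
      moreover have "\<gamma> \<notin> inside d v \<inter> cross d (e k)"
        using k g(2) by (auto simp: edge_open_def hit_def)
      ultimately show ?thesis using g(2) by (auto simp: edge_open_def hit_def)
    qed
    then have "\<omega> \<in> R k" using w k by (auto simp: R_def path)
    with k show "\<omega> \<in> (\<Union>k\<in>{Suc i..n}. R k)" by blast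
  qed
qed

end

text \<open>\<open>U n\<close> is the probability that an edge \<open>n\<close> levels below the top
  is closed, with U(0) = 1 as a convention for the top itself. Leaving \<open>U\<close> abstract
  serves both finite edge masses and the infinite-mass regime, where it vanishes at positive
  arguments.\<close>

locale loop_renewal = loop_percolation +
  fixes U :: "nat \<Rightarrow> real"
  assumes U: "v \<noteq> [] \<Longrightarrow> s \<in> below d v \<Longrightarrow> length s = length v + Suc n \<Longrightarrow>
      measure (loop_soup d \<alpha> \<kappa>) (space (loop_soup d \<alpha> \<kappa>) - edge_open v s) = U (Suc n)"
    and U0: "U 0 = 1" and U_dec: "decseq U" and U_ge0: "U n \<ge> 0"

sublocale loop_renewal \<subseteq> renewal_eq U "real d - 1"
  using U0 U_dec U_ge0 d_ge3 by unfold_locales auto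

context loop_renewal
begin

text \<open>The first \<open>i\<close> edges below \<open>v\<close> are left free: i = 0 yields the
  renewal equation for \<open>S\<close>, general \<open>i\<close> concerns paths that start
  \<open>i\<close> levels below the top but may use all loops of the larger subtree.\<close>

lemma prob_path_open_aux:
  assumes v: "v \<noteq> []" and x: "x \<in> below d v" "length x = length v + n" and i: "i \<le> n"
    and IH: "\<And>k. k \<in> {Suc i..n} \<Longrightarrow>
       prob (path_open (drop (n - k) x) (length (drop (n - k) x)) x) = S (n - k)"
  shows "prob (path_open v (length v + i) x) = 1 - (\<Sum>k\<in>{Suc i..n}. U k * S (n - k))"
proof -
  define e where "e k = drop (n - k) x" for k
  define R where "R k = (space MM - edge_open v (e k)) \<inter> path_open (e k) (length (e k)) x" for k
  note lc = last_closed_edge[OF v x i, folded e_def, folded R_def]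
  have Rev: "R k \<in> events" for k
    unfolding R_def using edge_open_events path_open_events by auto
  have pR: "prob (R k) = U k * S (n - k)" if k: "k \<in> {Suc i..n}" for k
  proof -
    obtain j where j: "k = Suc j" using k by (cases k) auto
    have "suffix (e k) x" "length (e k) = length v + k" using k x by (auto simp: e_def suffix_drop)
    moreover have "suffix v x" "x \<in> tree_verts d" using x by (auto simp: below_def)
    ultimately have ek: "e k \<in> below d v" "length (e k) = length v + Suc j"
      using j by (auto simp: below_def intro: tree_verts_suffix suffix_length_suffix)
    have "prob (R k) = prob (space MM - edge_open v (e k)) * prob (path_open (e k) (length (e k)) x)"
      unfolding R_def
    proof (rule prob_info_Int)
      show "(inside d v \<inter> cross d (e k)) \<inter> inside d (e k) = {}" by (auto simp: cross_def inside_def)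
      show "space MM - edge_open v (e k) \<in> info (inside d v \<inter> cross d (e k))"
        using cross_subset by (intro info_compl edge_open_info) auto
      show "path_open (e k) (length (e k)) x \<in> info (inside d (e k))" by (rule path_open_info_inside)
    qed (use inside_subset in auto)
    with U[OF v ek] IH[OF k] j show ?thesis by (simp add: e_def)
  qed
  have "1 - prob (path_open v (length v + i) x) = prob (space MM - path_open v (length v + i) x)"
    by (rule prob_compl[symmetric]) (rule path_open_events)
  also have "\<dots> = (\<Sum>k\<in>{Suc i..n}. prob (R k))"
    unfolding lc(1) using lc(2) Rev by (intro finite_measure_finite_Union) auto
  also have "\<dots> = (\<Sum>k\<in>{Suc i..n}. U k * S (n - k))" using pR by (intro sum.cong) auto
  finally show ?thesis by simp
qed

lemma prob_path_open:
  assumes "v \<noteq> []" "x \<in> below d v" "length x = length v + n"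
  shows "prob (path_open v (length v) x) = S n"
  using assms
proof (induction n arbitrary: v rule: less_induct)
  case (less n)
  have "prob (path_open v (length v + 0) x) = 1 - (\<Sum>k\<in>{Suc 0..n}. U k * S (n - k))"
  proof (rule prob_path_open_aux[OF less.prems])
    fix k assume k: "k \<in> {Suc 0..n}"
    have "x \<in> below d (drop (n - k) x)" using less.prems by (auto simp: below_def suffix_drop)
    then show "prob (path_open (drop (n - k) x) (length (drop (n - k) x)) x) = S (n - k)"
      using k less.prems by (intro less.IH) auto
  qed simp
  then show ?case by (subst renewal.simps) simp
qed

lemma prob_path_open_tail:
  assumes v: "v \<noteq> []" and x: "x \<in> below d v" "length x = length v + n" and i: "i \<le> n"
  shows "prob (path_open v (length v + i) x) = (\<Sum>k\<le>i. U k * S (n - k))"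
proof -
  have "prob (path_open v (length v + i) x) = 1 - (\<Sum>k\<in>{Suc i..n}. U k * S (n - k))"
  proof (rule prob_path_open_aux[OF assms])
    fix k assume k: "k \<in> {Suc i..n}"
    have "x \<in> below d (drop (n - k) x)" using x by (auto simp: below_def suffix_drop)
    then show "prob (path_open (drop (n - k) x) (length (drop (n - k) x)) x) = S (n - k)"
      using k x v by (intro prob_path_open) auto
  qed
  then show ?thesis using renewal_tail[OF i] by simp
qed

end

section \<open>Clusters\<close>

context loop_percolation
begin

lemma loop_connected_refl: "loop_connected d \<omega> u u"
  by (simp add: loop_connected_def)

lemma loop_connected_trans:
  assumes "loop_connected d \<omega> u v" "loop_connected d \<omega> v x"
  shows "loop_connected d \<omega> u x"
proof (cases "u = v \<or> v = x")
  case False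
  obtain ls where ls: "ls \<noteq> []" "set ls \<subseteq> open_loops d \<omega>" "u \<in> loop_verts (hd ls)" "v \<in> loop_verts (last ls)"
     "successively (\<lambda>\<gamma> \<gamma>'. loop_verts \<gamma> \<inter> loop_verts \<gamma>' \<noteq> {}) ls"
    using assms(1) False by (auto simp: loop_connected_def)
  obtain ks where ks: "ks \<noteq> []" "set ks \<subseteq> open_loops d \<omega>" "v \<in> loop_verts (hd ks)" "x \<in> loop_verts (last ks)"
     "successively (\<lambda>\<gamma> \<gamma>'. loop_verts \<gamma> \<inter> loop_verts \<gamma>' \<noteq> {}) ks"
    using assms(2) False by (auto simp: loop_connected_def)
  have "successively (\<lambda>\<gamma> \<gamma>'. loop_verts \<gamma> \<inter> loop_verts \<gamma>' \<noteq> {}) (ls @ ks)"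
    using ls ks by (auto simp: successively_append_iff)
  then show ?thesis unfolding loop_connected_def
    using ls ks by (intro disjI2 exI[of _ "ls @ ks"]) auto
qed (use assms in auto)

lemma open_ev_iff: "\<gamma> \<in> loops d \<Longrightarrow> \<omega> \<in> open_ev d \<alpha> \<kappa> \<gamma> \<longleftrightarrow> \<omega> \<in> space MM \<and> \<gamma> \<in> open_loops d \<omega>"
  by (auto simp: open_ev_def open_loops_def)

lemma loop_connected_loop:
  assumes "\<gamma> \<in> open_loops d \<omega>" "u \<in> loop_verts \<gamma>" "v \<in> loop_verts \<gamma>"
  shows "loop_connected d \<omega> u v"
  unfolding loop_connected_def using assms by (intro disjI2 exI[of _ "[\<gamma>]"]) auto

lemma edge_openE:
  assumes "\<omega> \<in> edge_open v s"
  obtains \<gamma> where "\<gamma> \<in> open_loops d \<omega>" "\<gamma> \<in> inside d v" "\<gamma> \<in> cross d s" "s \<in> loop_verts \<gamma>" "tl s \<in> loop_verts \<gamma>"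
proof -
  from assms obtain \<gamma> where g: "\<gamma> \<in> inside d v" "\<gamma> \<in> cross d s" "\<omega> \<in> open_ev d \<alpha> \<kappa> \<gamma>"
    by (auto simp: edge_open_def hit_def)
  moreover have "\<gamma> \<in> loops d" "s \<in> loop_verts \<gamma>" using g by (auto simp: cross_def)
  ultimately show ?thesis using that[of \<gamma>] cross_tl[of \<gamma> d s] open_ev_iff[of \<gamma> \<omega>] by blast
qed

lemma path_open_connected:
  assumes "x \<in> below d v" "\<omega> \<in> path_open v (length v) x"
  shows "loop_connected d \<omega> v x"
  using assms
proof (induction "length x" arbitrary: x)
  case 0
  then show ?case by (cases "x = v") (auto simp: below_def loop_connected_refl)
next
  case (Suc n)
  show ?case
  proof (cases "x = v")
    case False
    note b = below_cases[OF Suc.prems(1) False]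
    obtain a where x: "x = a # tl x" using b(1) by (cases x) auto
    have "path_edges (length v) (tl x) \<subseteq> path_edges (length v) x"
      by (subst (2) x) (auto simp: path_edges_def suffix_ConsI)
    then have "\<omega> \<in> path_open v (length v) (tl x)" using Suc.prems(2) by (auto simp: path_open_def)
    then have 1: "loop_connected d \<omega> v (tl x)" using Suc.hyps b by (intro Suc.hyps(1)) auto
    have "length x = Suc (length (tl x))" using b(1) by (cases x) auto
    then have "x \<in> path_edges (length v) x" using b(3) by (simp add: path_edges_def)
    then have "\<omega> \<in> edge_open v x" using Suc.prems(2) by (auto simp: path_open_def)
    then obtain \<gamma> where "\<gamma> \<in> open_loops d \<omega>" "x \<in> loop_verts \<gamma>" "tl x \<in> loop_verts \<gamma>"
      by (rule edge_openE)
    then have "loop_connected d \<omega> (tl x) x" by (intro loop_connected_loop)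
    with 1 show ?thesis by (rule loop_connected_trans)
  qed (simp add: loop_connected_refl)
qed

lemma theta_eq: "\<theta> d \<alpha> \<kappa> = prob {\<omega> \<in> space MM. infinite (cluster d \<omega> [])}"
  by (simp add: \<theta>_def tree_root_def)

end

section \<open>Survival of an embedded branching process\<close>

text \<open>Keeps the error of the linear approximation quadratic in k e, so that the linear gain
  wins in the survival recursion.\<close>

lemma power_one_minus_le:
  fixes e :: real
  assumes "0 \<le> e" "e \<le> 1"
  shows "(1 - e) ^ k \<le> 1 - real k * e + (real k * e)\<^sup>2"
proof (induction k)
  case (Suc k)
  have "(1 - e) ^ Suc k \<le> (1 - e) * (1 - real k * e + (real k * e)\<^sup>2)"
    using Suc assms by (simp add: mult_left_mono)
  also have "\<dots> = 1 - real (Suc k) * e + (real k * e)\<^sup>2 + real k * e\<^sup>2 - (real k * e)\<^sup>2 * e"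
    by (simp add: power2_eq_square algebra_simps)
  also have "\<dots> \<le> 1 - real (Suc k) * e + (real k * e)\<^sup>2 + real k * e\<^sup>2"
    using assms by simp
  also have "\<dots> \<le> 1 - real (Suc k) * e + (real (Suc k) * e)\<^sup>2"
    using assms by (simp add: power2_eq_square algebra_simps)
  finally show ?case .
qed simp

context loop_renewal
begin

text \<open>Survival for \<open>j\<close> generations of a branching process whose generations are
  \<open>N\<close> levels apart. Each individual restarts with the loops inside its own subtree,
  which discards connections but gives independence.\<close>

fun survive :: "nat \<Rightarrow> nat \<Rightarrow> nat list \<Rightarrow> (nat list list set \<Rightarrow> nat) set" where
  "survive N 0 v = space MM"
| "survive N (Suc j) v = (\<Union>x\<in>level d N v. path_open v (length v) x \<inter> survive N j x)"

lemma inside_level: "x \<in> level d N v \<Longrightarrow> inside d x \<subseteq> inside d v"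
  by (rule inside_mono) (auto simp: level_def below_def)

lemma survive_info: "survive N j v \<in> info (inside d v)"
proof (induction j arbitrary: v)
  case (Suc j)
  have "path_open v (length v) x \<inter> survive N j x \<in> info (inside d v)" if "x \<in> level d N v" for x
    using Suc[of x] info_mono[OF inside_level[OF that]]
    by (intro info_Int path_open_info_inside inside_subset) auto
  then show ?case by (auto intro!: info_UN inside_subset countable_finite)
qed (simp add: space_info)

lemma survive_events: "survive N j v \<in> events"
  using info_events[OF inside_subset survive_info] .

lemma survive_decseq: "survive N (Suc j) v \<subseteq> survive N j v"
proof (induction j arbitrary: v)
  case 0
  then show ?case using sets.sets_into_space[OF survive_events[of N "Suc 0" v]] by simp
next
  case (Suc j)
  show ?case by (subst (1 2) survive.simps(2)) (use Suc in blast)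
qed

lemma survive_connected:
  assumes "v \<in> tree_verts d" "\<omega> \<in> survive N j v"
  shows "\<exists>x\<in>level d (N * j) v. loop_connected d \<omega> v x"
  using assms
proof (induction j arbitrary: v)
  case 0
  then show ?case by (simp add: level_0 loop_connected_refl)
next
  case (Suc j)
  then obtain x where x: "x \<in> level d N v" "\<omega> \<in> path_open v (length v) x" "\<omega> \<in> survive N j x" by auto
  have xv: "x \<in> below d v" "x \<in> tree_verts d" "suffix v x" "length x = length v + N"
    using x(1) by (auto simp: level_def below_def)
  obtain y where y: "y \<in> level d (N * j) x" "loop_connected d \<omega> x y"
    using Suc.IH[OF xv(2) x(3)] by blast
  have "y \<in> level d (N * Suc j) v"
    using y(1) xv by (auto simp: level_def below_def intro: suffix_order.trans)
  moreover have "loop_connected d \<omega> v y"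
    using path_open_connected[OF xv(1) x(2)] y(2) by (rule loop_connected_trans)
  ultimately show ?case by blast
qed

definition offspring :: "nat \<Rightarrow> nat list \<Rightarrow> nat list set \<Rightarrow> (nat list list set \<Rightarrow> nat) set" where
  "offspring N v Z = space MM \<inter> \<Inter>((\<lambda>x. if x \<in> Z then path_open v (length v) x else space MM - path_open v (length v) x) ` level d N v)"

text \<open>The loops that may decide which vertices of level \<open>N\<close> are reached; they are
  disjoint from those that govern the later generations.\<close>

definition upper_loops :: "nat \<Rightarrow> nat list \<Rightarrow> nat list list set set" where
  "upper_loops N v = inside d v - (\<Union>x\<in>level d N v. inside d x)"

lemma upper_loops_subset: "upper_loops N v \<subseteq> loops d"
  using inside_subset by (auto simp: upper_loops_def)

lemma path_open_upper:
  assumes x: "x \<in> level d N v"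
  shows "path_open v (length v) x \<in> info (upper_loops N v)"
proof (rule path_open_info[OF upper_loops_subset])
  fix s assume s: "s \<in> path_edges (length v) x"
  then have l: "length s \<le> length v + N" "s \<noteq> []"
    using x by (auto simp: path_edges_def level_def dest: suffix_length_le)
  show "inside d v \<inter> cross d s \<subseteq> upper_loops N v"
  proof
    fix \<gamma> assume g: "\<gamma> \<in> inside d v \<inter> cross d s"
    \<comment> \<open>A loop crossing an edge at or above level \<open>N\<close> visits its upper
      endpoint, which is too short a word to lie below a vertex of level \<open>N\<close>.\<close>
    have "\<gamma> \<notin> inside d y" if y: "y \<in> level d N v" for y
    proof
      assume "\<gamma> \<in> inside d y"
      then have "tl s \<in> below d y" using cross_tl[of \<gamma> d s] g by (auto simp: inside_def)
      then have "length y \<le> length (tl s)" by (auto simp: below_def dest: suffix_length_le)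
      with l y show False by (cases s) (auto simp: level_def)
    qed
    with g show "\<gamma> \<in> upper_loops N v" by (auto simp: upper_loops_def)
  qed
qed

lemma offspring_info: "offspring N v Z \<in> info (upper_loops N v)"
  unfolding offspring_def
  by (intro info_INT upper_loops_subset) (auto intro: path_open_upper info_compl)

lemma offspring_events: "offspring N v Z \<in> events"
  using info_events[OF upper_loops_subset offspring_info] .

lemma offspring_iff:
  assumes "Z \<subseteq> level d N v"
  shows "\<omega> \<in> offspring N v Z \<longleftrightarrow> \<omega> \<in> space MM \<and> Z = {x \<in> level d N v. \<omega> \<in> path_open v (length v) x}"
  using assms unfolding offspring_def by (auto split: if_splits)

lemma prob_offspring_partition:
  assumes X: "X \<in> events"
  shows "prob X = (\<Sum>Z\<in>Pow (level d N v). prob (offspring N v Z \<inter> X))"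
proof -
  have "X = (\<Union>Z\<in>Pow (level d N v). offspring N v Z \<inter> X)"
  proof (intro set_eqI iffI)
    fix \<omega> assume w: "\<omega> \<in> X"
    then have "\<omega> \<in> space MM" using sets.sets_into_space[OF X] by blast
    then have "\<omega> \<in> offspring N v {x \<in> level d N v. \<omega> \<in> path_open v (length v) x}"
      by (subst offspring_iff) auto
    with w show "\<omega> \<in> (\<Union>Z\<in>Pow (level d N v). offspring N v Z \<inter> X)"
      by (intro UN_I[of "{x \<in> level d N v. \<omega> \<in> path_open v (length v) x}"]) auto
  qed auto
  moreover have "(\<lambda>Z. offspring N v Z \<inter> X) ` Pow (level d N v) \<subseteq> events"
    using offspring_events X by auto
  moreover have "disjoint_family_on (\<lambda>Z. offspring N v Z \<inter> X) (Pow (level d N v))"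
  proof -
    have "Z = Z'" if "Z \<in> Pow (level d N v)" "Z' \<in> Pow (level d N v)" "\<omega> \<in> offspring N v Z" "\<omega> \<in> offspring N v Z'" for Z Z' \<omega>
      using that offspring_iff[of Z N v \<omega>] offspring_iff[of Z' N v \<omega>] by simp
    then show ?thesis unfolding disjoint_family_on_def by blast
  qed
  ultimately show ?thesis
    using finite_measure_finite_Union[of "Pow (level d N v)" "\<lambda>Z. offspring N v Z \<inter> X"]
    by (metis finite_Pow_iff finite_level)
qed

lemma expected_offspring:
  assumes v: "v \<in> tree_verts d" "v \<noteq> []"
  shows "(\<Sum>Z\<in>Pow (level d N v). prob (offspring N v Z) * real (card Z)) = t N"
proof -
  let ?L = "level d N v"
  have "t N = (\<Sum>x\<in>?L. prob (path_open v (length v) x))"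
  proof -
    have "prob (path_open v (length v) x) = S N" if "x \<in> ?L" for x
      using that v by (intro prob_path_open) (auto simp: level_def)
    then show ?thesis using card_level[OF v, of N] d_ge3 by (simp add: t_def of_nat_diff)
  qed
  also have "\<dots> = (\<Sum>x\<in>?L. \<Sum>Z\<in>Pow ?L. prob (offspring N v Z) * of_bool (x \<in> Z))"
  proof (intro sum.cong refl)
    fix x assume x: "x \<in> ?L"
    have "prob (path_open v (length v) x) = (\<Sum>Z\<in>Pow ?L. prob (offspring N v Z \<inter> path_open v (length v) x))"
      by (rule prob_offspring_partition) (rule path_open_events)
    also have "\<dots> = (\<Sum>Z\<in>Pow ?L. prob (offspring N v Z) * of_bool (x \<in> Z))"
    proof (intro sum.cong refl)
      fix Z assume Z: "Z \<in> Pow ?L"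
      have "offspring N v Z \<inter> path_open v (length v) x = (if x \<in> Z then offspring N v Z else {})"
        using Z x offspring_iff[of Z N v] by auto
      then show "prob (offspring N v Z \<inter> path_open v (length v) x) = prob (offspring N v Z) * of_bool (x \<in> Z)" by simp
    qed
    finally show "prob (path_open v (length v) x) = (\<Sum>Z\<in>Pow ?L. prob (offspring N v Z) * of_bool (x \<in> Z))" .
  qed
  also have "\<dots> = (\<Sum>Z\<in>Pow ?L. \<Sum>x\<in>?L. prob (offspring N v Z) * of_bool (x \<in> Z))"
    by (rule sum.swap)
  also have "\<dots> = (\<Sum>Z\<in>Pow ?L. prob (offspring N v Z) * real (card Z))"
  proof (intro sum.cong refl)
    fix Z assume "Z \<in> Pow ?L"
    then have "(\<Sum>x\<in>?L. of_bool (x \<in> Z)) = real (card Z)"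
      by (simp add: of_bool_def sum.If_cases Int_absorb1 Int_absorb2)
    then show "(\<Sum>x\<in>?L. prob (offspring N v Z) * of_bool (x \<in> Z)) = prob (offspring N v Z) * real (card Z)"
      by (simp flip: sum_distrib_left)
  qed
  finally show ?thesis by simp
qed

text \<open>The offspring \<open>Z\<close> are decided by \<open>upper_loops\<close>, the extinction
  of each member \<open>x\<close> of \<open>Z\<close> by \<open>inside d x\<close>. All these sets
  of loops are disjoint, so the probabilities multiply.\<close>

lemma prob_not_survive:
  assumes v: "v \<in> tree_verts d" "v \<noteq> []" and Z: "Z \<subseteq> level d N v"
  shows "prob (offspring N v Z \<inter> (space MM - survive N (Suc j) v)) =
         prob (offspring N v Z) * (\<Prod>x\<in>Z. 1 - prob (survive N j x))"
proof -
  have fZ: "finite Z" using Z finite_level finite_subset by blast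
  have eq: "offspring N v Z \<inter> (space MM - survive N (Suc j) v) =
        offspring N v Z \<inter> (space MM \<inter> \<Inter>((\<lambda>x. space MM - survive N j x) ` Z))"
    using offspring_iff[OF Z] Z by auto
  have "prob (space MM \<inter> \<Inter>((\<lambda>x. space MM - survive N j x) ` Z)) = (\<Prod>x\<in>Z. prob (space MM - survive N j x))"
  proof (rule prob_info_INT[OF fZ, where A = "inside d"])
    show "disjoint_family_on (inside d) Z"
    proof -
      have "length x = length v + N" if "x \<in> Z" for x using that Z by (auto simp: level_def)
      then show ?thesis unfolding disjoint_family_on_def by (auto intro!: inside_disjoint)
    qed
  qed (auto simp: inside_subset survive_info info_compl)
  moreover have "prob (offspring N v Z \<inter> (space MM \<inter> \<Inter>((\<lambda>x. space MM - survive N j x) ` Z))) =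
     prob (offspring N v Z) * prob (space MM \<inter> \<Inter>((\<lambda>x. space MM - survive N j x) ` Z))"
  proof (rule prob_info_Int)
    show "upper_loops N v \<inter> (\<Union>x\<in>Z. inside d x) = {}" using Z by (auto simp: upper_loops_def)
    show U: "(\<Union>x\<in>Z. inside d x) \<subseteq> loops d" using inside_subset by blast
    show "space MM \<inter> \<Inter>((\<lambda>x. space MM - survive N j x) ` Z) \<in> info (\<Union>x\<in>Z. inside d x)"
    proof (rule info_INT[OF U fZ])
      fix x assume "x \<in> Z"
      then have "info (inside d x) \<subseteq> info (\<Union>x\<in>Z. inside d x)" by (intro info_mono) auto
      then show "space MM - survive N j x \<in> info (\<Union>x\<in>Z. inside d x)"
        using info_compl[OF survive_info[of N j x]] by blast
    qed
  qed (auto simp: upper_loops_subset offspring_info)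
  ultimately show ?thesis unfolding eq by (simp add: prob_compl survive_events)
qed

text \<open>A branching process with mean offspring above 1, by induction over the generations: the
  second-order bound on extinction leaves a survival probability of at least e (1 - B e)
  t(N).\<close>

lemma ex_survive_lower_bound:
  assumes N: "t N > 1"
  obtains e where "e > 0" "\<And>j v. v \<in> tree_verts d \<Longrightarrow> v \<noteq> [] \<Longrightarrow> prob (survive N j v) \<ge> e"
proof
  define B where "B = real ((d - 1) ^ N)"
  \<comment> \<open>The solution of (1 - B e) t(N) = 1, so that the induction reproduces
    \<open>e\<close> exactly; \<open>B\<close> bounds the number of offspring.\<close>
  define e where "e = (1 - 1 / t N) / B"
  have B: "B \<ge> 1" unfolding B_def using d_ge3 by simp
  have tN: "0 < 1 - 1 / t N" "1 - 1 / t N < 1" using N by auto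
  show e: "e > 0" unfolding e_def using tN B by simp
  have "e \<le> (1 - 1 / t N) / 1" unfolding e_def using B tN by (intro divide_left_mono) auto
  then have e1: "e \<le> 1" using tN(2) unfolding div_by_1 by linarith
  have Be: "(1 - B * e) * t N = 1" using B N by (simp add: e_def)
  show "prob (survive N j v) \<ge> e" if "v \<in> tree_verts d" "v \<noteq> []" for j v
    using that
  proof (induction j arbitrary: v)
    case (Suc j)
    let ?L = "level d N v"
    have bound: "prob (offspring N v Z \<inter> (space MM - survive N (Suc j) v)) \<le>
        prob (offspring N v Z) - e * (1 - B * e) * (prob (offspring N v Z) * real (card Z))" if Z: "Z \<in> Pow ?L" for Z
    proof -
      have "card Z \<le> card ?L" using Z by (intro card_mono) auto
      then have cB: "real (card Z) \<le> B" unfolding B_def using card_level[OF Suc.prems, of N] by simp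
      have "(\<Prod>x\<in>Z. 1 - prob (survive N j x)) \<le> (\<Prod>x\<in>Z. 1 - e)"
      proof (rule prod_mono)
        fix x assume "x \<in> Z"
        then have "x \<in> ?L" using Z by auto
        then have "e \<le> prob (survive N j x)"
          using level_nonempty_word[OF Suc.prems(2)] by (intro Suc.IH) auto
        then show "0 \<le> 1 - prob (survive N j x) \<and> 1 - prob (survive N j x) \<le> 1 - e"
          by simp
      qed
      also have "\<dots> = (1 - e) ^ card Z" by simp
      also have "\<dots> \<le> 1 - real (card Z) * e + (real (card Z) * e)\<^sup>2"
        using e e1 by (intro power_one_minus_le) auto
      also have "(real (card Z) * e)\<^sup>2 \<le> real (card Z) * e * (B * e)"
        unfolding power2_eq_square using e cB by (intro mult_left_mono mult_right_mono) auto
      finally have "(\<Prod>x\<in>Z. 1 - prob (survive N j x)) \<le> 1 - e * (1 - B * e) * real (card Z)"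
        by (simp add: algebra_simps)
      then have "prob (offspring N v Z) * (\<Prod>x\<in>Z. 1 - prob (survive N j x)) \<le>
          prob (offspring N v Z) * (1 - e * (1 - B * e) * real (card Z))"
        by (intro mult_left_mono) auto
      then show ?thesis using Z by (subst prob_not_survive[OF Suc.prems]) (auto simp: algebra_simps)
    qed
    have "1 - prob (survive N (Suc j) v) = prob (space MM - survive N (Suc j) v)"
      by (rule prob_compl[symmetric]) (rule survive_events)
    also have "\<dots> = (\<Sum>Z\<in>Pow ?L. prob (offspring N v Z \<inter> (space MM - survive N (Suc j) v)))"
      by (rule prob_offspring_partition) (rule sets.compl_sets[OF survive_events])
    also have "\<dots> \<le> (\<Sum>Z\<in>Pow ?L. prob (offspring N v Z) - e * (1 - B * e) * (prob (offspring N v Z) * real (card Z)))"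
      by (intro sum_mono bound)
    also have "\<dots> = (\<Sum>Z\<in>Pow ?L. prob (offspring N v Z)) - e * (1 - B * e) * t N"
      by (simp add: sum_subtractf expected_offspring[OF Suc.prems] flip: sum_distrib_left)
    also have "(\<Sum>Z\<in>Pow ?L. prob (offspring N v Z)) = 1"
    proof -
      have "offspring N v Z \<inter> space MM = offspring N v Z" for Z by (auto simp: offspring_def)
      then show ?thesis using prob_offspring_partition[OF sets.top, of N v] by (simp add: prob_space)
    qed
    also have "e * (1 - B * e) * t N = e" using Be by (simp add: mult.assoc)
    finally show ?case by simp
  qed (use e1 in \<open>simp add: prob_space\<close>)
qed

text \<open>Survival below a child \<open>v\<close> of the root is decided by the loops inside that
  branch. The loop running once along the edge from the root to \<open>v\<close> is not among them,
  so it is independently open and ties the root to an infinite cluster.\<close>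

lemma theta_pos:
  assumes a: "\<alpha> > 0" and N: "t N > 1"
  shows "\<theta> d \<alpha> \<kappa> > 0"
proof -
  obtain e where e: "e > 0" "\<And>j v. v \<in> tree_verts d \<Longrightarrow> v \<noteq> [] \<Longrightarrow> prob (survive N j v) \<ge> e"
    using ex_survive_lower_bound[OF N] by metis
  have N0: "N > 0" using N t_0 by (cases N) auto
  define v :: "nat list" where "v = [0]"
  have v: "v \<in> tree_verts d" "v \<noteq> []" using d_ge3 by (auto simp: v_def tree_verts_def)
  define l where "l = [[], v]"
  define \<gamma> where "\<gamma> = shift_rel d `` {l}"
  have l: "l \<in> based_loops d"
    using v by (auto simp: l_def based_loops_def tree_adj_def tree_verts_def v_def)
  then have g: "\<gamma> \<in> loops d" "loop_verts \<gamma> = {[], v}"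
    by (auto simp: \<gamma>_def loops_def quotientI loop_verts_class) (auto simp: l_def)
  define Y where "Y = (\<Inter>j. survive N j v)"
  have dec: "decseq (\<lambda>j. survive N j v)"
    by (rule decseq_SucI) (rule survive_decseq)
  have "(\<lambda>j. prob (survive N j v)) \<longlonglongrightarrow> prob Y"
    unfolding Y_def using dec survive_events by (intro finite_Lim_measure_decseq) auto
  then have Y: "prob Y \<ge> e"
    by (rule LIMSEQ_le_const) (use e(2)[OF v] in auto)
  have Yi: "Y \<in> info (inside d v)"
  proof -
    interpret sigma_algebra "space MM" "info (inside d v)" by (rule sigma_algebra_info[OF inside_subset])
    show ?thesis unfolding Y_def using survive_info by (intro countable_INT) auto
  qed
  have "prob (hit {\<gamma>} \<inter> Y) = prob (hit {\<gamma>}) * prob Y"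
  proof (rule prob_info_Int)
    show "{\<gamma>} \<inter> inside d v = {}" using g by (auto simp: inside_def below_def v_def)
    show "hit {\<gamma>} \<in> info {\<gamma>}" using g by (intro info_hit) auto
  qed (use g Yi inside_subset in auto)
  moreover have "prob (hit {\<gamma>}) = 1 - exp (- loop_rate d \<alpha> \<kappa> \<gamma>)"
    using g by (simp add: hit_def prob_ev)
  moreover have "loop_rate d \<alpha> \<kappa> \<gamma> > 0"
  proof -
    have "finite \<gamma>" using g by (intro finite_loop)
    have "l \<in> \<gamma>" using l by (auto simp: \<gamma>_def shift_rel_def intro: exI[of _ 0])
    have term_pos: "1 / real (length l) * (1 / (1 + \<kappa>)) ^ length l * (1 / real d) ^ length l > 0"
      using kappa_gt d_ge3 by (simp add: l_def)
    have "0 < ennreal (1 / real (length l) * (1 / (1 + \<kappa>)) ^ length l * (1 / real d) ^ length l)"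
      using term_pos by simp
    also have "\<dots> \<le> emeasure (loop_measure d \<kappa>) {\<gamma>}"
      unfolding emeasure_loop_measure[OF g(1)] using \<open>finite \<gamma>\<close> \<open>l \<in> \<gamma>\<close>
      by (intro member_le_sum) auto
    finally have "emeasure (loop_measure d \<kappa>) {\<gamma>} > 0" .
    moreover have "emeasure (loop_measure d \<kappa>) {\<gamma>} < \<infinity>"
      unfolding emeasure_loop_measure[OF g(1)] using \<open>finite \<gamma>\<close> by simp
    ultimately have "measure (loop_measure d \<kappa>) {\<gamma>} > 0"
      by (simp add: measure_def enn2real_positive_iff)
    then show ?thesis using a by (simp add: loop_rate_def)
  qed
  ultimately have "prob (hit {\<gamma>} \<inter> Y) > 0"
    using Y e(1) by simp
  also have "prob (hit {\<gamma>} \<inter> Y) \<le> \<theta> d \<alpha> \<kappa>"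
    unfolding theta_eq
  proof (rule finite_measure_mono)
    show "{\<omega> \<in> space MM. infinite (cluster d \<omega> [])} \<in> events" by (rule infinite_cluster_measurable)
    show "hit {\<gamma>} \<inter> Y \<subseteq> {\<omega> \<in> space MM. infinite (cluster d \<omega> [])}"
    proof
      fix \<omega> assume w: "\<omega> \<in> hit {\<gamma>} \<inter> Y"
      then have ws: "\<omega> \<in> space MM" "\<gamma> \<in> open_loops d \<omega>"
        using open_ev_iff[OF g(1)] by (auto simp: hit_def)
      have root: "loop_connected d \<omega> [] v" using ws(2) g by (intro loop_connected_loop[of \<gamma>]) auto
      have "\<exists>x\<in>cluster d \<omega> []. length x = Suc (N * j)" for j
      proof -
        have "\<omega> \<in> survive N j v" using w by (auto simp: Y_def)
        then obtain x where "x \<in> level d (N * j) v" "loop_connected d \<omega> v x"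
          using survive_connected[OF v(1)] by blast
        then show ?thesis using loop_connected_trans[OF root]
          by (intro bexI[of _ x]) (auto simp: cluster_def level_def below_def v_def)
      qed
      then have "range (\<lambda>j. Suc (N * j)) \<subseteq> length ` cluster d \<omega> []"
        by (metis (no_types, lifting) image_eqI image_subsetI)
      moreover have "infinite (range (\<lambda>j. Suc (N * j)))"
        using N0 by (intro range_inj_infinite) (auto simp: inj_on_def)
      ultimately have "infinite (cluster d \<omega> [])"
        using finite_surj by blast
      with ws show "\<omega> \<in> {\<omega> \<in> space MM. infinite (cluster d \<omega> [])}" by simp
    qed
  qed
  finally show ?thesis .
qed

end

section \<open>Finiteness of clusters\<close>

context loop_percolation
begin

definition root_loops :: "nat list list set set" where
  "root_loops = {\<gamma> \<in> loops d. [] \<in> loop_verts \<gamma>}"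

text \<open>\<open>[last y]\<close> is the ancestor of \<open>y\<close> adjacent to the root, so the
  loops used are those in its branch, which avoid the root.\<close>

definition branch_cluster :: "(nat list list set \<Rightarrow> nat) \<Rightarrow> nat list \<Rightarrow> nat list set" where
  "branch_cluster \<omega> y = {x \<in> below d y. \<omega> \<in> path_open [last y] (length y) x}"

text \<open>Beyond the last vertex \<open>y\<close> of the path from the root to \<open>x\<close> that is visited by an open loop
  through the root, the edges of the path are covered by loops that avoid the root.\<close>

lemma cluster_subset:
  assumes w: "\<omega> \<in> space MM"
  defines "W \<equiv> \<Union>(loop_verts ` {\<gamma> \<in> root_loops. \<omega> \<in> open_ev d \<alpha> \<kappa> \<gamma>})"
  shows "cluster d \<omega> [] \<subseteq> {[]} \<union> W \<union> (\<Union>y\<in>W - {[]}. branch_cluster \<omega> y)"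
proof
  fix x assume "x \<in> cluster d \<omega> []"
  then have x: "x \<in> tree_verts d" "loop_connected d \<omega> [] x" by (auto simp: cluster_def)
  show "x \<in> {[]} \<union> W \<union> (\<Union>y\<in>W - {[]}. branch_cluster \<omega> y)"
  proof (cases "x = [] \<or> x \<in> W")
    case False
    then have x0: "x \<noteq> []" "x \<notin> W" by auto
    obtain ls where ls: "ls \<noteq> []" "set ls \<subseteq> open_loops d \<omega>" "[] \<in> loop_verts (hd ls)" "x \<in> loop_verts (last ls)"
       "successively (\<lambda>\<gamma> \<gamma>'. loop_verts \<gamma> \<inter> loop_verts \<gamma>' \<noteq> {}) ls"
      using x(2) x0 by (auto simp: loop_connected_def)
    \<comment> \<open>If no open loop crossed the edge at \<open>s\<close>, a chain of open loops
      starting at the root could not enter the subtree of \<open>s\<close>, which contains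
      \<open>x\<close>.\<close>
    have cov: "\<exists>\<gamma>\<in>open_loops d \<omega>. \<gamma> \<in> cross d s" if s: "suffix s x" "s \<noteq> []" for s
    proof (rule ccontr)
      assume nc: "\<not> (\<exists>\<gamma>\<in>open_loops d \<omega>. \<gamma> \<in> cross d s)"
      have r: "[] \<notin> below d s" using s by (auto simp: below_def)
      have stay: "loop_verts \<gamma> \<inter> below d s = {}" if g: "\<gamma> \<in> set ls" and u: "u \<in> loop_verts \<gamma>" "u \<notin> below d s" for \<gamma> u
      proof (rule ccontr)
        assume "loop_verts \<gamma> \<inter> below d s \<noteq> {}"
        then have "\<gamma> \<in> cross d s"
          using loop_crosses[of \<gamma> d _ s u] u g ls(2) by (auto simp: open_loops_def)
        then show False using nc g ls(2) by auto
      qed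
      have "\<forall>\<gamma>\<in>set ls. loop_verts \<gamma> \<inter> below d s = {}"
      proof (rule successively_invariant[OF ls(5,1)])
        show "loop_verts (hd ls) \<inter> below d s = {}" using stay[of "hd ls" "[]"] ls(1,3) r by auto
        show "loop_verts \<gamma>' \<inter> below d s = {}" if "\<gamma>' \<in> set ls" "loop_verts \<gamma> \<inter> loop_verts \<gamma>' \<noteq> {}" "loop_verts \<gamma> \<inter> below d s = {}" for \<gamma> \<gamma>'
          using that stay[of \<gamma>'] by blast
      qed
      then have "x \<notin> below d s" using ls(1,4) by auto
      then show False using s x by (auto simp: below_def)
    qed
    define Q where "Q = {s \<in> set (suffixes x). s \<in> W \<or> s = []}"
    have "finite Q" unfolding Q_def by (rule finite_subset[OF _ finite_set[of "suffixes x"]]) blast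
    moreover have "[] \<in> Q" by (simp add: Q_def)
    ultimately have "finite (length ` Q)" "length ` Q \<noteq> {}" by auto
    from Max_in[OF this] Max_ge[OF this(1)] obtain y where y: "y \<in> Q" "\<And>s. s \<in> Q \<Longrightarrow> length s \<le> length y"
      by auto
    have far: "s \<notin> W \<and> s \<noteq> []" if "suffix s x" "length s > length y" for s
      using y(2)[of s] that by (auto simp: Q_def)
    have avoid: "\<exists>\<gamma>\<in>open_loops d \<omega>. \<gamma> \<in> cross d s \<and> [] \<notin> loop_verts \<gamma>" if s: "suffix s x" "length s > length y" for s
    proof -
      obtain \<gamma> where g: "\<gamma> \<in> open_loops d \<omega>" "\<gamma> \<in> cross d s" using cov[OF s(1)] far[OF s] by blast
      have gl: "\<gamma> \<in> loops d" "s \<in> loop_verts \<gamma>" using g(2) by (auto simp: cross_def)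
      have "[] \<notin> loop_verts \<gamma>"
      proof
        assume "[] \<in> loop_verts \<gamma>"
        then have "s \<in> W" using g gl open_ev_iff[OF gl(1), of \<omega>] w by (auto simp: W_def root_loops_def)
        then show False using far[OF s] by simp
      qed
      with g show ?thesis by blast
    qed
    have sx: "suffix y x" using y(1) by (auto simp: Q_def)
    have lx: "suffix [last x] x" using x0(1) by (metis append_butlast_last_id suffix_def)
    \<comment> \<open>Otherwise a loop avoiding the root would cross the edge at the child
      \<open>[last x]\<close> of the root, whose upper endpoint is the root.\<close>
    have y0: "y \<noteq> []"
    proof
      assume "y = []"
      then obtain \<gamma> where "\<gamma> \<in> cross d [last x]" "[] \<notin> loop_verts \<gamma>" using avoid[OF lx] by auto
      then show False using cross_tl[of \<gamma> d "[last x]"] by simp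
    qed
    then have yW: "y \<in> W - {[]}" using y(1) by (auto simp: Q_def)
    have last: "last y = last x" using sx y0 by (auto simp: suffix_def)
    have "\<omega> \<in> edge_open [last y] s" if s: "s \<in> path_edges (length y) x" for s
    proof -
      have s': "suffix s x" "length s > length y" using s by (auto simp: path_edges_def)
      obtain \<gamma> where g: "\<gamma> \<in> open_loops d \<omega>" "\<gamma> \<in> cross d s" "[] \<notin> loop_verts \<gamma>" using avoid[OF s'] by blast
      have gl: "\<gamma> \<in> loops d" "s \<in> loop_verts \<gamma>" using g(2) by (auto simp: cross_def)
      have "suffix [last x] s" using lx s'(1) by (rule suffix_length_suffix) (use s'(2) in simp)
      then have sb: "s \<in> below d [last x]" using tree_verts_suffix[OF s'(1) x(1)] by (simp add: below_def)
      have "\<gamma> \<in> inside d [last x]"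
      proof (rule ccontr)
        assume "\<gamma> \<notin> inside d [last x]"
        then obtain u where "u \<in> loop_verts \<gamma>" "u \<notin> below d [last x]" using gl by (auto simp: inside_def)
        then have "\<gamma> \<in> cross d [last x]" using loop_crosses[OF gl sb] by blast
        then show False using cross_tl[of \<gamma> d "[last x]"] g(3) by simp
      qed
      then show ?thesis unfolding edge_open_def hit_def last
        using g open_ev_iff[OF gl(1), of \<omega>] w by auto
    qed
    then have "x \<in> branch_cluster \<omega> y"
      using w sx x(1) by (auto simp: branch_cluster_def path_open_def below_def)
    with yW show ?thesis by blast
  qed auto
qed

end

context loop_renewal
begin

text \<open>Borel-Cantelli over the levels below \<open>y\<close>: almost surely only finitely many
  of them are reached, and each level is finite.\<close>

lemma AE_finite_branch_cluster:
  assumes t: "summable t" and y: "y \<in> tree_verts d" "y \<noteq> []"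
  shows "AE \<omega> in MM. finite (branch_cluster \<omega> y)"
proof -
  define i where "i = length y - 1"
  define v where "v = [last y]"
  have i: "length y = length v + i" using y by (cases y) (auto simp: i_def v_def)
  have vy: "suffix v y" using y(2) unfolding v_def by (metis append_butlast_last_id suffix_def)
  define B where "B m = (\<Union>x\<in>level d m y. path_open v (length y) x)" for m
  have B: "B m \<in> events" for m unfolding B_def using path_open_events by auto
  \<comment> \<open>The loops may come from the whole branch, whose top lies \<open>i\<close> levels
    above \<open>y\<close>. So \<open>prob_path_open_tail\<close> gives i + 1 summands, each
    dominated by a shifted t.\<close>
  have pB: "prob (B m) \<le> (\<Sum>k\<le>i. t (m + (i - k)))" for m
  proof -
    have "prob (B m) \<le> (\<Sum>x\<in>level d m y. prob (path_open v (length y) x))"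
      unfolding B_def using path_open_events by (intro finite_measure_subadditive_finite) auto
    also have "\<dots> = (\<Sum>x\<in>level d m y. \<Sum>k\<le>i. U k * S (i + m - k))"
    proof (intro sum.cong refl)
      fix x assume x: "x \<in> level d m y"
      show "prob (path_open v (length y) x) = (\<Sum>k\<le>i. U k * S (i + m - k))"
        unfolding i
      proof (rule prob_path_open_tail)
        show "v \<noteq> []" by (simp add: v_def)
        show "x \<in> below d v" using x vy by (auto simp: level_def below_def intro: suffix_order.trans)
        show "length x = length v + (i + m)" using x i by (auto simp: level_def)
      qed simp
    qed
    also have "\<dots> = (\<Sum>k\<le>i. (real d - 1) ^ m * (U k * S (i + m - k)))"
      using card_level[OF y, of m] d_ge3 by (simp add: sum_distrib_left of_nat_diff)
    also have "\<dots> \<le> (\<Sum>k\<le>i. t (m + (i - k)))"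
    proof (rule sum_mono)
      fix k assume "k \<in> {..i}"
      have "U k \<le> 1" using decseqD[OF U_decseq, of 0 k] U_0 by simp
      then have le: "U k * S (i + m - k) \<le> 1 * S (i + m - k)" by (intro mult_right_mono S_nonneg)
      have pw: "(real d - 1) ^ m \<le> (real d - 1) ^ (m + (i - k))"
        using d_ge3 by (intro power_increasing) auto
      have "(real d - 1) ^ m * (U k * S (i + m - k)) \<le> (real d - 1) ^ (m + (i - k)) * (1 * S (i + m - k))"
        by (rule mult_mono[OF pw le]) (use U_nonneg S_nonneg d_ge3 in auto)
      also have "\<dots> = t (m + (i - k))"
        using \<open>k \<in> {..i}\<close> by (simp add: t_def add.commute)
      finally show "(real d - 1) ^ m * (U k * S (i + m - k)) \<le> t (m + (i - k))" .
    qed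
    finally show ?thesis .
  qed
  have "summable (\<lambda>m. \<Sum>k\<le>i. t (m + (i - k)))"
    by (intro summable_sum summable_ignore_initial_segment t)
  then have "summable (\<lambda>m. prob (B m))"
    by (rule summable_comparison_test'[of _ 0]) (use pB in auto)
  then have "AE \<omega> in MM. eventually (\<lambda>m. \<omega> \<in> space MM - B m) sequentially"
    using B by (intro borel_cantelli_AE1) (auto simp: emeasure_eq_measure)
  then show ?thesis
  proof eventually_elim
    fix \<omega> assume "eventually (\<lambda>m. \<omega> \<in> space MM - B m) sequentially"
    then obtain M where M: "\<And>m. m \<ge> M \<Longrightarrow> \<omega> \<notin> B m" by (auto simp: eventually_sequentially)
    have "branch_cluster \<omega> y \<subseteq> (\<Union>m<M. level d m y)"
    proof
      fix x assume x: "x \<in> branch_cluster \<omega> y"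
      define m where "m = length x - length y"
      have xl: "x \<in> level d m y"
        using x by (auto simp: branch_cluster_def level_def m_def below_def dest: suffix_length_le)
      then have "\<omega> \<in> B m" using x by (auto simp: B_def branch_cluster_def v_def)
      then have "m < M" using M by (meson not_less)
      with xl show "x \<in> (\<Union>m<M. level d m y)" by blast
    qed
    then show "finite (branch_cluster \<omega> y)" by (rule finite_subset) auto
  qed
qed

text \<open>Almost surely finitely many open loops pass through the root, so they visit a finite set
  of vertices, and each of these carries a finite branch cluster.\<close>

lemma theta_zero:
  assumes t: "summable t" and root: "loop_mass d w (tree_verts d) [] < \<infinity>"
  shows "\<theta> d \<alpha> \<kappa> = 0"
proof -
  have fin: "(\<integral>\<^sup>+\<gamma>. ennreal (loop_rate d \<alpha> \<kappa> \<gamma>) \<partial>count_space root_loops) < \<infinity>"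
  proof -
    have "root_loops = {\<gamma> \<in> loops d. loop_verts \<gamma> \<subseteq> tree_verts d \<and> [] \<in> loop_verts \<gamma>}"
      using loop_verts_subset by (auto simp: root_loops_def)
    then have "(\<integral>\<^sup>+\<gamma>. ennreal (loop_rate d \<alpha> \<kappa> \<gamma>) \<partial>count_space root_loops) = ennreal \<alpha> * loop_mass d w (tree_verts d) []"
      using nn_integral_loop_measure[OF kappa_gt, of d "\<lambda>V. V \<subseteq> tree_verts d \<and> [] \<in> V"] d_ge3 alpha_nonneg
      unfolding loop_rate_def loop_mass_eq_weight_mass by (simp add: ennreal_mult nn_integral_cmult)
    then show ?thesis using root by (simp add: ennreal_mult_less_top)
  qed
  have "AE \<omega> in MM. finite {\<gamma> \<in> root_loops. \<omega> \<in> open_ev d \<alpha> \<kappa> \<gamma>}"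
    by (rule AE_finite_hits[OF _ fin]) (auto simp: root_loops_def)
  moreover have "AE \<omega> in MM. \<forall>y\<in>tree_verts d - {[]}. finite (branch_cluster \<omega> y)"
    by (subst AE_ball_countable) (auto intro: AE_finite_branch_cluster[OF t])
  ultimately have "AE \<omega> in MM. \<omega> \<notin> {\<omega> \<in> space MM. infinite (cluster d \<omega> [])}"
    using AE_space
  proof eventually_elim
    fix \<omega> assume 1: "finite {\<gamma> \<in> root_loops. \<omega> \<in> open_ev d \<alpha> \<kappa> \<gamma>}"
      and 2: "\<forall>y\<in>tree_verts d - {[]}. finite (branch_cluster \<omega> y)" and w: "\<omega> \<in> space MM"
    define W where "W = \<Union>(loop_verts ` {\<gamma> \<in> root_loops. \<omega> \<in> open_ev d \<alpha> \<kappa> \<gamma>})"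
    have "finite (loop_verts \<gamma>)" if "\<gamma> \<in> loops d" for \<gamma> using that by (auto elim: loopsE)
    then have W: "finite W" unfolding W_def using 1 by (auto simp: root_loops_def)
    have "W \<subseteq> tree_verts d" unfolding W_def using loop_verts_subset by (auto simp: root_loops_def)
    then have "finite ({[]} \<union> W \<union> (\<Union>y\<in>W - {[]}. branch_cluster \<omega> y))" using W 2 by auto
    then have "finite (cluster d \<omega> [])"
      using cluster_subset[OF w] unfolding W_def by (rule finite_subset[rotated])
    then show "\<omega> \<notin> {\<omega> \<in> space MM. infinite (cluster d \<omega> [])}" by simp
  qed
  then show ?thesis unfolding theta_eq
    using prob_eq_0[OF infinite_cluster_measurable] by simp
qed

end

section \<open>The critical value as the root of a series\<close>

text \<open>For y = \<rho>^(k+1) this is the relative excess of the closing probability at depth k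
  over its limit as k grows, see \<open>closed_prob_eq\<close>.\<close>

definition excess :: "real \<Rightarrow> real \<Rightarrow> real" where
  "excess \<alpha> y = (1 - y) powr (- \<alpha>) - 1"

definition crit_series :: "real \<Rightarrow> real \<Rightarrow> real \<Rightarrow> real" where
  "crit_series b \<alpha> \<rho> = (b - 1) * (\<Sum>k. b ^ k * excess \<alpha> (\<rho> ^ Suc k))"

lemma excess_nonneg: "0 \<le> y \<Longrightarrow> y < 1 \<Longrightarrow> \<alpha> \<ge> 0 \<Longrightarrow> excess \<alpha> y \<ge> 0"
  unfolding excess_def using ge_one_powr_ge_zero[of "1 / (1 - y)" \<alpha>]
  by (simp add: powr_minus_divide powr_divide)

text \<open>The slope in \<open>y\<close> is \<alpha> (1 - y)^(-\<alpha> - 1), at least \<alpha>.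
  The increment is bounded through ln x \<le> x - 1 and exp x \<ge> 1 + x.\<close>

lemma excess_diff_ge:
  assumes "0 \<le> y'" "y' \<le> y" "y < 1" "\<alpha> \<ge> 0"
  shows "excess \<alpha> y - excess \<alpha> y' \<ge> \<alpha> * (y - y')"
proof -
  define q where "q = (1 - y') / (1 - y)"
  have q: "q \<ge> 1" using assms by (simp add: q_def)
  have "(1 - y) / (1 - y') = 1 - (y - y') / (1 - y')" using assms by (simp add: field_simps)
  moreover have "ln ((1 - y) / (1 - y')) \<le> (1 - y) / (1 - y') - 1"
    using assms by (intro ln_le_minus_one) auto
  moreover have "ln ((1 - y) / (1 - y')) = - ln q" using assms by (simp add: q_def ln_div)
  ultimately have "ln q \<ge> (y - y') / (1 - y')" by simp
  moreover have "(y - y') / (1 - y') \<ge> (y - y') / 1" using assms by (intro divide_left_mono) auto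
  ultimately have lnq: "ln q \<ge> y - y'" by simp
  have "q powr \<alpha> = exp (\<alpha> * ln q)" using q by (simp add: powr_def)
  also have "\<dots> \<ge> 1 + \<alpha> * ln q" by (rule exp_ge_add_one_self)
  finally have qa: "q powr \<alpha> - 1 \<ge> \<alpha> * (y - y')"
    using mult_left_mono[OF lnq assms(4)] by linarith
  have "(1 - y) powr (- \<alpha>) = (1 - y') powr (- \<alpha>) * q powr \<alpha>"
    using assms by (simp add: q_def powr_divide powr_minus_divide)
  then have "excess \<alpha> y - excess \<alpha> y' = (1 - y') powr (- \<alpha>) * (q powr \<alpha> - 1)"
    by (simp add: excess_def algebra_simps)
  also have "\<dots> \<ge> 1 * (\<alpha> * (y - y'))"
    using excess_nonneg[of y' \<alpha>] assms qa by (intro mult_mono) (auto simp: excess_def)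
  finally show ?thesis by simp
qed

lemma excess_le:
  assumes "0 \<le> y" "y \<le> 1 / 2" "0 \<le> \<alpha>"
  shows "excess \<alpha> y \<le> 2 * \<alpha> * 2 powr \<alpha> * y"
proof -
  define u where "u = - \<alpha> * ln (1 - y)"
  have "ln (1 / (1 - y)) \<le> 1 / (1 - y) - 1" using assms by (intro ln_le_minus_one) auto
  also have "\<dots> = y / (1 - y)" using assms by (simp add: field_simps)
  also have "\<dots> \<le> y / (1 / 2)" using assms by (intro divide_left_mono) auto
  finally have l: "- ln (1 - y) \<le> 2 * y" using assms by (simp add: ln_div)
  have u: "u \<le> 2 * \<alpha> * y"
    unfolding u_def using mult_left_mono[OF l assms(3)] by simp
  have u0: "u \<ge> 0" unfolding u_def using assms by (simp add: mult_nonneg_nonpos)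
  have eu: "(1 - y) powr (- \<alpha>) = exp u" using assms by (simp add: powr_def u_def)
  have "exp u \<le> 2 powr \<alpha>"
  proof -
    have "(1 - y) powr (- \<alpha>) = (1 / (1 - y)) powr \<alpha>" using assms by (simp add: powr_minus_divide powr_divide)
    also have "\<dots> \<le> 2 powr \<alpha>" using assms by (intro powr_mono2) (auto simp: field_simps)
    finally show ?thesis by (simp add: eu)
  qed
  have "1 - u \<le> exp (- u)" using exp_ge_add_one_self[of "- u"] by simp
  then have "exp u * (1 - u) \<le> exp u * exp (- u)" by (intro mult_left_mono) auto
  also have "exp u * exp (- u) = 1" by (simp flip: exp_add)
  finally have "exp u * (1 - u) \<le> 1" .
  then have "exp u - 1 \<le> u * exp u" by (simp add: algebra_simps)
  also have "\<dots> \<le> (2 * \<alpha> * y) * 2 powr \<alpha>" using u u0 \<open>exp u \<le> 2 powr \<alpha>\<close> by (intro mult_mono) auto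
  finally show ?thesis by (simp add: excess_def eu mult_ac)
qed

locale crit_rho =
  fixes b \<rho> :: real
  assumes b_ge: "b \<ge> 2" and rho: "0 < \<rho>" "b * \<rho> < 1"
begin

lemma rho_half: "\<rho> < 1 / 2"
proof -
  have "2 * \<rho> \<le> b * \<rho>" using b_ge rho by (intro mult_right_mono) auto
  then show ?thesis using rho by linarith
qed

lemma rho_Suc: "0 < \<rho> ^ Suc k" "\<rho> ^ Suc k \<le> 1 / 2" "\<rho> ^ Suc k < 1"
proof -
  show "0 < \<rho> ^ Suc k" using rho by simp
  have "\<rho> ^ Suc k \<le> \<rho> ^ 1" using rho rho_half by (intro power_decreasing) auto
  then show "\<rho> ^ Suc k \<le> 1 / 2" "\<rho> ^ Suc k < 1" using rho_half by auto
qed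

lemma excess_term_le:
  assumes "\<alpha> \<ge> 0"
  shows "b ^ k * excess \<alpha> (\<rho> ^ Suc k) \<le> 2 * \<alpha> * 2 powr \<alpha> * \<rho> * (b * \<rho>) ^ k"
proof -
  have "b ^ k * excess \<alpha> (\<rho> ^ Suc k) \<le> b ^ k * (2 * \<alpha> * 2 powr \<alpha> * \<rho> ^ Suc k)"
    using b_ge rho_Suc[of k] assms by (intro mult_left_mono excess_le) auto
  then show ?thesis by (simp add: power_mult_distrib mult_ac)
qed

lemma summable_excess:
  assumes "\<alpha> \<ge> 0"
  shows "summable (\<lambda>k. b ^ k * excess \<alpha> (\<rho> ^ Suc k))"
proof (rule summable_comparison_test'[of "\<lambda>k. 2 * \<alpha> * 2 powr \<alpha> * \<rho> * (b * \<rho>) ^ k" 0])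
  show "summable (\<lambda>k. 2 * \<alpha> * 2 powr \<alpha> * \<rho> * (b * \<rho>) ^ k)"
    using rho b_ge by (intro summable_mult summable_geometric) auto
  show "norm (b ^ k * excess \<alpha> (\<rho> ^ Suc k)) \<le> 2 * \<alpha> * 2 powr \<alpha> * \<rho> * (b * \<rho>) ^ k" for k
  proof -
    have "excess \<alpha> (\<rho> ^ Suc k) \<ge> 0" using rho_Suc[of k] assms by (intro excess_nonneg) auto
    then have "b ^ k * excess \<alpha> (\<rho> ^ Suc k) \<ge> 0" using b_ge by simp
    then show ?thesis using excess_term_le[OF assms, of k] by simp
  qed
qed

end

section \<open>The soup at weight \<open>step_weight d \<rho>\<close>\<close>

definition closed_prob :: "real \<Rightarrow> real \<Rightarrow> nat \<Rightarrow> real" where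
  "closed_prob \<alpha> \<rho> n = ((1 - \<rho>) / (1 - \<rho> ^ Suc n)) powr \<alpha>"

locale soup_rho = loop_percolation d \<alpha> \<kappa> + rho_tree d \<rho> for d \<alpha> \<kappa> \<rho> +
  assumes weight: "1 / ((1 + \<kappa>) * real d) = step_weight d \<rho>"

sublocale soup_rho \<subseteq> loop_renewal d \<alpha> \<kappa> "closed_prob \<alpha> \<rho>"
proof
  fix v s :: "nat list" and n :: nat
  assume a: "v \<noteq> []" "s \<in> below d v" "length s = length v + Suc n"
  have q: "1 - \<rho> > 0" "1 - \<rho> ^ (n + 2) > 0" using rho_lt1 rho_power_lt1[of "n + 2"] by auto
  have "\<rho> ^ (n + 2) \<le> \<rho> ^ 1" using rho_pos rho_lt1 by (intro power_decreasing) auto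
  then have "(1 - \<rho> ^ (n + 2)) / (1 - \<rho>) \<ge> 1" using q by (simp add: field_simps)
  then have l: "ln ((1 - \<rho> ^ (n + 2)) / (1 - \<rho>)) \<ge> 0" by simp
  have "prob (space MM - edge_open v s) = exp (- (\<alpha> * ln ((1 - \<rho> ^ (n + 2)) / (1 - \<rho>))))"
    using prob_closed[of v s] l unfolding weight cross_mass_eq[OF a] by simp
  also have "\<dots> = closed_prob \<alpha> \<rho> (Suc n)"
    using q by (simp add: closed_prob_def powr_def ln_div algebra_simps)
  finally show "prob (space MM - edge_open v s) = closed_prob \<alpha> \<rho> (Suc n)" .
next
  show "closed_prob \<alpha> \<rho> 0 = 1" using rho_lt1 by (simp add: closed_prob_def)
  show "decseq (closed_prob \<alpha> \<rho>)"
    unfolding decseq_Suc_iff closed_prob_def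
  proof
    fix n
    have q: "1 - \<rho> ^ Suc n > 0" "1 - \<rho> ^ Suc (Suc n) > 0"
      using rho_power_lt1[of "Suc n"] rho_power_lt1[of "Suc (Suc n)"] by auto
    have "\<rho> ^ Suc (Suc n) \<le> \<rho> ^ Suc n" using rho_pos rho_lt1 by (intro power_decreasing) auto
    then have "(1 - \<rho>) / (1 - \<rho> ^ Suc (Suc n)) \<le> (1 - \<rho>) / (1 - \<rho> ^ Suc n)"
      using q rho_lt1 by (intro divide_left_mono mult_pos_pos) auto
    then show "((1 - \<rho>) / (1 - \<rho> ^ Suc (Suc n))) powr \<alpha> \<le> ((1 - \<rho>) / (1 - \<rho> ^ Suc n)) powr \<alpha>"
      using q rho_lt1 alpha_nonneg by (intro powr_mono2) auto
  qed
  show "closed_prob \<alpha> \<rho> n \<ge> 0" for n by (simp add: closed_prob_def)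
qed

context soup_rho
begin

lemma closed_prob_eq: "closed_prob \<alpha> \<rho> k = (1 - \<rho>) powr \<alpha> * (1 + excess \<alpha> (\<rho> ^ Suc k))"
  using rho_lt1 rho_power_lt1[of "Suc k"]
  by (simp add: closed_prob_def excess_def powr_divide powr_minus_divide)

lemma A_eq: "A k = (1 - \<rho>) powr \<alpha> * ((excess \<alpha> (\<rho> ^ Suc k) - excess \<alpha> (\<rho> ^ Suc (Suc k))) * (real d - 1) ^ Suc k)"
  unfolding A_def closed_prob_eq by (simp add: algebra_simps)

lemma excess_0_pos: "(1 - \<rho>) powr \<alpha> * (1 + excess \<alpha> \<rho>) = 1"
  using rho_lt1 by (simp add: excess_def flip: powr_add)

text \<open>Summation by parts: differences of successive powers of d - 1 produce the factor d - 2.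
  The last summand is the boundary term, which tends to 0 when (d - 1) \<rho> < 1.\<close>

lemma sum_A:
  "(\<Sum>k<K. A k) = (1 - \<rho>) powr \<alpha> * (excess \<alpha> \<rho> + (real d - 2) * (\<Sum>k<K. (real d - 1) ^ k * excess \<alpha> (\<rho> ^ Suc k))
      - (real d - 1) ^ K * excess \<alpha> (\<rho> ^ Suc K))"
proof (induction K)
  case (Suc K)
  have "q * (E + (r - 2) * S - P * x) + q * ((x - y) * ((r - 1) * P)) = q * (E + (r - 2) * (S + P * x) - (r - 1) * P * y)"
    for q E r S P x y :: real
    by (simp add: algebra_simps)
  then show ?case unfolding sum.lessThan_Suc Suc.IH unfolding A_eq power_Suc[of "real d - 1"] .
qed simp

text \<open>By \<open>excess_0_pos\<close> the total of the weights \<open>A\<close> is 1 + (1 -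
  \<rho>)^\<alpha> (\<Phi> - 1), so it lies on the same side of 1 as the series \<Phi>.\<close>

lemma theta_crit_series:
  assumes lt: "(real d - 1) * \<rho> < 1"
  shows "crit_series (real d - 1) \<alpha> \<rho> < 1 \<Longrightarrow> \<theta> d \<alpha> \<kappa> = 0"
    and "crit_series (real d - 1) \<alpha> \<rho> > 1 \<Longrightarrow> \<theta> d \<alpha> \<kappa> > 0"
proof -
  interpret crit_rho "real d - 1" \<rho> using d_ge rho_pos lt by unfold_locales auto
  let ?b = "real d - 1"
  define \<Phi> where "\<Phi> = crit_series ?b \<alpha> \<rho>"
  note s = summable_excess[OF alpha_nonneg]
  have "(\<lambda>K. \<Sum>k<K. A k) \<longlonglongrightarrow> (1 - \<rho>) powr \<alpha> * (excess \<alpha> \<rho> + (real d - 2) * (\<Sum>k. ?b ^ k * excess \<alpha> (\<rho> ^ Suc k)) - 0)"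
    unfolding sum_A by (intro tendsto_intros summable_LIMSEQ[OF s] summable_LIMSEQ_zero[OF s])
  then have lim: "(\<lambda>K. \<Sum>k<K. A k) \<longlonglongrightarrow> (1 - \<rho>) powr \<alpha> * (excess \<alpha> \<rho> + \<Phi>)"
    by (simp add: \<Phi>_def crit_series_def)
  have q: "(1 - \<rho>) powr \<alpha> > 0" using rho_lt1 by simp
  have eq: "(1 - \<rho>) powr \<alpha> * (excess \<alpha> \<rho> + \<Phi>) = 1 + (1 - \<rho>) powr \<alpha> * (\<Phi> - 1)"
    using excess_0_pos by (simp add: algebra_simps)
  have inc: "incseq (\<lambda>K. \<Sum>k<K. A k)" using A_nonneg by (intro incseq_SucI) auto
  show "\<theta> d \<alpha> \<kappa> = 0" if "crit_series ?b \<alpha> \<rho> < 1"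
  proof (rule theta_zero)
    have "(1 - \<rho>) powr \<alpha> * (\<Phi> - 1) < 0" using that q by (simp add: \<Phi>_def mult_pos_neg)
    then show "summable t"
      using incseq_le[OF inc lim] unfolding eq by (intro summable_t) auto
    show "loop_mass d w (tree_verts d) [] < \<infinity>" unfolding weight by (rule loop_mass_root_finite)
  qed
  show "\<theta> d \<alpha> \<kappa> > 0" if "crit_series ?b \<alpha> \<rho> > 1"
  proof -
    have "\<alpha> \<noteq> 0"
    proof
      assume "\<alpha> = 0"
      then have "excess \<alpha> (\<rho> ^ Suc k) = 0" for k using rho_Suc[of k] by (simp add: excess_def)
      then show False using that by (simp add: crit_series_def)
    qed
    have "(1 - \<rho>) powr \<alpha> * (\<Phi> - 1) > 0" using that q by (simp add: \<Phi>_def)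
    then have "eventually (\<lambda>K. (\<Sum>k<K. A k) > 1) sequentially"
      using lim unfolding eq by (intro order_tendstoD(1)) auto
    then obtain K where "(\<Sum>k<K. A k) > 1" by (auto simp: eventually_sequentially)
    from ex_t_gt_1[OF this] obtain N where "t N > 1" by blast
    then show ?thesis using \<open>\<alpha> \<noteq> 0\<close> alpha_nonneg by (intro theta_pos) auto
  qed
qed

text \<open>For (d - 1) \<rho> = 1 the decay of the decrements of \<open>closed_prob\<close> just
  balances the growth of the tree: the weights \<open>A k\<close> stay above a positive constant and
  their sum diverges.\<close>

lemma theta_pos_critical:
  assumes eq: "(real d - 1) * \<rho> = 1" and a: "\<alpha> > 0"
  shows "\<theta> d \<alpha> \<kappa> > 0"
proof -
  define c where "c = (1 - \<rho>) powr \<alpha> * (\<alpha> * (1 - \<rho>))"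
  have c: "c > 0" using a rho_lt1 by (simp add: c_def)
  have Ac: "A k \<ge> c" for k
  proof -
    have "\<rho> ^ Suc (Suc k) \<le> \<rho> ^ Suc k" using rho_pos rho_lt1 by (intro power_decreasing) auto
    then have "\<alpha> * (\<rho> ^ Suc k - \<rho> ^ Suc (Suc k)) \<le> excess \<alpha> (\<rho> ^ Suc k) - excess \<alpha> (\<rho> ^ Suc (Suc k))"
      using rho_power_lt1[of "Suc k"] rho_pos a by (intro excess_diff_ge) auto
    then have "\<alpha> * (\<rho> ^ Suc k - \<rho> ^ Suc (Suc k)) * (real d - 1) ^ Suc k \<le>
       (excess \<alpha> (\<rho> ^ Suc k) - excess \<alpha> (\<rho> ^ Suc (Suc k))) * (real d - 1) ^ Suc k"
      using d_ge by (intro mult_right_mono) auto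
    also have "\<alpha> * (\<rho> ^ Suc k - \<rho> ^ Suc (Suc k)) * (real d - 1) ^ Suc k = \<alpha> * (1 - \<rho>) * ((real d - 1) * \<rho>) ^ Suc k"
    proof -
      have "\<alpha> * (P - \<rho> * P) * Q = \<alpha> * (1 - \<rho>) * (Q * P)" for P Q :: real by (simp add: algebra_simps)
      then show ?thesis unfolding power_mult_distrib power_Suc[of \<rho> "Suc k"] .
    qed
    finally have "\<alpha> * (1 - \<rho>) \<le> (excess \<alpha> (\<rho> ^ Suc k) - excess \<alpha> (\<rho> ^ Suc (Suc k))) * (real d - 1) ^ Suc k"
      unfolding eq by simp
    then show ?thesis unfolding A_eq c_def by (intro mult_left_mono) auto
  qed
  obtain K :: nat where "1 < real K * c" using c reals_Archimedean3 by blast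
  also have "\<dots> \<le> (\<Sum>k<K. A k)" using sum_mono[of "{..<K}" "\<lambda>_. c" A] Ac by simp
  finally obtain N where "t N > 1" using ex_t_gt_1 by blast
  then show ?thesis using a by (intro theta_pos) auto
qed

end

text \<open>Every edge below a non-root vertex is almost surely open, so the renewal framework
  applies with U = 0 at positive arguments, and t(1) = d - 1 > 1.\<close>

lemma theta_pos_infinite_mass:
  assumes d: "d \<ge> 3" and a: "\<alpha> > 0" and k: "\<kappa> > -1"
    and z: "4 * (real d - 1) * (1 / ((1 + \<kappa>) * real d))\<^sup>2 > 1"
  shows "\<theta> d \<alpha> \<kappa> > 0"
proof -
  interpret loop_percolation d \<alpha> \<kappa> using assms by unfold_locales auto
  define U :: "nat \<Rightarrow> real" where "U n = (if n = 0 then 1 else 0)" for n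
  interpret loop_renewal d \<alpha> \<kappa> U
  proof
    fix v s :: "nat list" and n :: nat
    assume v: "v \<noteq> []" and s: "s \<in> below d v" "length s = length v + Suc n"
    have sv: "s \<noteq> v" using s by auto
    note b = below_cases[OF s(1) sv]
    have sc: "s \<in> children d (tl s)"
      using b s(1) by (cases s) (auto simp: children_def tree_adj_def below_def)
    have t0: "tl s \<noteq> []"
    proof
      assume "tl s = []"
      with b(3) v show False by (simp del: length_tl)
    qed
    \<comment> \<open>The loops below the parent of \<open>s\<close> suffice; a larger subtree only
      adds loops.\<close>
    have "cross_mass d w (tl s) s = \<infinity>"
      using z k d b(2) t0 sc by (intro cross_mass_infinite) (auto simp: below_def)
    then have "prob (space MM - edge_open (tl s) s) = 0"
      using prob_closed[of "tl s" s] a by simp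
    moreover have "suffix v (tl s)" using b(2) by (simp add: below_def)
    then have "prob (space MM - edge_open v s) \<le> prob (space MM - edge_open (tl s) s)"
      using edge_open_events edge_open_mono[of v "tl s" s] by (intro finite_measure_mono) auto
    ultimately show "prob (space MM - edge_open v s) = U (Suc n)"
      by (simp add: U_def measure_le_0_iff)
  qed (auto simp: U_def decseq_Suc_iff)
  have "S 1 = 1" by (subst renewal.simps) (simp add: U_def)
  then have "t 1 = real d - 1" by (simp add: t_def)
  then have "t 1 > 1" using d by simp
  then show ?thesis using a by (rule theta_pos[rotated])
qed

lemma alpha_c_eq_0:
  assumes "\<And>\<alpha>. \<alpha> > 0 \<Longrightarrow> \<theta> d \<alpha> \<kappa> > 0"
  shows "alpha_c d \<kappa> = 0"
proof -
  let ?S = "{\<alpha>. \<alpha> \<ge> 0 \<and> \<theta> d \<alpha> \<kappa> > 0}"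
  have "1 \<in> ?S" using assms[of 1] by simp
  then have "?S \<noteq> {}" by blast
  then have "alpha_c d \<kappa> \<ge> 0" unfolding alpha_c_def by (intro cInf_greatest) auto
  moreover have "alpha_c d \<kappa> \<le> e" if "e > 0" for e
    unfolding alpha_c_def using assms[OF that] that by (intro cInf_lower bdd_belowI[of _ 0]) auto
  ultimately show ?thesis by (metis dense_ge order_antisym)
qed

lemma alpha_c_eqI:
  assumes "a \<ge> 0" "\<And>\<alpha>. \<alpha> > a \<Longrightarrow> \<theta> d \<alpha> \<kappa> > 0" "\<And>\<alpha>. 0 \<le> \<alpha> \<Longrightarrow> \<alpha> < a \<Longrightarrow> \<theta> d \<alpha> \<kappa> = 0"
  shows "alpha_c d \<kappa> = a"
proof -
  let ?S = "{\<alpha>. \<alpha> \<ge> 0 \<and> \<theta> d \<alpha> \<kappa> > 0}"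
  have "?S \<noteq> {}" using assms(1) assms(2)[of "a + 1"] by (force intro!: exI[of _ "a + 1"])
  moreover have "a \<le> \<alpha>" if "\<alpha> \<in> ?S" for \<alpha> using that assms(3)[of \<alpha>] by force
  ultimately have "alpha_c d \<kappa> \<ge> a" unfolding alpha_c_def by (intro cInf_greatest) auto
  moreover have "alpha_c d \<kappa> \<le> e" if "e > a" for e
    unfolding alpha_c_def using assms(1) assms(2)[OF that] that by (intro cInf_lower bdd_belowI[of _ 0]) auto
  ultimately show ?thesis by (metis dense_ge order_antisym)
qed

section \<open>The root of the series as a function of the parameter\<close>

lemma powr_le_affine:
  fixes x :: real
  assumes "x > 0" "0 \<le> a" "a \<le> 1"
  shows "x powr a \<le> 1 + a * (x - 1)"
proof -
  have c: "convex_on UNIV exp" by (rule exp_convex)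
  have "exp ((1 - a) *\<^sub>R 0 + a *\<^sub>R ln x) \<le> (1 - a) * exp 0 + a * exp (ln x)"
    using assms by (intro convex_onD[OF c]) auto
  then show ?thesis using assms by (simp add: powr_def algebra_simps)
qed

text \<open>Sharper than \<open>excess_le\<close>: the linear coefficient is exactly \<alpha>,
  matching the lower bound from \<open>excess_diff_ge\<close>, as the expansion near the critical
  parameter requires.\<close>

lemma excess_le_small:
  assumes "0 \<le> y" "y \<le> 1 / 2" "0 \<le> \<alpha>" "\<alpha> \<le> 1"
  shows "excess \<alpha> y \<le> \<alpha> * y + 2 * \<alpha> * y\<^sup>2"
proof -
  have "(1 - y) powr (- \<alpha>) = (1 / (1 - y)) powr \<alpha>" using assms by (simp add: powr_minus_divide powr_divide)
  also have "\<dots> \<le> 1 + \<alpha> * (1 / (1 - y) - 1)" using assms by (intro powr_le_affine) auto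
  also have "1 / (1 - y) - 1 = y + y\<^sup>2 / (1 - y)" using assms by (simp add: field_simps power2_eq_square)
  also have "y\<^sup>2 / (1 - y) \<le> y\<^sup>2 / (1 / 2)" using assms by (intro divide_left_mono) auto
  finally have "(1 - y) powr (- \<alpha>) \<le> 1 + \<alpha> * (y + y\<^sup>2 / (1 / 2))" using assms by (simp add: mult_left_mono)
  then show ?thesis by (simp add: excess_def algebra_simps)
qed

lemma minus_ln_one_minus_bounds:
  fixes y :: real
  assumes "0 \<le> y" "y < 1"
  shows "y \<le> - ln (1 - y)" "- ln (1 - y) \<le> y / (1 - y)"
proof -
  show "y \<le> - ln (1 - y)" using ln_le_minus_one[of "1 - y"] assms by simp
  have "ln (1 / (1 - y)) \<le> 1 / (1 - y) - 1" using assms by (intro ln_le_minus_one) auto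
  also have "\<dots> = y / (1 - y)" using assms by (simp add: field_simps)
  finally show "- ln (1 - y) \<le> y / (1 - y)" using assms by (simp add: ln_div)
qed

definition crit_deriv :: "real \<Rightarrow> real \<Rightarrow> real \<Rightarrow> real" where
  "crit_deriv b \<alpha> \<rho> = (b - 1) * (\<Sum>k. b ^ k * (- ln (1 - \<rho> ^ Suc k) * (1 - \<rho> ^ Suc k) powr (- \<alpha>)))"

text \<open>The majorant is uniform over a rectangle in (\<alpha>, \<rho>), so that the M-test gives
  joint continuity and not only differentiability in \<alpha>.\<close>

lemma crit_deriv_term_le:
  assumes "b \<ge> 2" "0 \<le> \<rho>" "\<rho> \<le> r" "r \<le> 1 / 2" "0 \<le> \<alpha>" "\<alpha> \<le> R"
  shows "norm (b ^ k * (- ln (1 - \<rho> ^ Suc k) * (1 - \<rho> ^ Suc k) powr (- \<alpha>))) \<le> 2 * 2 powr R * r * (b * r) ^ k"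
proof -
  define y where "y = \<rho> ^ Suc k"
  have "\<rho> ^ Suc k \<le> r ^ Suc k" using assms by (intro power_mono) auto
  then have yr: "y \<le> r ^ Suc k" by (simp add: y_def)
  have "r ^ Suc k \<le> r ^ 1" using assms by (intro power_decreasing) auto
  then have y: "0 \<le> y" "y \<le> 1 / 2" using yr assms by (auto simp: y_def)
  have l: "0 \<le> - ln (1 - y)" "- ln (1 - y) \<le> 2 * r ^ Suc k"
  proof -
    show "0 \<le> - ln (1 - y)" using minus_ln_one_minus_bounds(1)[of y] y by linarith
    have "- ln (1 - y) \<le> y / (1 - y)" using minus_ln_one_minus_bounds(2)[of y] y by simp
    also have "\<dots> \<le> y / (1 / 2)" using y by (intro divide_left_mono) auto
    finally show "- ln (1 - y) \<le> 2 * r ^ Suc k" using yr by simp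
  qed
  have "(1 - y) powr (- \<alpha>) = (1 / (1 - y)) powr \<alpha>" using y by (simp add: powr_minus_divide powr_divide)
  also have "\<dots> \<le> 2 powr \<alpha>" using y assms by (intro powr_mono2) (auto simp: field_simps)
  also have "\<dots> \<le> 2 powr R" using assms by (intro powr_mono) auto
  finally have p: "(1 - y) powr (- \<alpha>) \<le> 2 powr R" .
  have "norm (b ^ k * (- ln (1 - y) * (1 - y) powr (- \<alpha>))) = b ^ k * (- ln (1 - y) * (1 - y) powr (- \<alpha>))"
    using assms l by (simp add: abs_mult)
  also have "\<dots> \<le> b ^ k * ((2 * r ^ Suc k) * 2 powr R)"
    using assms l p by (intro mult_left_mono mult_mono) auto
  also have "\<dots> = 2 * 2 powr R * r * (b * r) ^ k" by (simp add: power_mult_distrib)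
  finally show ?thesis by (simp add: y_def)
qed

lemma has_derivative_crit_series_alpha:
  assumes "b \<ge> 2" "0 < \<rho>" "b * \<rho> < 1" "\<alpha> > 0"
  shows "((\<lambda>a. crit_series b a \<rho>) has_real_derivative crit_deriv b \<alpha> \<rho>) (at \<alpha>)"
proof -
  interpret crit_rho b \<rho> by unfold_locales fact+
  let ?f = "\<lambda>k a. b ^ k * excess a (\<rho> ^ Suc k)"
  let ?f' = "\<lambda>k a. b ^ k * (- ln (1 - \<rho> ^ Suc k) * (1 - \<rho> ^ Suc k) powr (- a))"
  let ?I = "{0..\<alpha> + 1}"
  have "((\<lambda>a. \<Sum>k. ?f k a) has_field_derivative (\<Sum>k. ?f' k \<alpha>)) (at \<alpha>)"
  proof (rule has_field_derivative_series'[of ?I])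
    show "(?f k has_field_derivative ?f' k a) (at a within ?I)" for k a
      unfolding excess_def using rho_Suc[of k]
      by (auto intro!: derivative_eq_intros simp: powr_def mult_ac)
    show "uniformly_convergent_on ?I (\<lambda>n a. \<Sum>k<n. ?f' k a)"
    proof (rule Weierstrass_m_test')
      show "norm (?f' k a) \<le> 2 * 2 powr (\<alpha> + 1) * \<rho> * (b * \<rho>) ^ k" if "a \<in> ?I" for k a
        using that assms rho_half by (intro crit_deriv_term_le) auto
      show "summable (\<lambda>k. 2 * 2 powr (\<alpha> + 1) * \<rho> * (b * \<rho>) ^ k)"
        using assms by (intro summable_mult summable_geometric) auto
    qed
    show "summable (\<lambda>k. ?f k 0)" by (rule summable_excess) simp
  qed (use assms in auto)
  from DERIV_cmult[OF this, of "b - 1"] show ?thesis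
    by (simp add: crit_series_def crit_deriv_def)
qed

lemma continuous_on_crit_deriv:
  assumes "b \<ge> 2" "b * r < 1" "R \<ge> 0" "r > 0"
  shows "continuous_on ({0..R} \<times> {0..r}) (\<lambda>(\<alpha>, \<rho>). crit_deriv b \<alpha> \<rho>)"
proof -
  interpret crit_rho b r by unfold_locales fact+
  let ?f = "\<lambda>k (\<alpha>, \<rho>). b ^ k * (- ln (1 - \<rho> ^ Suc k) * (1 - \<rho> ^ Suc k) powr (- \<alpha>))"
  let ?K = "{0..R} \<times> {0..r}"
  have "uniform_limit ?K (\<lambda>n x. \<Sum>k<n. ?f k x) (\<lambda>x. \<Sum>k. ?f k x) sequentially"
  proof (rule Weierstrass_m_test)
    show "norm (?f k x) \<le> 2 * 2 powr R * r * (b * r) ^ k" if "x \<in> ?K" for k x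
    proof (cases x)
      case (Pair \<alpha> \<rho>)
      with that assms rho_half show ?thesis
        using crit_deriv_term_le[of b \<rho> r \<alpha> R k] by auto
    qed
    show "summable (\<lambda>k. 2 * 2 powr R * r * (b * r) ^ k)"
      using assms by (intro summable_mult summable_geometric) auto
  qed
  moreover have "continuous_on ?K (?f k)" for k
  proof -
    have pos: "1 - snd x ^ Suc k > 0" if "x \<in> ?K" for x
    proof -
      have "snd x ^ Suc k \<le> r ^ Suc k" using that by (intro power_mono) auto
      then show ?thesis using rho_Suc[of k] by linarith
    qed
    have "continuous_on ?K (\<lambda>x. b ^ k * (- ln (1 - snd x ^ Suc k) * (1 - snd x ^ Suc k) powr (- fst x)))"
      using pos by (intro continuous_intros) (auto simp: less_imp_neq[THEN not_sym] dest: less_imp_le)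
    then show ?thesis by (simp add: case_prod_unfold)
  qed
  ultimately have "continuous_on ?K (\<lambda>x. \<Sum>k. ?f k x)"
    by (intro uniform_limit_theorem[of _ "\<lambda>n x. \<Sum>k<n. ?f k x" sequentially]) (auto intro!: always_eventually continuous_on_sum)
  then have "continuous_on ?K (\<lambda>x. (b - 1) * (\<Sum>k. ?f k x))" by (intro continuous_intros)
  then show ?thesis by (simp add: crit_deriv_def case_prod_unfold)
qed

lemma differentiable_crit_series_rho:
  assumes "b \<ge> 2" "0 < \<rho>" "b * \<rho> < 1" "\<alpha> \<ge> 0"
  shows "\<exists>D. ((\<lambda>r. crit_series b \<alpha> r) has_real_derivative D) (at \<rho>)"
proof -
  \<comment> \<open>The midpoint of \<rho> and 1/b: \<rho> is interior to the interval from 0 to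
    \<open>r\<close>, and b r < 1 keeps the majorant summable.\<close>
  define r where "r = (\<rho> + 1 / b) / 2"
  have "1 + \<rho> * b > 0" using assms by (simp add: add_pos_pos)
  then have r: "\<rho> < r" "b * r < 1" "r > 0"
    using assms by (auto simp: r_def field_simps)
  interpret crit_rho b r by unfold_locales (use assms r in auto)
  interpret R: crit_rho b \<rho> by unfold_locales (use assms r in auto)
  let ?f = "\<lambda>k x. b ^ k * excess \<alpha> (x ^ Suc k)"
  let ?f' = "\<lambda>k x. b ^ k * (\<alpha> * (1 - x ^ Suc k) powr (- \<alpha> - 1) * (real (Suc k) * x ^ k))"
  let ?I = "{0..r}"
  have y: "0 \<le> x ^ Suc k" "x ^ Suc k \<le> 1 / 2" "x ^ k \<le> r ^ k" if "x \<in> ?I" for x k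
  proof -
    have "x ^ Suc k \<le> r ^ Suc k" using that by (intro power_mono) auto
    then show "x ^ Suc k \<le> 1 / 2" using rho_Suc[of k] by linarith
    show "0 \<le> x ^ Suc k" "x ^ k \<le> r ^ k" using that by (auto intro!: power_mono)
  qed
  have "((\<lambda>x. \<Sum>k. ?f k x) has_field_derivative (\<Sum>k. ?f' k \<rho>)) (at \<rho>)"
  proof (rule has_field_derivative_series'[of ?I])
    show "(?f k has_field_derivative ?f' k x) (at x within ?I)" if "x \<in> ?I" for k x
    proof -
      have p: "1 - x ^ Suc k > 0" using y[OF that, of k] by linarith
      have "((\<lambda>x. x ^ Suc k) has_field_derivative (real (Suc k) * x ^ k)) (at x within ?I)"
        using DERIV_pow[of "Suc k" x ?I] by simp
      then have "((\<lambda>x. 1 - x ^ Suc k) has_field_derivative - (real (Suc k) * x ^ k)) (at x within ?I)"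
        using DERIV_diff[OF DERIV_const] by fastforce
      from DERIV_chain2[OF has_real_derivative_powr[OF p, of "- \<alpha>"] this]
      have "((\<lambda>x. (1 - x ^ Suc k) powr (- \<alpha>)) has_field_derivative
          (- \<alpha> * (1 - x ^ Suc k) powr (- \<alpha> - 1)) * (- (real (Suc k) * x ^ k))) (at x within ?I)" .
      then have "(?f k has_field_derivative b ^ k * ((- \<alpha> * (1 - x ^ Suc k) powr (- \<alpha> - 1)) * (- (real (Suc k) * x ^ k)) - 0)) (at x within ?I)"
        unfolding excess_def by (intro DERIV_cmult DERIV_diff DERIV_const)
      then show ?thesis by (simp add: mult_ac)
    qed
    show "uniformly_convergent_on ?I (\<lambda>n x. \<Sum>k<n. ?f' k x)"
    proof (rule Weierstrass_m_test')
      show "norm (?f' k x) \<le> (\<alpha> * 2 powr (\<alpha> + 1)) * (real (Suc k) * (b * r) ^ k)" if "x \<in> ?I" for k x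
      proof -
        have "(1 - x ^ Suc k) powr (- \<alpha> - 1) = (1 / (1 - x ^ Suc k)) powr (\<alpha> + 1)"
        proof -
          have "- \<alpha> - 1 = - (\<alpha> + 1)" by simp
          then show ?thesis using y[OF that, of k] by (simp only: powr_minus_divide powr_divide) simp
        qed
        also have "\<dots> \<le> 2 powr (\<alpha> + 1)"
          using y[OF that, of k] assms by (intro powr_mono2) (auto simp: field_simps)
        finally have p: "(1 - x ^ Suc k) powr (- \<alpha> - 1) \<le> 2 powr (\<alpha> + 1)" .
        have "norm (?f' k x) = ?f' k x" using assms that by (simp add: abs_mult)
        also have "\<dots> \<le> b ^ k * (\<alpha> * 2 powr (\<alpha> + 1) * (real (Suc k) * r ^ k))"
          using assms that p y[OF that, of k] by (intro mult_left_mono mult_mono) auto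
        also have "\<dots> = (\<alpha> * 2 powr (\<alpha> + 1)) * (real (Suc k) * (b * r) ^ k)"
          by (simp add: power_mult_distrib)
        finally show ?thesis .
      qed
      show "summable (\<lambda>k. (\<alpha> * 2 powr (\<alpha> + 1)) * (real (Suc k) * (b * r) ^ k))"
        using geometric_deriv_sums[of "b * r"] assms r by (intro summable_mult) (auto simp: sums_iff)
    qed
    show "summable (\<lambda>k. ?f k \<rho>)" by (rule R.summable_excess) fact
  qed (use assms r in auto)
  from DERIV_cmult[OF this, of "b - 1"] show ?thesis
    by (auto simp: crit_series_def)
qed

text \<open>Termwise: in \<alpha> each term is an exponential, in \<rho>
  \<open>excess_diff_ge\<close> applies. Strictness requires the larger exponent to be positive,
  since the series vanishes identically for \<alpha> = 0.\<close>

lemma crit_series_strict_mono: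
  assumes "b \<ge> 2" "0 < \<rho>" "\<rho> \<le> \<rho>'" "b * \<rho>' < 1" "0 \<le> \<alpha>" "\<alpha> \<le> \<alpha>'" "\<alpha>' > 0" "\<rho> < \<rho>' \<or> \<alpha> < \<alpha>'"
  shows "crit_series b \<alpha> \<rho> < crit_series b \<alpha>' \<rho>'"
proof -
  have "b * \<rho> \<le> b * \<rho>'" using assms by (intro mult_left_mono) auto
  then have "b * \<rho> < 1" using assms by linarith
  then interpret L: crit_rho b \<rho> using assms by unfold_locales auto
  interpret R: crit_rho b \<rho>' using assms by unfold_locales auto
  have le: "excess \<alpha> (\<rho> ^ Suc k) < excess \<alpha>' (\<rho>' ^ Suc k)" for k
  proof -
    have p: "\<rho> ^ Suc k \<le> \<rho>' ^ Suc k" "\<rho> < \<rho>' \<Longrightarrow> \<rho> ^ Suc k < \<rho>' ^ Suc k"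
      using assms by (auto intro!: power_mono power_strict_mono simp del: power_Suc)
    define l where "l = - ln (1 - \<rho> ^ Suc k)"
    have "l > 0" using minus_ln_one_minus_bounds(1)[of "\<rho> ^ Suc k"] L.rho_Suc[of k] unfolding l_def by linarith
    moreover have "excess a (\<rho> ^ Suc k) = exp (a * l) - 1" for a
      using L.rho_Suc[of k] by (simp add: excess_def powr_def l_def)
    ultimately have 1: "excess \<alpha> (\<rho> ^ Suc k) \<le> excess \<alpha>' (\<rho> ^ Suc k)" "\<alpha> < \<alpha>' \<Longrightarrow> excess \<alpha> (\<rho> ^ Suc k) < excess \<alpha>' (\<rho> ^ Suc k)"
      using assms by (simp_all del: power_Suc)
    have 2: "excess \<alpha>' (\<rho> ^ Suc k) + \<alpha>' * (\<rho>' ^ Suc k - \<rho> ^ Suc k) \<le> excess \<alpha>' (\<rho>' ^ Suc k)"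
      using excess_diff_ge[of "\<rho> ^ Suc k" "\<rho>' ^ Suc k" \<alpha>'] L.rho_Suc[of k] R.rho_Suc[of k] p assms by simp
    have 3: "\<alpha>' * (\<rho>' ^ Suc k - \<rho> ^ Suc k) \<ge> 0" "\<rho> < \<rho>' \<Longrightarrow> \<alpha>' * (\<rho>' ^ Suc k - \<rho> ^ Suc k) > 0"
      using p assms by auto
    show ?thesis using 1 2 3 assms(8) by linarith
  qed
  have "(\<Sum>k. b ^ k * excess \<alpha> (\<rho> ^ Suc k)) < (\<Sum>k. b ^ k * excess \<alpha>' (\<rho>' ^ Suc k))"
  proof -
    have s: "summable (\<lambda>k. b ^ k * excess \<alpha> (\<rho> ^ Suc k))" "summable (\<lambda>k. b ^ k * excess \<alpha>' (\<rho>' ^ Suc k))"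
      using assms by (auto intro!: L.summable_excess R.summable_excess simp del: power_Suc)
    have "b ^ k * excess \<alpha> (\<rho> ^ Suc k) < b ^ k * excess \<alpha>' (\<rho>' ^ Suc k)" for k
      using le[of k] assms by (intro mult_strict_left_mono) auto
    then have "0 < (\<Sum>k. b ^ k * excess \<alpha>' (\<rho>' ^ Suc k) - b ^ k * excess \<alpha> (\<rho> ^ Suc k))"
      by (intro suminf_pos summable_diff s) (simp del: power_Suc)
    then show ?thesis using suminf_diff[OF s(2,1)] by simp
  qed
  then show ?thesis using assms by (simp add: crit_series_def)
qed

section \<open>Existence, continuity and differentiability of the root\<close>

definition crit_root :: "real \<Rightarrow> real \<Rightarrow> real" where
  "crit_root b \<rho> = (THE \<alpha>. \<alpha> > 0 \<and> crit_series b \<alpha> \<rho> = 1)"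

context crit_rho
begin

abbreviation "\<Phi> \<alpha> \<equiv> crit_series b \<alpha> \<rho>"

lemma strict_mono_alpha: "0 \<le> \<alpha> \<Longrightarrow> \<alpha> < \<alpha>' \<Longrightarrow> \<Phi> \<alpha> < \<Phi> \<alpha>'"
  using b_ge rho by (intro crit_series_strict_mono) auto

lemma ln_pos: "- ln (1 - \<rho>) > 0"
  using rho rho_half by simp

lemma ln_ratio_pos: "ln (b / (b - 1)) > 0"
  using b_ge by (intro ln_gt_zero) (auto simp: field_simps)

text \<open>The term k = 0 alone; it yields the explicit upper bound for the root.\<close>

lemma crit_series_ge:
  assumes "\<alpha> \<ge> 0"
  shows "\<Phi> \<alpha> \<ge> (b - 1) * excess \<alpha> \<rho>"
proof -
  have "b ^ k * excess \<alpha> (\<rho> ^ Suc k) \<ge> 0" for k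
    using b_ge assms rho_Suc[of k] by (intro mult_nonneg_nonneg excess_nonneg) (auto simp del: power_Suc)
  then have "(\<Sum>k<1. b ^ k * excess \<alpha> (\<rho> ^ Suc k)) \<le> (\<Sum>k. b ^ k * excess \<alpha> (\<rho> ^ Suc k))"
    by (intro sum_le_suminf summable_excess assms) auto
  then show ?thesis using b_ge by (simp add: crit_series_def)
qed

lemma crit_root_exists: "\<exists>\<alpha>. \<alpha> > 0 \<and> \<Phi> \<alpha> = 1"
proof -
  \<comment> \<open>The value at which the term k = 0 alone equals 1, so the series is at least 1
    there.\<close>
  define a where "a = ln (b / (b - 1)) / (- ln (1 - \<rho>))"
  have a: "a > 0" unfolding a_def by (intro divide_pos_pos ln_pos ln_ratio_pos)
  have "(1 - \<rho>) powr (- a) = b / (b - 1)"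
    using rho_half ln_pos b_ge by (simp add: powr_def a_def)
  then have "(b - 1) * excess a \<rho> = 1" using b_ge by (simp add: excess_def field_simps)
  then have ge: "\<Phi> a \<ge> 1" using crit_series_ge[of a] a by simp
  \<comment> \<open>For \<open>e\<close> at most 1 the series is at most C e, by comparison with a
    geometric series; the choice of \<open>e\<close> makes this at most 1/2.\<close>
  define C where "C = (b - 1) * (4 * \<rho> / (1 - b * \<rho>))"
  have C: "C > 0" unfolding C_def using b_ge rho by simp
  define e where "e = min 1 (1 / (2 * C))"
  have e: "e > 0" "e \<le> 1" "e \<le> 1 / (2 * C)" using C by (auto simp: e_def)
  have "\<Phi> e \<le> (b - 1) * (\<Sum>k. 4 * e * \<rho> * (b * \<rho>) ^ k)"
    unfolding crit_series_def
  proof (intro mult_left_mono suminf_le)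
    fix k
    have "b ^ k * excess e (\<rho> ^ Suc k) \<le> 2 * e * 2 powr e * \<rho> * (b * \<rho>) ^ k"
      using e by (intro excess_term_le) auto
    also have "\<dots> \<le> 2 * e * 2 powr 1 * \<rho> * (b * \<rho>) ^ k"
      using e rho b_ge by (intro mult_right_mono mult_left_mono powr_mono) auto
    finally show "b ^ k * excess e (\<rho> ^ Suc k) \<le> 4 * e * \<rho> * (b * \<rho>) ^ k" by simp
    show "summable (\<lambda>k. 4 * e * \<rho> * (b * \<rho>) ^ k)"
      using rho b_ge by (intro summable_mult summable_geometric) auto
  qed (use e b_ge in \<open>auto intro!: summable_excess simp del: power_Suc\<close>)
  also have "(\<Sum>k. 4 * e * \<rho> * (b * \<rho>) ^ k) = 4 * e * \<rho> * (1 / (1 - b * \<rho>))"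
    using rho b_ge by (subst suminf_mult) (auto intro!: summable_geometric simp: suminf_geometric)
  also have "(b - 1) * (4 * e * \<rho> * (1 / (1 - b * \<rho>))) = C * e" by (simp add: C_def)
  also have "\<dots> \<le> C * (1 / (2 * C))" using C e by (intro mult_left_mono) auto
  also have "\<dots> = 1 / 2" using C by simp
  finally have le: "\<Phi> e \<le> 1" by simp
  have "e \<le> a"
  proof (rule ccontr)
    assume "\<not> e \<le> a"
    then have "\<Phi> a < \<Phi> e" using a by (intro strict_mono_alpha) auto
    with ge le show False by linarith
  qed
  moreover have "continuous_on {e..a} \<Phi>"
    using e b_ge rho by (intro continuous_at_imp_continuous_on ballI DERIV_isCont[OF has_derivative_crit_series_alpha]) auto
  ultimately obtain x where "e \<le> x" "x \<le> a" "\<Phi> x = 1" using IVT'[of \<Phi> e 1 a] le ge by blast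
  with e show ?thesis by (intro exI[of _ x]) auto
qed

lemma crit_root: "crit_root b \<rho> > 0" "\<Phi> (crit_root b \<rho>) = 1"
proof -
  have "\<exists>!\<alpha>. \<alpha> > 0 \<and> \<Phi> \<alpha> = 1"
    using crit_root_exists strict_mono_alpha by (metis less_imp_le less_irrefl linorder_neqE)
  from theI'[OF this] show "crit_root b \<rho> > 0" "\<Phi> (crit_root b \<rho>) = 1"
    by (auto simp: crit_root_def)
qed

lemma less_crit_root: "0 \<le> \<alpha> \<Longrightarrow> \<Phi> \<alpha> < 1 \<longleftrightarrow> \<alpha> < crit_root b \<rho>"
  using strict_mono_alpha[of \<alpha> "crit_root b \<rho>"] strict_mono_alpha[of "crit_root b \<rho>" \<alpha>] crit_root
  by (cases \<alpha> "crit_root b \<rho>" rule: linorder_cases) auto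

lemma greater_crit_root: "0 \<le> \<alpha> \<Longrightarrow> \<Phi> \<alpha> > 1 \<longleftrightarrow> \<alpha> > crit_root b \<rho>"
  using strict_mono_alpha[of \<alpha> "crit_root b \<rho>"] strict_mono_alpha[of "crit_root b \<rho>" \<alpha>] crit_root
  by (cases \<alpha> "crit_root b \<rho>" rule: linorder_cases) auto

lemma crit_root_le: "crit_root b \<rho> \<le> ln (b / (b - 1)) / (- ln (1 - \<rho>))"
proof -
  define a where "a = ln (b / (b - 1)) / (- ln (1 - \<rho>))"
  have a: "a > 0" unfolding a_def by (intro divide_pos_pos ln_pos ln_ratio_pos)
  have "(1 - \<rho>) powr (- a) = b / (b - 1)"
    using rho_half ln_pos b_ge by (simp add: powr_def a_def)
  then have "(b - 1) * excess a \<rho> = 1" using b_ge by (simp add: excess_def field_simps)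
  then have "\<not> \<Phi> a < 1" using crit_series_ge[of a] a by simp
  then show ?thesis using less_crit_root[of a] a by (simp add: a_def)
qed

lemma crit_deriv_pos: "\<alpha> \<ge> 0 \<Longrightarrow> crit_deriv b \<alpha> \<rho> > 0"
proof -
  assume a: "\<alpha> \<ge> 0"
  let ?f = "\<lambda>k. b ^ k * (- ln (1 - \<rho> ^ Suc k) * (1 - \<rho> ^ Suc k) powr (- \<alpha>))"
  have "summable ?f"
  proof (rule summable_comparison_test'[of "\<lambda>k. 2 * 2 powr \<alpha> * \<rho> * (b * \<rho>) ^ k" 0])
    show "summable (\<lambda>k. 2 * 2 powr \<alpha> * \<rho> * (b * \<rho>) ^ k)"
      using rho b_ge by (intro summable_mult summable_geometric) auto
    show "norm (?f k) \<le> 2 * 2 powr \<alpha> * \<rho> * (b * \<rho>) ^ k" for k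
      using rho rho_half b_ge a by (intro crit_deriv_term_le) auto
  qed
  moreover have "?f k > 0" for k
    using rho_Suc[of k] b_ge by (intro mult_pos_pos) (simp_all del: power_Suc)
  ultimately have "suminf ?f > 0" by (rule suminf_pos)
  then show ?thesis using b_ge by (simp add: crit_deriv_def)
qed

lemma eventually_crit_rho: "eventually (\<lambda>r. crit_rho b r) (at \<rho>)"
proof -
  have "eventually (\<lambda>r. r \<in> {0<..<1 / b}) (at \<rho>)"
    using rho b_ge by (intro eventually_at_in_open') (auto simp: field_simps)
  then show ?thesis
    by eventually_elim (use b_ge in \<open>auto simp: crit_rho_def field_simps\<close>)
qed

lemma isCont_crit_series_rho: "\<alpha> \<ge> 0 \<Longrightarrow> isCont (\<lambda>r. crit_series b \<alpha> r) \<rho>"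
  using differentiable_crit_series_rho[OF b_ge rho(1,2)] DERIV_isCont by blast

text \<open>Whether the root lies above or below \<open>a\<close> is decided by the series at the
  fixed exponent \<open>a\<close>, so continuity of the series in \<rho> is enough.\<close>

lemma isCont_crit_root: "isCont (crit_root b) \<rho>"
  unfolding isCont_def
proof (rule order_tendstoI)
  fix a assume a: "a < crit_root b \<rho>"
  show "eventually (\<lambda>r. a < crit_root b r) (at \<rho>)"
  proof (cases "a \<ge> 0")
    case True
    then have "crit_series b a \<rho> < 1" using a by (simp add: less_crit_root)
    then have "eventually (\<lambda>r. crit_series b a r < 1) (at \<rho>)"
      using isCont_crit_series_rho[OF True, unfolded isCont_def] by (rule order_tendstoD(2)[rotated])
    with eventually_crit_rho show ?thesis
      by eventually_elim (use True in \<open>simp add: crit_rho.less_crit_root\<close>)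
  next
    case False
    from eventually_crit_rho show ?thesis
      by eventually_elim (use False crit_rho.crit_root(1) in force)
  qed
next
  fix a assume a: "a > crit_root b \<rho>"
  then have a0: "a \<ge> 0" using crit_root(1) by linarith
  then have "crit_series b a \<rho> > 1" using a by (simp add: greater_crit_root)
  then have "eventually (\<lambda>r. crit_series b a r > 1) (at \<rho>)"
    using isCont_crit_series_rho[OF a0, unfolded isCont_def] by (rule order_tendstoD(1)[rotated])
  with eventually_crit_rho show "eventually (\<lambda>r. crit_root b r < a) (at \<rho>)"
    by eventually_elim (use a0 in \<open>simp add: crit_rho.greater_crit_root\<close>)
qed

text \<open>Implicit differentiation: by the mean value theorem in \<open>\<alpha>\<close>, the difference quotient of the root
  is minus the one of the series in \<open>\<rho>\<close>, divided by the partial derivative at a nearby point.\<close>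

lemma differentiable_crit_root: "crit_root b differentiable (at \<rho>)"
proof -
  let ?A = "crit_root b"
  define A0 where "A0 = ?A \<rho>"
  define r where "r = (\<rho> + 1 / b) / 2"
  have "1 + \<rho> * b > 0" using rho b_ge by (simp add: add_pos_pos)
  then have r: "\<rho> < r" "b * r < 1" "r > 0"
    using rho b_ge by (auto simp: r_def field_simps)
  obtain E where E: "((\<lambda>r. crit_series b A0 r) has_real_derivative E) (at \<rho>)"
    using differentiable_crit_series_rho[OF b_ge rho(1,2), of A0] crit_root(1) by (auto simp: A0_def)
  define D where "D = crit_deriv b A0 \<rho>"
  have D: "D > 0" unfolding D_def using crit_root(1) by (intro crit_deriv_pos) (simp add: A0_def)
  \<comment> \<open>\<open>\<xi>\<close> is the intermediate point. Its distance to
    \<open>A0\<close> is at most that of the root, so it converges with the root; where the root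
    equals \<open>A0\<close>, the point \<open>A0\<close> itself serves.\<close>
  define P where "P x \<xi> \<longleftrightarrow> \<xi> > 0 \<and> \<bar>\<xi> - A0\<bar> \<le> \<bar>?A x - A0\<bar> \<and> 1 - crit_series b A0 x = (?A x - A0) * crit_deriv b \<xi> x" for x \<xi>
  define \<xi> where "\<xi> x = (SOME \<xi>. P x \<xi>)" for x
  have exP: "\<exists>\<xi>. P x \<xi>" if "crit_rho b x" for x
  proof -
    interpret X: crit_rho b x by fact
    have der: "((\<lambda>a. crit_series b a x) has_real_derivative crit_deriv b a x) (at a)" if "a > 0" for a
      using that X.b_ge X.rho by (intro has_derivative_crit_series_alpha)
    have A0: "A0 > 0" using crit_root(1) by (simp add: A0_def)
    consider "?A x < A0" | "?A x = A0" | "?A x > A0" by linarith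
    then show ?thesis
    proof cases
      case 1
      obtain \<zeta> where "\<zeta> > ?A x" "\<zeta> < A0" "crit_series b A0 x - crit_series b (?A x) x = (A0 - ?A x) * crit_deriv b \<zeta> x"
        using MVT2[OF 1, of "\<lambda>a. crit_series b a x" "\<lambda>a. crit_deriv b a x"] der X.crit_root(1) by force
      then show ?thesis using X.crit_root by (intro exI[of _ \<zeta>]) (auto simp: P_def algebra_simps)
    next
      case 2
      then show ?thesis using X.crit_root A0 by (intro exI[of _ A0]) (auto simp: P_def)
    next
      case 3
      obtain \<zeta> where "\<zeta> > A0" "\<zeta> < ?A x" "crit_series b (?A x) x - crit_series b A0 x = (?A x - A0) * crit_deriv b \<zeta> x"
        using MVT2[OF 3, of "\<lambda>a. crit_series b a x" "\<lambda>a. crit_deriv b a x"] der A0 by force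
      then show ?thesis using X.crit_root A0 by (intro exI[of _ \<zeta>]) (auto simp: P_def)
    qed
  qed
  note ev = eventually_crit_rho
  have evP: "eventually (\<lambda>x. P x (\<xi> x)) (at \<rho>)"
  proof (rule eventually_mono[OF ev])
    fix x assume "crit_rho b x"
    then show "P x (\<xi> x)" unfolding \<xi>_def by (rule someI_ex[OF exP])
  qed
  have Alim: "(?A \<longlongrightarrow> A0) (at \<rho>)" using isCont_crit_root by (simp add: isCont_def A0_def)
  have xlim: "(\<xi> \<longlongrightarrow> A0) (at \<rho>)"
  proof -
    have "eventually (\<lambda>x. norm (\<xi> x - A0) \<le> \<bar>?A x - A0\<bar>) (at \<rho>)"
      using evP by eventually_elim (simp add: P_def)
    moreover have "((\<lambda>x. \<bar>?A x - A0\<bar>) \<longlongrightarrow> 0) (at \<rho>)"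
      using Alim by (intro tendsto_rabs_zero) (rule Lim_null[THEN iffD1])
    ultimately have "((\<lambda>x. \<xi> x - A0) \<longlongrightarrow> 0) (at \<rho>)" by (rule Lim_null_comparison)
    then show ?thesis by (rule Lim_null[THEN iffD2])
  qed
  have Dlim: "((\<lambda>x. crit_deriv b (\<xi> x) x) \<longlongrightarrow> D) (at \<rho>)"
  proof -
    \<comment> \<open>A rectangle that contains the points (\<open>\<xi> x\<close>, x) for x near
      \<rho> and on which the partial derivative is jointly continuous.\<close>
    let ?K = "{0..A0 + 1} \<times> {0..r}"
    have A0: "A0 > 0" using crit_root(1) by (simp add: A0_def)
    have c: "continuous_on ?K (\<lambda>(\<alpha>, \<rho>). crit_deriv b \<alpha> \<rho>)"
      using b_ge r A0 by (intro continuous_on_crit_deriv) auto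
    have "((\<lambda>x. (\<xi> x, x)) \<longlongrightarrow> (A0, \<rho>)) (at \<rho>)" by (intro tendsto_intros xlim)
    moreover have "eventually (\<lambda>x. (\<xi> x, x) \<in> ?K) (at \<rho>)"
    proof -
      have "eventually (\<lambda>x. \<xi> x < A0 + 1) (at \<rho>)" using xlim by (rule order_tendstoD) simp
      moreover have "eventually (\<lambda>x. x < r) (at \<rho>)" using r by (intro order_tendstoD(2)[OF tendsto_ident_at])
      ultimately show ?thesis using evP ev
        by eventually_elim (auto simp: P_def crit_rho_def)
    qed
    ultimately have "((\<lambda>x. case (\<xi> x, x) of (\<alpha>, \<rho>) \<Rightarrow> crit_deriv b \<alpha> \<rho>) \<longlongrightarrow> (case (A0, \<rho>) of (\<alpha>, \<rho>) \<Rightarrow> crit_deriv b \<alpha> \<rho>)) (at \<rho>)"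
      using A0 r rho by (intro continuous_on_tendsto_compose[OF c]) auto
    then show ?thesis by (simp add: D_def)
  qed
  have Elim: "((\<lambda>x. (crit_series b A0 x - 1) / (x - \<rho>)) \<longlongrightarrow> E) (at \<rho>)"
    using E crit_root(2) by (simp add: has_field_derivative_iff A0_def)
  have "((\<lambda>x. - ((crit_series b A0 x - 1) / (x - \<rho>)) / crit_deriv b (\<xi> x) x) \<longlongrightarrow> - E / D) (at \<rho>)"
    using D by (intro tendsto_intros Elim Dlim) auto
  moreover have "eventually (\<lambda>x. - ((crit_series b A0 x - 1) / (x - \<rho>)) / crit_deriv b (\<xi> x) x = (?A x - ?A \<rho>) / (x - \<rho>)) (at \<rho>)"
    using evP ev
  proof eventually_elim
    case (elim x)
    have "crit_deriv b (\<xi> x) x > 0" using elim by (intro crit_rho.crit_deriv_pos) (auto simp: P_def)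
    moreover have "- (crit_series b A0 x - 1) = (?A x - A0) * crit_deriv b (\<xi> x) x"
      using elim by (simp add: P_def)
    then have "- ((crit_series b A0 x - 1) / (x - \<rho>)) = (?A x - A0) * crit_deriv b (\<xi> x) x / (x - \<rho>)"
      by (metis minus_divide_left)
    ultimately show ?case by (simp add: A0_def)
  qed
  ultimately have "(?A has_real_derivative (- E / D)) (at \<rho>)"
    unfolding has_field_derivative_iff by (rule Lim_transform_eventually)
  then show ?thesis by (auto simp: real_differentiable_def)
qed

text \<open>By \<open>excess \<alpha> y \<ge> \<alpha> * y\<close> the series is at least (b - 1)
  \<alpha> \<rho> / (1 - b \<rho>), a geometric sum, which must not exceed 1 at the root.\<close>

lemma crit_root_le_near: "crit_root b \<rho> \<le> (1 - b * \<rho>) / ((b - 1) * \<rho>)"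
proof -
  define \<alpha> where "\<alpha> = crit_root b \<rho>"
  define e where "e = 1 - b * \<rho>"
  have a: "0 < \<alpha>" "crit_series b \<alpha> \<rho> = 1" using crit_root by (auto simp: \<alpha>_def)
  have e: "0 < e" "e < 1" using rho b_ge by (auto simp: e_def)
  have geo1: "(\<lambda>k. b ^ k * \<rho> ^ Suc k) sums (\<rho> / e)"
    using sums_mult[OF geometric_sums[of "b * \<rho>"], of \<rho>] rho b_ge by (simp add: e_def power_mult_distrib mult_ac)
  note s = summable_excess[of \<alpha>]
  have lower: "1 \<ge> (b - 1) * (\<alpha> * (\<rho> / e))"
  proof -
    have "(\<Sum>k. \<alpha> * (b ^ k * \<rho> ^ Suc k)) \<le> (\<Sum>k. b ^ k * excess \<alpha> (\<rho> ^ Suc k))"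
    proof (rule suminf_le)
      fix k
      have "\<alpha> * \<rho> ^ Suc k \<le> excess \<alpha> (\<rho> ^ Suc k)"
        using excess_diff_ge[of 0 "\<rho> ^ Suc k" \<alpha>] rho_Suc[of k] a by (simp add: excess_def)
      then have "b ^ k * (\<alpha> * \<rho> ^ Suc k) \<le> b ^ k * excess \<alpha> (\<rho> ^ Suc k)"
        using b_ge by (intro mult_left_mono) auto
      then show "\<alpha> * (b ^ k * \<rho> ^ Suc k) \<le> b ^ k * excess \<alpha> (\<rho> ^ Suc k)" by (simp add: mult_ac)
    qed (use s a sums_summable[OF geo1] in \<open>auto intro!: summable_mult\<close>)
    also have "(\<Sum>k. \<alpha> * (b ^ k * \<rho> ^ Suc k)) = \<alpha> * (\<rho> / e)"
      using sums_unique[OF sums_mult[OF geo1, of \<alpha>]] by simp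
    finally have "(b - 1) * (\<alpha> * (\<rho> / e)) \<le> crit_series b \<alpha> \<rho>"
      unfolding crit_series_def using b_ge by (intro mult_left_mono) auto
    then show ?thesis using a by simp
  qed
  then show ?thesis using e b_ge rho unfolding \<alpha>_def[symmetric] e_def[symmetric] by (simp add: field_simps)
qed

text \<open>The quadratic terms of the upper bound sum to a geometric series of ratio b \<rho>^2
  \<le> 1/2, hence stay bounded relative to \<alpha>, while the linear ones blow up as b \<rho>
  tends to 1.\<close>

lemma crit_root_near:
  assumes "crit_root b \<rho> \<le> 1"
  shows "\<bar>crit_root b \<rho> - (1 - b * \<rho>) / ((b - 1) * \<rho>)\<bar> \<le> 4 * (1 - b * \<rho>)\<^sup>2 / (b - 1)"
proof -
  define \<alpha> where "\<alpha> = crit_root b \<rho>"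
  define e where "e = 1 - b * \<rho>"
  have a: "0 < \<alpha>" "\<alpha> \<le> 1" "crit_series b \<alpha> \<rho> = 1" using crit_root assms by (auto simp: \<alpha>_def)
  have e: "0 < e" "e < 1" using rho b_ge by (auto simp: e_def)
  have geo1: "(\<lambda>k. b ^ k * \<rho> ^ Suc k) sums (\<rho> / e)"
    using sums_mult[OF geometric_sums[of "b * \<rho>"], of \<rho>] rho b_ge by (simp add: e_def power_mult_distrib mult_ac)
  have br2: "b * \<rho>\<^sup>2 \<le> 1 / 2"
  proof -
    have "b * \<rho>\<^sup>2 = (b * \<rho>) * \<rho>" by (simp add: power2_eq_square)
    also have "\<dots> \<le> 1 * \<rho>" using rho by (intro mult_right_mono) auto
    finally show ?thesis using rho_half by linarith
  qed
  have geo2: "(\<lambda>k. b ^ k * (\<rho> ^ Suc k)\<^sup>2) sums (\<rho>\<^sup>2 / (1 - b * \<rho>\<^sup>2))"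
  proof -
    have "\<rho>\<^sup>2 * (b * \<rho>\<^sup>2) ^ k = b ^ k * (\<rho> ^ Suc k)\<^sup>2" for k
      by (simp add: power_mult_distrib power_mult[symmetric] mult_ac power2_eq_square power_add)
    then show ?thesis
      using sums_mult[OF geometric_sums[of "b * \<rho>\<^sup>2"], of "\<rho>\<^sup>2"] rho b_ge br2 by (simp add: abs_mult)
  qed
  note s = summable_excess[of \<alpha>]
  have upper: "1 \<le> (b - 1) * (\<alpha> * (\<rho> / e) + 2 * \<alpha> * (\<rho>\<^sup>2 / (1 - b * \<rho>\<^sup>2)))"
  proof -
    have sm: "(\<lambda>k. \<alpha> * (b ^ k * \<rho> ^ Suc k) + 2 * \<alpha> * (b ^ k * (\<rho> ^ Suc k)\<^sup>2)) sums
        (\<alpha> * (\<rho> / e) + 2 * \<alpha> * (\<rho>\<^sup>2 / (1 - b * \<rho>\<^sup>2)))"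
      by (intro sums_add sums_mult geo1 geo2)
    have "(\<Sum>k. b ^ k * excess \<alpha> (\<rho> ^ Suc k)) \<le> (\<Sum>k. \<alpha> * (b ^ k * \<rho> ^ Suc k) + 2 * \<alpha> * (b ^ k * (\<rho> ^ Suc k)\<^sup>2))"
    proof (rule suminf_le)
      fix k
      have "excess \<alpha> (\<rho> ^ Suc k) \<le> \<alpha> * \<rho> ^ Suc k + 2 * \<alpha> * (\<rho> ^ Suc k)\<^sup>2"
        using rho_Suc[of k] a by (intro excess_le_small) (auto simp del: power_Suc)
      then have "b ^ k * excess \<alpha> (\<rho> ^ Suc k) \<le> b ^ k * (\<alpha> * \<rho> ^ Suc k + 2 * \<alpha> * (\<rho> ^ Suc k)\<^sup>2)"
        using b_ge by (intro mult_left_mono) auto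
      then show "b ^ k * excess \<alpha> (\<rho> ^ Suc k) \<le> \<alpha> * (b ^ k * \<rho> ^ Suc k) + 2 * \<alpha> * (b ^ k * (\<rho> ^ Suc k)\<^sup>2)"
        by (simp add: algebra_simps del: power_Suc)
    qed (use s a sums_summable[OF sm] in auto)
    also have "\<dots> = \<alpha> * (\<rho> / e) + 2 * \<alpha> * (\<rho>\<^sup>2 / (1 - b * \<rho>\<^sup>2))" using sums_unique[OF sm] by simp
    finally have "crit_series b \<alpha> \<rho> \<le> (b - 1) * (\<alpha> * (\<rho> / e) + 2 * \<alpha> * (\<rho>\<^sup>2 / (1 - b * \<rho>\<^sup>2)))"
      unfolding crit_series_def using b_ge by (intro mult_left_mono) auto
    then show ?thesis using a by simp
  qed
  \<comment> \<open>The first-order value of the root. Multiplying the inequality by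
    \<open>T\<close> gives T \<le> \<alpha> + 4 \<alpha> \<rho> e, and \<alpha> \<le> T bounds the
    error.\<close>
  define T where "T = e / ((b - 1) * \<rho>)"
  have T: "T > 0" using e b_ge rho by (simp add: T_def)
  have le: "\<alpha> \<le> T" using crit_root_le_near by (simp add: T_def \<alpha>_def e_def)
  have "\<rho>\<^sup>2 / (1 - b * \<rho>\<^sup>2) \<le> \<rho>\<^sup>2 / (1 / 2)" using br2 by (intro divide_left_mono) auto
  then have "2 * \<alpha> * (\<rho>\<^sup>2 / (1 - b * \<rho>\<^sup>2)) \<le> 2 * \<alpha> * (\<rho>\<^sup>2 / (1 / 2))" using a by (intro mult_left_mono) auto
  then have "(b - 1) * (\<alpha> * (\<rho> / e) + 2 * \<alpha> * (\<rho>\<^sup>2 / (1 - b * \<rho>\<^sup>2))) \<le> (b - 1) * (\<alpha> * (\<rho> / e) + 4 * \<alpha> * \<rho>\<^sup>2)"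
    using b_ge by (intro mult_left_mono add_left_mono) auto
  with upper have "1 \<le> (b - 1) * (\<alpha> * (\<rho> / e) + 4 * \<alpha> * \<rho>\<^sup>2)" by linarith
  then have "T * 1 \<le> T * ((b - 1) * (\<alpha> * (\<rho> / e) + 4 * \<alpha> * \<rho>\<^sup>2))" using T by (intro mult_left_mono) auto
  also have "T * ((b - 1) * (\<alpha> * (\<rho> / e) + 4 * \<alpha> * \<rho>\<^sup>2)) = \<alpha> + 4 * \<alpha> * \<rho> * e"
    using e b_ge rho by (simp add: T_def field_simps power2_eq_square)
  also have "4 * \<alpha> * \<rho> * e \<le> 4 * T * \<rho> * e" using le rho e by (intro mult_right_mono) auto
  also have "4 * T * \<rho> * e = 4 * e\<^sup>2 / (b - 1)" using e b_ge rho by (simp add: T_def field_simps power2_eq_square)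
  finally show ?thesis using le unfolding \<alpha>_def[symmetric] e_def[symmetric] T_def by simp
qed

text \<open>The product \<alpha> \<rho> is at most \<open>c\<close> at the root, so the terms with k
  \<ge> 1 add up to at most C \<rho>. The term k = 0 must supply the rest, and taking logarithms
  bounds \<alpha> from below.\<close>

lemma crit_root_ge:
  defines "c \<equiv> ln (b / (b - 1))"
  defines "C \<equiv> 4 * c * exp (2 * c) * b"
  assumes small: "b * \<rho> \<le> 1 / 2" "C * \<rho> \<le> 1 / 2"
  shows "crit_root b \<rho> \<ge> c / \<rho> - (c + 2 * C)"
proof -
  define \<alpha> where "\<alpha> = crit_root b \<rho>"
  have c: "c > 0" unfolding c_def by (rule ln_ratio_pos)
  have a: "0 < \<alpha>" "crit_series b \<alpha> \<rho> = 1" using crit_root by (auto simp: \<alpha>_def)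
  have ar: "\<alpha> * \<rho> \<le> c"
  proof -
    have "\<rho> \<le> - ln (1 - \<rho>)" using minus_ln_one_minus_bounds(1)[of \<rho>] rho rho_half by simp
    then have "\<alpha> * \<rho> \<le> \<alpha> * (- ln (1 - \<rho>))" using a by (intro mult_left_mono) auto
    also have "\<dots> \<le> c"
      using crit_root_le ln_pos unfolding \<alpha>_def c_def by (simp add: field_simps)
    finally show ?thesis .
  qed
  have ex_le: "excess \<alpha> (\<rho> ^ Suc k) \<le> 2 * c * exp (2 * c) * \<rho> ^ k" for k
  proof -
    define y where "y = \<rho> ^ Suc k"
    have y: "0 < y" "y \<le> 1 / 2" using rho_Suc[of k] by (auto simp: y_def)
    define u where "u = \<alpha> * (- ln (1 - y))"
    have "- ln (1 - y) \<le> y / (1 - y)" using minus_ln_one_minus_bounds(2)[of y] y by simp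
    also have "\<dots> \<le> y / (1 / 2)" using y by (intro divide_left_mono) auto
    finally have "u \<le> \<alpha> * (2 * y)" unfolding u_def using a by (intro mult_left_mono) auto
    also have "\<dots> = 2 * (\<alpha> * \<rho>) * \<rho> ^ k" by (simp add: y_def)
    also have "\<dots> \<le> 2 * c * \<rho> ^ k" using ar rho by (intro mult_right_mono) auto
    finally have u: "u \<le> 2 * c * \<rho> ^ k" .
    have "\<rho> ^ k \<le> 1" using rho rho_half by (intro power_le_one) auto
    then have "2 * c * \<rho> ^ k \<le> 2 * c * 1" using c by (intro mult_left_mono) auto
    with u have u2: "u \<le> 2 * c" by simp
    have u0: "u \<ge> 0" unfolding u_def using a y by (intro mult_nonneg_nonneg) auto
    have "1 - u \<le> exp (- u)" using exp_ge_add_one_self[of "- u"] by simp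
    then have "exp u * (1 - u) \<le> exp u * exp (- u)" by (intro mult_left_mono) auto
    also have "exp u * exp (- u) = 1" by (simp flip: exp_add)
    finally have "exp u - 1 \<le> u * exp u" by (simp add: algebra_simps)
    also have "\<dots> \<le> (2 * c * \<rho> ^ k) * exp (2 * c)" using u u2 u0 by (intro mult_mono) auto
    finally have "exp u - 1 \<le> 2 * c * exp (2 * c) * \<rho> ^ k" by (simp add: mult_ac)
    moreover have "excess \<alpha> y = exp u - 1" using y by (simp add: excess_def powr_def u_def)
    ultimately show ?thesis by (simp add: y_def)
  qed
  define E where "E = (1 - \<rho>) powr (- \<alpha>)"
  have "1 \<le> (b - 1) * (E - 1) + (b - 1) * (C * \<rho>)"
  proof -
    define f where "f k = b ^ k * excess \<alpha> (\<rho> ^ Suc k)" for k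
    have s: "summable f" unfolding f_def using a by (intro summable_excess) auto
    have g: "(\<lambda>k. 2 * c * exp (2 * c) * b * \<rho> * (b * \<rho>) ^ k) sums (2 * c * exp (2 * c) * b * \<rho> * (1 / (1 - b * \<rho>)))"
      using rho b_ge by (intro sums_mult geometric_sums) auto
    have "suminf (\<lambda>k. f (Suc k)) \<le> (\<Sum>k. 2 * c * exp (2 * c) * b * \<rho> * (b * \<rho>) ^ k)"
    proof (rule suminf_le)
      show "f (Suc k) \<le> 2 * c * exp (2 * c) * b * \<rho> * (b * \<rho>) ^ k" for k
      proof -
        have "f (Suc k) \<le> b ^ Suc k * (2 * c * exp (2 * c) * \<rho> ^ Suc k)"
          unfolding f_def using b_ge by (intro mult_left_mono ex_le) auto
        then show ?thesis by (simp add: power_mult_distrib mult_ac)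
      qed
      show "summable (\<lambda>k. f (Suc k))" using s by (simp add: summable_Suc_iff)
    qed (use sums_summable[OF g] in auto)
    also have "\<dots> = 2 * c * exp (2 * c) * b * \<rho> * (1 / (1 - b * \<rho>))" using sums_unique[OF g] by simp
    also have "\<dots> \<le> 2 * c * exp (2 * c) * b * \<rho> * (1 / (1 / 2))"
      using small c b_ge rho by (intro mult_left_mono divide_left_mono) auto
    also have "\<dots> = C * \<rho>" by (simp add: C_def)
    finally have "suminf f \<le> f 0 + C * \<rho>" using suminf_split_head[OF s] by simp
    then have "(b - 1) * suminf f \<le> (b - 1) * (f 0 + C * \<rho>)" using b_ge by (intro mult_left_mono) auto
    moreover have "(b - 1) * suminf f = 1" using a by (simp add: crit_series_def f_def[abs_def])
    ultimately show ?thesis by (simp add: f_def E_def excess_def algebra_simps)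
  qed
  then have "b - (b - 1) * (C * \<rho>) \<le> (b - 1) * E" by (simp add: algebra_simps)
  then have E: "b / (b - 1) - C * \<rho> \<le> E" using b_ge by (simp add: field_simps)
  have p: "b / (b - 1) \<ge> 1" using b_ge by (simp add: field_simps)
  have C0: "C * \<rho> \<ge> 0" using c b_ge rho by (simp add: C_def)
  have pos: "b / (b - 1) - C * \<rho> > 0" using p small by linarith
  have "c - 2 * (C * \<rho>) \<le> ln (b / (b - 1) - C * \<rho>)"
  proof -
    have "ln (b / (b - 1)) - ln (b / (b - 1) - C * \<rho>) \<le> (b / (b - 1) - (b / (b - 1) - C * \<rho>)) / (b / (b - 1) - C * \<rho>)"
      using pos p by (intro ln_diff_le) auto
    also have "\<dots> = C * \<rho> / (b / (b - 1) - C * \<rho>)" by simp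
    also have "\<dots> \<le> C * \<rho> / (1 / 2)"
    proof (rule divide_left_mono[OF _ C0])
      show "1 / 2 \<le> b / (b - 1) - C * \<rho>" using p small by linarith
      show "0 < (b / (b - 1) - C * \<rho>) * (1 / 2)" using pos by (intro mult_pos_pos) auto
    qed
    finally show ?thesis by (simp add: c_def)
  qed
  also have "\<dots> \<le> ln E" using E pos by simp
  also have "ln E = \<alpha> * (- ln (1 - \<rho>))" using rho_half by (simp add: E_def ln_powr)
  also have "\<dots> \<le> \<alpha> * (\<rho> / (1 - \<rho>))"
    using a minus_ln_one_minus_bounds(2)[of \<rho>] rho rho_half by (intro mult_left_mono) auto
  finally have "(c - 2 * (C * \<rho>)) * (1 - \<rho>) \<le> \<alpha> * \<rho>" using rho_half by (simp add: field_simps)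
  moreover have "(c - 2 * (C * \<rho>)) * (1 - \<rho>) \<ge> c - (c + 2 * C) * \<rho>"
  proof -
    have "(c - 2 * (C * \<rho>)) * (1 - \<rho>) = c - (c + 2 * C) * \<rho> + 2 * (C * \<rho>) * \<rho>" by (simp add: algebra_simps)
    then show ?thesis using C0 rho by simp
  qed
  ultimately have "c - (c + 2 * C) * \<rho> \<le> \<alpha> * \<rho>" by linarith
  then have "c / \<rho> - (c + 2 * C) \<le> \<alpha>" using rho by (simp add: field_simps)
  then show ?thesis by (simp add: \<alpha>_def)
qed

end

section \<open>The critical value as a function of the killing parameter\<close>

definition inv_weight :: "nat \<Rightarrow> real \<Rightarrow> real" where
  "inv_weight d \<kappa> = (1 + \<kappa>) * real d"

text \<open>Square root of the discriminant of b s^2 - y s + 1 = 0, the equation for s = sqrt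
  \<rho>, where y is \<open>inv_weight d \<kappa>\<close> and b = d - 1; it vanishes at
  \<open>kappa_c d\<close>.\<close>

definition disc :: "nat \<Rightarrow> real \<Rightarrow> real" where
  "disc d \<kappa> = sqrt ((inv_weight d \<kappa>)\<^sup>2 - 4 * (real d - 1))"

text \<open>The root in \<open>(0, 1/(d - 1)]\<close> of \<open>(1 + (d - 1) \<rho>) / \<surd>\<rho> = (1 + \<kappa>) d\<close>.\<close>

definition rho_of :: "nat \<Rightarrow> real \<Rightarrow> real" where
  "rho_of d \<kappa> = (2 / (inv_weight d \<kappa> + disc d \<kappa>))\<^sup>2"

locale tree_degree =
  fixes d :: nat
  assumes d3: "d \<ge> 3"
begin

abbreviation "b \<equiv> real d - 1"

abbreviation "y \<equiv> inv_weight d"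

abbreviation "D \<equiv> disc d"

abbreviation "R \<equiv> rho_of d"

lemma b2: "b \<ge> 2"
  using d3 by simp

lemma y_eq: "y \<kappa> = 2 * sqrt b + real d * (\<kappa> - kappa_c d)"
  using d3 by (simp add: inv_weight_def kappa_c_def field_simps)

lemma y_ge_iff: "\<kappa> \<ge> kappa_c d \<longleftrightarrow> y \<kappa> \<ge> 2 * sqrt b" "\<kappa> > kappa_c d \<longleftrightarrow> y \<kappa> > 2 * sqrt b"
  using d3 unfolding y_eq by (auto simp: zero_le_mult_iff zero_less_mult_iff)

lemma kappa_c_gt: "kappa_c d > -1"
  using d3 by (simp add: kappa_c_def)

lemma sqrt_b_pos: "sqrt b > 0"
  using b2 by simp

lemma y_pos: "\<kappa> \<ge> kappa_c d \<Longrightarrow> y \<kappa> > 0"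
  using sqrt_b_pos y_ge_iff(1)[of \<kappa>] by linarith

lemma y_sq_ge: "\<kappa> \<ge> kappa_c d \<Longrightarrow> (y \<kappa>)\<^sup>2 \<ge> 4 * b"
proof -
  assume "\<kappa> \<ge> kappa_c d"
  then have "2 * sqrt b \<le> y \<kappa>" by (simp add: y_ge_iff)
  then have "(2 * sqrt b)\<^sup>2 \<le> (y \<kappa>)\<^sup>2" using sqrt_b_pos by (intro power_mono) auto
  then show ?thesis using b2 by (simp add: power_mult_distrib)
qed

lemma D_sq: "\<kappa> \<ge> kappa_c d \<Longrightarrow> (D \<kappa>)\<^sup>2 = (y \<kappa>)\<^sup>2 - 4 * b" and D_nonneg: "\<kappa> \<ge> kappa_c d \<Longrightarrow> D \<kappa> \<ge> 0"
  using y_sq_ge[of \<kappa>] by (auto simp: disc_def)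

lemma D_le: "\<kappa> \<ge> kappa_c d \<Longrightarrow> D \<kappa> \<le> y \<kappa>"
  using y_pos[of \<kappa>] b2 by (auto simp: disc_def intro!: real_le_lsqrt)

text \<open>Factors y^2 - 4 b as a difference of squares; y = 2 sqrt b at \<open>kappa_c d\<close>,
  so the square root of \<kappa> - \<open>kappa_c d\<close> splits off.\<close>

lemma D_eq: "\<kappa> \<ge> kappa_c d \<Longrightarrow> D \<kappa> = sqrt (real d * (\<kappa> - kappa_c d)) * sqrt (4 * sqrt b + real d * (\<kappa> - kappa_c d))"
proof -
  have "(y \<kappa>)\<^sup>2 - 4 * b = real d * (\<kappa> - kappa_c d) * (4 * sqrt b + real d * (\<kappa> - kappa_c d))"
  proof -
    have "(2 * s + x)\<^sup>2 - 4 * (s * s) = x * (4 * s + x)" for s x :: real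
      by (simp add: power2_eq_square algebra_simps)
    from this[of "sqrt b" "real d * (\<kappa> - kappa_c d)"] show ?thesis
      unfolding y_eq using b2 by simp
  qed
  then show ?thesis by (simp add: disc_def real_sqrt_mult)
qed

lemma R_pos: "\<kappa> \<ge> kappa_c d \<Longrightarrow> R \<kappa> > 0"
  using y_pos[of \<kappa>] D_nonneg[of \<kappa>] by (simp add: rho_of_def)

lemma inv_R: "1 / R \<kappa> = (y \<kappa> + D \<kappa>)\<^sup>2 / 4"
  by (simp add: rho_of_def power_divide)

lemma R_excess: "\<kappa> \<ge> kappa_c d \<Longrightarrow> 1 / R \<kappa> - b = D \<kappa> * (y \<kappa> + D \<kappa>) / 2"
  unfolding inv_R using D_sq[of \<kappa>] by (simp add: power2_eq_square field_simps)

lemma bR_le: "\<kappa> \<ge> kappa_c d \<Longrightarrow> b * R \<kappa> \<le> 1"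
proof -
  assume k: "\<kappa> \<ge> kappa_c d"
  have "1 / R \<kappa> - b \<ge> 0" unfolding R_excess[OF k] using D_nonneg[OF k] y_pos[OF k] by simp
  then show ?thesis using R_pos[OF k] by (simp add: field_simps)
qed

lemma D_pos: "\<kappa> > kappa_c d \<Longrightarrow> D \<kappa> > 0"
  using D_eq[of \<kappa>] d3 sqrt_b_pos by (auto intro!: mult_pos_pos add_pos_pos)

lemma bR_lt: "\<kappa> > kappa_c d \<Longrightarrow> b * R \<kappa> < 1"
proof -
  assume k: "\<kappa> > kappa_c d"
  have "1 / R \<kappa> - b > 0" unfolding R_excess[OF less_imp_le[OF k]] using D_pos[OF k] y_pos[of \<kappa>] k by simp
  then show ?thesis using R_pos[of \<kappa>] k by (simp add: field_simps)
qed

lemma R_quadratic: "\<kappa> \<ge> kappa_c d \<Longrightarrow> 1 + b * R \<kappa> = y \<kappa> * sqrt (R \<kappa>)"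
proof -
  assume k: "\<kappa> \<ge> kappa_c d"
  define s where "s = y \<kappa> + D \<kappa>"
  have s: "s > 0" using y_pos[OF k] D_nonneg[OF k] by (simp add: s_def)
  have "s\<^sup>2 + 4 * b = 2 * y \<kappa> * s" using D_sq[OF k] by (simp add: s_def power2_eq_square algebra_simps)
  then have "1 + b * (4 / s\<^sup>2) = y \<kappa> * (2 / s)" using s by (simp add: field_simps power2_eq_square)
  moreover have R: "R \<kappa> = (2 / s)\<^sup>2" by (simp add: rho_of_def s_def)
  moreover have "sqrt (R \<kappa>) = 2 / s" unfolding R using s by simp
  moreover have "R \<kappa> = 4 / s\<^sup>2" unfolding R by (simp add: power_divide)
  ultimately show ?thesis by metis
qed

lemma step_weight_R: "\<kappa> \<ge> kappa_c d \<Longrightarrow> 1 / ((1 + \<kappa>) * real d) = step_weight d (R \<kappa>)"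
  unfolding step_weight_def R_quadratic
  using R_pos[of \<kappa>] y_pos[of \<kappa>] by (simp add: inv_weight_def[symmetric])

lemma crit_rho_R: "\<kappa> > kappa_c d \<Longrightarrow> crit_rho b (R \<kappa>)"
  using b2 R_pos[of \<kappa>] bR_lt[of \<kappa>] by (simp add: crit_rho_def)

lemma soup_rho_R: "\<kappa> \<ge> kappa_c d \<Longrightarrow> \<alpha> \<ge> 0 \<Longrightarrow> soup_rho d \<alpha> \<kappa> (R \<kappa>)"
  using d3 R_pos[of \<kappa>] bR_le[of \<kappa>] step_weight_R[of \<kappa>] kappa_c_gt
  by unfold_locales auto

lemma alpha_c_above:
  assumes k: "\<kappa> > kappa_c d"
  shows "alpha_c d \<kappa> = crit_root b (R \<kappa>)"
proof -
  interpret C: crit_rho b "R \<kappa>" by (rule crit_rho_R) fact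
  have S: "soup_rho d \<alpha> \<kappa> (R \<kappa>)" if "\<alpha> \<ge> 0" for \<alpha> using that k by (intro soup_rho_R) auto
  show ?thesis
  proof (rule alpha_c_eqI)
    show "crit_root b (R \<kappa>) \<ge> 0" using C.crit_root(1) by simp
    show "\<theta> d \<alpha> \<kappa> > 0" if "\<alpha> > crit_root b (R \<kappa>)" for \<alpha>
    proof -
      have a: "\<alpha> \<ge> 0" using that C.crit_root(1) by linarith
      show ?thesis
        using soup_rho.theta_crit_series(2)[OF S[OF a] bR_lt[OF k]] C.greater_crit_root[OF a] that by simp
    qed
    show "\<theta> d \<alpha> \<kappa> = 0" if "0 \<le> \<alpha>" "\<alpha> < crit_root b (R \<kappa>)" for \<alpha>
      using soup_rho.theta_crit_series(1)[OF S[OF that(1)] bR_lt[OF k]] C.less_crit_root[OF that(1)] that by simp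
  qed
qed

text \<open>Below \<open>kappa_c d\<close> the edge masses are infinite; at \<open>kappa_c d\<close>
  they are finite, but (d - 1) \<rho> = 1 makes the total renewal weight diverge.\<close>

lemma alpha_c_below:
  assumes k: "\<kappa> > -1" "\<kappa> \<le> kappa_c d"
  shows "alpha_c d \<kappa> = 0"
proof (rule alpha_c_eq_0)
  fix \<alpha> :: real assume a: "\<alpha> > 0"
  show "\<theta> d \<alpha> \<kappa> > 0"
  proof (cases "\<kappa> = kappa_c d")
    case True
    have "D \<kappa> = 0" using D_eq[of \<kappa>] True by simp
    then have "1 / R \<kappa> = b" using R_excess[of \<kappa>] True by simp
    then have "b * R \<kappa> = 1" using R_pos[of \<kappa>] True by (simp add: field_simps)
    then show ?thesis
      using soup_rho.theta_pos_critical[OF soup_rho_R[of \<kappa> \<alpha>]] a True by simp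
  next
    case False
    have y: "0 < y \<kappa>" "y \<kappa> < 2 * sqrt b"
      using k False y_ge_iff(1)[of \<kappa>] d3 by (auto simp: inv_weight_def)
    then have "(y \<kappa>)\<^sup>2 < (2 * sqrt b)\<^sup>2" by (intro power_strict_mono) auto
    then have "(y \<kappa>)\<^sup>2 < 4 * b" using b2 by (simp add: power_mult_distrib)
    then have "4 * b * (1 / y \<kappa>)\<^sup>2 > 1" using y by (simp add: power_divide field_simps)
    then show ?thesis using d3 a k(1) by (intro theta_pos_infinite_mass) (auto simp: inv_weight_def)
  qed
qed

lemma R_strict_antimono:
  assumes "kappa_c d \<le> \<kappa>" "\<kappa> < \<kappa>'"
  shows "R \<kappa>' < R \<kappa>"
proof -
  have y: "y \<kappa> < y \<kappa>'" using assms d3 by (simp add: inv_weight_def)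
  have "(y \<kappa>)\<^sup>2 \<le> (y \<kappa>')\<^sup>2" using y y_pos[OF assms(1)] by (intro power_mono) auto
  then have "D \<kappa> \<le> D \<kappa>'" by (simp add: disc_def)
  with y have "y \<kappa> + D \<kappa> < y \<kappa>' + D \<kappa>'" by simp
  moreover have "y \<kappa> + D \<kappa> > 0" using y_pos[OF assms(1)] D_nonneg[OF assms(1)] by simp
  ultimately show ?thesis unfolding rho_of_def
    by (intro power_strict_mono divide_strict_left_mono mult_pos_pos) auto
qed

lemma strict_mono_alpha_c: "strict_mono_on {kappa_c d..} (alpha_c d)"
proof (rule strict_mono_onI)
  fix \<kappa> \<kappa>' assume k: "\<kappa> \<in> {kappa_c d..}" "\<kappa>' \<in> {kappa_c d..}" "\<kappa> < \<kappa>'"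
  interpret C': crit_rho b "R \<kappa>'" using k by (intro crit_rho_R) auto
  show "alpha_c d \<kappa> < alpha_c d \<kappa>'"
  proof (cases "\<kappa> = kappa_c d")
    case True
    then show ?thesis using C'.crit_root(1) alpha_c_above[of \<kappa>'] alpha_c_below[of \<kappa>] kappa_c_gt k by simp
  next
    case False
    then have k': "\<kappa> > kappa_c d" using k by simp
    interpret C: crit_rho b "R \<kappa>" using k' by (rule crit_rho_R)
    \<comment> \<open>Raising \<kappa> lowers \<rho>, so at the old root the series drops below 1
      and the new root lies higher.\<close>
    have "crit_series b (crit_root b (R \<kappa>)) (R \<kappa>') < crit_series b (crit_root b (R \<kappa>)) (R \<kappa>)"
      using R_strict_antimono[of \<kappa> \<kappa>'] k C.crit_root(1) C.b_ge C.rho C'.rho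
      by (intro crit_series_strict_mono) auto
    then have "crit_root b (R \<kappa>) < crit_root b (R \<kappa>')"
      using C.crit_root by (subst C'.less_crit_root[symmetric]) auto
    then show ?thesis using k k' by (simp add: alpha_c_above)
  qed
qed

lemma differentiable_alpha_c_above:
  assumes k: "\<kappa> > kappa_c d"
  shows "alpha_c d differentiable (at \<kappa>)"
proof -
  interpret C: crit_rho b "R \<kappa>" using k by (rule crit_rho_R)
  have k': "\<kappa> \<ge> kappa_c d" using k by simp
  \<comment> \<open>Keeps the argument of the square root in \<open>disc\<close> away from 0, where
    the root is not differentiable.\<close>
  have "(y \<kappa>)\<^sup>2 - 4 * b > 0" using D_pos[OF k] by (simp add: disc_def)
  moreover have "y \<kappa> + D \<kappa> \<noteq> 0" using y_pos[OF k'] D_pos[OF k] by simp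
  ultimately have "\<exists>E. (R has_real_derivative E) (at \<kappa>)"
    unfolding rho_of_def[abs_def] disc_def inv_weight_def
    by (intro exI) (rule derivative_eq_intros refl | simp)+
  then have "R differentiable (at \<kappa>)" by (simp add: real_differentiable_def)
  then have "(crit_root b \<circ> R) differentiable (at \<kappa>)"
    by (rule differentiable_chain_at) (rule C.differentiable_crit_root)
  then obtain E where "((crit_root b \<circ> R) has_real_derivative E) (at \<kappa>)" by (auto simp: real_differentiable_def)
  moreover have "eventually (\<lambda>x. x \<in> {kappa_c d<..}) (nhds \<kappa>)"
    using k by (intro eventually_nhds_in_open) auto
  then have "eventually (\<lambda>x. alpha_c d x = (crit_root b \<circ> R) x) (nhds \<kappa>)"
    by eventually_elim (simp add: alpha_c_above)
  ultimately have "(alpha_c d has_real_derivative E) (at \<kappa>)"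
    by (subst DERIV_cong_ev[OF refl _ refl])
  then show ?thesis by (auto simp: real_differentiable_def)
qed

lemma differentiable_alpha_c_below:
  assumes k: "-1 < \<kappa>" "\<kappa> < kappa_c d"
  shows "alpha_c d differentiable (at \<kappa>)"
proof -
  have "eventually (\<lambda>x. x \<in> {-1<..<kappa_c d}) (nhds \<kappa>)"
    using k by (intro eventually_nhds_in_open) auto
  then have "eventually (\<lambda>x. alpha_c d x = 0) (nhds \<kappa>)"
    by eventually_elim (simp add: alpha_c_below)
  then have "(alpha_c d has_real_derivative 0) (at \<kappa>)"
    by (subst DERIV_cong_ev[OF refl _ refl]) auto
  then show ?thesis by (auto simp: real_differentiable_def)
qed

text \<open>\<open>crit_root_near\<close> in terms of \<kappa>, through 1 - b \<rho> = \<rho>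
  (1/\<rho> - b) and \<open>R_excess\<close>.\<close>

lemma alpha_c_near:
  assumes k: "\<kappa> > kappa_c d" and a: "alpha_c d \<kappa> \<le> 1"
  shows "\<bar>alpha_c d \<kappa> - D \<kappa> * (y \<kappa> + D \<kappa>) / (2 * (b - 1))\<bar> \<le> (D \<kappa>)\<^sup>2 * (y \<kappa> + D \<kappa>)\<^sup>2"
proof -
  interpret C: crit_rho b "R \<kappa>" using k by (rule crit_rho_R)
  have k': "\<kappa> \<ge> kappa_c d" using k by simp
  define T where "T = D \<kappa> * (y \<kappa> + D \<kappa>) / 2"
  have Rp: "R \<kappa> > 0" using k' by (rule R_pos)
  have T: "1 / R \<kappa> - b = T" unfolding T_def using k' by (rule R_excess)
  have e: "1 - b * R \<kappa> = R \<kappa> * T" unfolding T[symmetric] using Rp by (simp add: field_simps)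
  have "\<bar>crit_root b (R \<kappa>) - (1 - b * R \<kappa>) / ((b - 1) * R \<kappa>)\<bar> \<le> 4 * (1 - b * R \<kappa>)\<^sup>2 / (b - 1)"
    using a k by (intro C.crit_root_near) (simp add: alpha_c_above)
  also have "(1 - b * R \<kappa>) / ((b - 1) * R \<kappa>) = T / (b - 1)" unfolding e using Rp by simp
  also have "4 * (1 - b * R \<kappa>)\<^sup>2 / (b - 1) \<le> 4 * (1 - b * R \<kappa>)\<^sup>2 / 1"
    using b2 by (intro divide_left_mono) auto
  also have "\<dots> = 4 * (R \<kappa>)\<^sup>2 * T\<^sup>2" unfolding e by (simp add: power_mult_distrib)
  also have "\<dots> \<le> 4 * 1 * T\<^sup>2"
    using Rp C.rho_half by (intro mult_right_mono mult_left_mono power_le_one) auto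
  also have "4 * 1 * T\<^sup>2 = (D \<kappa>)\<^sup>2 * (y \<kappa> + D \<kappa>)\<^sup>2" by (simp add: T_def power_divide power_mult_distrib)
  finally show ?thesis using k by (simp add: T_def alpha_c_above mult.commute)
qed

lemma alpha_c_le: "\<kappa> > kappa_c d \<Longrightarrow> alpha_c d \<kappa> \<le> D \<kappa> * (y \<kappa> + D \<kappa>) / (2 * (b - 1))"
proof -
  assume k: "\<kappa> > kappa_c d"
  interpret C: crit_rho b "R \<kappa>" using k by (rule crit_rho_R)
  have "crit_root b (R \<kappa>) \<le> (1 - b * R \<kappa>) / ((b - 1) * R \<kappa>)" by (rule C.crit_root_le_near)
  also have "\<dots> = (1 / R \<kappa> - b) / (b - 1)" using C.rho b2 by (simp add: field_simps)
  finally show ?thesis using k R_excess[of \<kappa>] by (simp add: alpha_c_above mult.commute)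
qed

text \<open>With p = sqrt(d (\<kappa> - \<open>kappa_c d\<close>)) and c = b^(1/4), D equals p q
  with q near 2 c, and y is near 2 c^2. So D y / 2 is near 2 p c^3, which yields the leading term
  after division by b - 1 = d - 2; all errors are of order p^2.\<close>

lemma alpha_c_asymp_critical:
  "(\<lambda>\<kappa>. alpha_c d \<kappa> - 2 * sqrt (real d) * b powr (3/4) / (real d - 2) * sqrt (\<kappa> - kappa_c d))
     \<in> O[at_right (kappa_c d)](\<lambda>\<kappa>. \<kappa> - kappa_c d)"
proof -
  define c where "c = sqrt (sqrt b)"
  have c: "c > 0" using sqrt_b_pos by (simp add: c_def)
  have c2: "c\<^sup>2 = sqrt b" using sqrt_b_pos by (simp add: c_def)
  have c3: "b powr (3/4) = c ^ 3"
  proof -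
    have "c = b powr (1/4)" using b2 by (simp add: c_def powr_half_sqrt[symmetric] powr_powr)
    then show ?thesis using b2 by (simp add: powr_powr flip: powr_realpow)
  qed
  define q0 where "q0 = sqrt (4 * c\<^sup>2 + 1)"
  have q0: "q0 \<ge> 1" by (simp add: q0_def)
  \<comment> \<open>For p \<le> 1 the product D (y + D) is at most p m. The radius 1/(d m^2) below
    gives p \<le> 1/m, which ensures \<open>alpha_c d \<kappa> \<le> 1\<close> as
    \<open>alpha_c_near\<close> demands.\<close>
  define m where "m = q0 * (2 * c\<^sup>2 + 1 + q0)"
  have "1 * 1 \<le> m" unfolding m_def using q0 by (intro mult_mono add_increasing) auto
  then have m: "m \<ge> 1" by simp
  define C2 where "C2 = c / 4 + q0 / 2 + q0\<^sup>2 / 2"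
  have bound: "\<bar>alpha_c d \<kappa> - 2 * sqrt (real d) * b powr (3/4) / (real d - 2) * sqrt (\<kappa> - kappa_c d)\<bar>
      \<le> (m\<^sup>2 + C2) * real d * \<bar>\<kappa> - kappa_c d\<bar>"
    if k: "kappa_c d < \<kappa>" "\<kappa> < kappa_c d + 1 / (real d * m\<^sup>2)" for \<kappa>
  proof -
    define p where "p = sqrt (real d * (\<kappa> - kappa_c d))"
    define q where "q = sqrt (4 * c\<^sup>2 + p\<^sup>2)"
    have k': "\<kappa> \<ge> kappa_c d" using k by simp
    have p2: "p\<^sup>2 = real d * (\<kappa> - kappa_c d)" using k by (simp add: p_def)
    have p0: "p > 0" unfolding p_def using k d3 by simp
    have "p\<^sup>2 \<le> (1 / m)\<^sup>2" unfolding p2 using k d3 m by (simp add: field_simps)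
    then have pm: "p \<le> 1 / m" by (rule power2_le_imp_le) (use m in simp)
    also have "1 / m \<le> 1" using m by simp
    finally have p1: "p \<le> 1" .
    have p21: "p\<^sup>2 \<le> 1" using p0 p1 by (simp add: power_le_one)
    have q: "q > 0" "q \<le> q0" "q \<ge> 2 * c" "q \<le> 2 * c + p\<^sup>2 / (4 * c)"
    proof -
      show "q > 0" unfolding q_def using c p0 by (simp add: add_pos_pos)
      show "q \<le> q0" unfolding q_def q0_def using p21 by simp
      show "q \<ge> 2 * c" unfolding q_def by (rule real_le_rsqrt) (simp add: power_mult_distrib)
      show "q \<le> 2 * c + p\<^sup>2 / (4 * c)" unfolding q_def
        using c p0 by (intro real_le_lsqrt) (simp_all add: power2_eq_square field_simps)
    qed
    have D: "D \<kappa> = p * q" using D_eq[OF k'] by (simp add: p_def[symmetric] q_def c2 p2)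
    have y: "y \<kappa> = 2 * c\<^sup>2 + p\<^sup>2" by (simp add: y_eq c2 p2)
    have "p * q \<le> 1 * q0" using p0 p1 q by (intro mult_mono) auto
    then have "y \<kappa> + D \<kappa> \<le> 2 * c\<^sup>2 + 1 + q0" unfolding y D using p21 by linarith
    moreover have yD: "y \<kappa> + D \<kappa> \<ge> 0" using y_pos[OF k'] D_nonneg[OF k'] by simp
    ultimately have "q * (y \<kappa> + D \<kappa>) \<le> m" unfolding m_def using q q0 by (intro mult_mono) auto
    then have "p * (q * (y \<kappa> + D \<kappa>)) \<le> p * m" using p0 by (intro mult_left_mono) auto
    then have Dm: "D \<kappa> * (y \<kappa> + D \<kappa>) \<le> p * m" unfolding D by (simp add: mult_ac)
    have Dn: "D \<kappa> * (y \<kappa> + D \<kappa>) \<ge> 0" using D_nonneg[OF k'] yD by simp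
    have "p * m \<le> 1 / m * m" using pm m by (intro mult_right_mono) auto
    then have "D \<kappa> * (y \<kappa> + D \<kappa>) \<le> 1" using Dm m by simp
    moreover have "D \<kappa> * (y \<kappa> + D \<kappa>) / (2 * (b - 1)) \<le> D \<kappa> * (y \<kappa> + D \<kappa>) / 1"
      using Dn b2 by (intro divide_left_mono) auto
    ultimately have "alpha_c d \<kappa> \<le> 1" using alpha_c_le[OF k(1)] by simp
    then have "\<bar>alpha_c d \<kappa> - D \<kappa> * (y \<kappa> + D \<kappa>) / (2 * (b - 1))\<bar> \<le> (D \<kappa> * (y \<kappa> + D \<kappa>))\<^sup>2"
      using alpha_c_near[OF k(1)] by (simp add: power_mult_distrib)
    also have "\<dots> \<le> (p * m)\<^sup>2" using Dm Dn by (intro power_mono) auto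
    finally have 1: "\<bar>alpha_c d \<kappa> - D \<kappa> * (y \<kappa> + D \<kappa>) / (2 * (b - 1))\<bar> \<le> m\<^sup>2 * p\<^sup>2"
      by (simp add: power_mult_distrib mult.commute)
    \<comment> \<open>The remainder after the leading term. Every summand of its expansion is of
      order p^2, since q - 2 c itself is.\<close>
    define Z where "Z = D \<kappa> * (y \<kappa> + D \<kappa>) / 2 - 2 * p * c ^ 3"
    have Z: "Z = p * c\<^sup>2 * (q - 2 * c) + p\<^sup>2 * (p * q / 2) + p\<^sup>2 * (q\<^sup>2 / 2)"
      unfolding Z_def D y by (simp add: power2_eq_square power3_eq_cube field_simps)
    have "Z \<ge> 0" unfolding Z using p0 q by (intro add_nonneg_nonneg mult_nonneg_nonneg) auto
    have "p * c\<^sup>2 * (q - 2 * c) \<le> p * c\<^sup>2 * (p\<^sup>2 / (4 * c))" using p0 q by (intro mult_left_mono) auto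
    also have "\<dots> = p * (c / 4 * p\<^sup>2)" using c by (simp add: power2_eq_square field_simps)
    also have "\<dots> \<le> 1 * (c / 4 * p\<^sup>2)" using p1 c by (intro mult_right_mono) auto
    finally have "p * c\<^sup>2 * (q - 2 * c) \<le> p\<^sup>2 * (c / 4)" by (simp add: mult.commute)
    moreover have "p\<^sup>2 * (p * q / 2) \<le> p\<^sup>2 * (q0 / 2)"
      using \<open>p * q \<le> 1 * q0\<close> by (intro mult_left_mono) auto
    moreover have "p\<^sup>2 * (q\<^sup>2 / 2) \<le> p\<^sup>2 * (q0\<^sup>2 / 2)"
      using q by (intro mult_left_mono divide_right_mono power_mono) auto
    ultimately have Zle: "Z \<le> C2 * p\<^sup>2" unfolding Z C2_def by (simp add: algebra_simps)
    have "\<bar>Z / (b - 1)\<bar> = Z / (b - 1)" using \<open>Z \<ge> 0\<close> b2 by simp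
    also have "\<dots> \<le> Z / 1" using \<open>Z \<ge> 0\<close> b2 by (intro divide_left_mono) auto
    finally have 2: "\<bar>Z / (b - 1)\<bar> \<le> C2 * p\<^sup>2" using Zle by simp
    have "p = sqrt (real d) * sqrt (\<kappa> - kappa_c d)" by (simp add: p_def real_sqrt_mult)
    then have tgt: "2 * sqrt (real d) * b powr (3/4) / (real d - 2) * sqrt (\<kappa> - kappa_c d) = 2 * p * c ^ 3 / (b - 1)"
      unfolding c3 by simp
    have "D \<kappa> * (y \<kappa> + D \<kappa>) / (2 * (b - 1)) - 2 * p * c ^ 3 / (b - 1) = Z / (b - 1)"
      unfolding Z_def by (simp add: diff_divide_distrib)
    moreover have "\<bar>u - v\<bar> \<le> B + B'" if "x - v = z" "\<bar>u - x\<bar> \<le> B" "\<bar>z\<bar> \<le> B'" for u v x z B B' :: real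
      using that by linarith
    ultimately have "\<bar>alpha_c d \<kappa> - 2 * p * c ^ 3 / (b - 1)\<bar> \<le> m\<^sup>2 * p\<^sup>2 + C2 * p\<^sup>2"
      using 1 2 by blast
    then show ?thesis unfolding tgt using k by (simp add: p2 algebra_simps)
  qed
  have "eventually (\<lambda>\<kappa>. \<kappa> \<in> {kappa_c d<..<kappa_c d + 1 / (real d * m\<^sup>2)}) (at_right (kappa_c d))"
    using d3 m by (intro eventually_at_right_real) simp
  then show ?thesis
    by (intro bigoI[of _ "(m\<^sup>2 + C2) * real d"]) (auto elim!: eventually_mono dest!: bound)
qed

text \<open>1/\<rho> differs from y^2 by a bounded amount, and the root differs from c/\<rho> at
  most by a bounded amount up to that same error, so the root is c y^2 up to a constant, with y = (1
  + \<kappa>) d.\<close>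

lemma alpha_c_asymp_infinity:
  "(\<lambda>\<kappa>. alpha_c d \<kappa> - (real d)\<^sup>2 * ln (b / (real d - 2)) * (1 + \<kappa>)\<^sup>2) \<in> O[at_top](\<lambda>_. 1)"
proof -
  define c where "c = ln (b / (b - 1))"
  define C where "C = 4 * c * exp (2 * c) * b"
  have c: "c > 0" unfolding c_def using b2 by (intro ln_gt_zero) (auto simp: field_simps)
  have C: "C > 0" using c b2 by (simp add: C_def)
  have bound: "\<bar>alpha_c d \<kappa> - c * (y \<kappa>)\<^sup>2\<bar> \<le> c + 2 * C + 3 * b * c"
    if k: "\<kappa> > kappa_c d" and Y: "y \<kappa> \<ge> 1" "y \<kappa> \<ge> 8 * (b + C)" for \<kappa>
  proof -
    interpret K: crit_rho b "R \<kappa>" using k by (rule crit_rho_R)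
    have k': "\<kappa> \<ge> kappa_c d" using k by simp
    have "(y \<kappa>)\<^sup>2 / 4 \<le> 1 / R \<kappa>"
      unfolding inv_R using D_nonneg[OF k'] Y by (intro divide_right_mono power_mono) auto
    moreover have "y \<kappa> * 1 \<le> (y \<kappa>)\<^sup>2" unfolding power2_eq_square using Y by (intro mult_left_mono) auto
    \<comment> \<open>The threshold 8 (b + C) serves this bound, as 1/\<rho> \<ge> y^2/4 \<ge> y/4.
      It implies both smallness conditions of \<open>crit_root_ge\<close>.\<close>
    ultimately have "2 * (b + C) \<le> 1 / R \<kappa>" using Y by linarith
    then have "2 * (b + C) * R \<kappa> \<le> 1 / R \<kappa> * R \<kappa>" using K.rho by (intro mult_right_mono) auto
    then have s: "2 * (b * R \<kappa>) + 2 * (C * R \<kappa>) \<le> 1" using K.rho by (simp add: algebra_simps)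
    have "C * R \<kappa> \<ge> 0" "b * R \<kappa> \<ge> 0" using C b2 K.rho by auto
    with s have small: "b * R \<kappa> \<le> 1 / 2" "C * R \<kappa> \<le> 1 / 2" by linarith+
    have upper: "crit_root b (R \<kappa>) \<le> c * (y \<kappa>)\<^sup>2"
    proof -
      have "R \<kappa> \<le> - ln (1 - R \<kappa>)" using minus_ln_one_minus_bounds(1)[of "R \<kappa>"] K.rho K.rho_half by simp
      then have "c / (- ln (1 - R \<kappa>)) \<le> c / R \<kappa>" using c K.rho K.ln_pos by (intro divide_left_mono mult_pos_pos) auto
      then have "crit_root b (R \<kappa>) \<le> c * (1 / R \<kappa>)" using K.crit_root_le by (simp add: c_def)
      also have "1 / R \<kappa> \<le> (2 * y \<kappa>)\<^sup>2 / 4"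
        unfolding inv_R using D_le[OF k'] D_nonneg[OF k'] Y by (intro divide_right_mono power_mono) auto
      finally show ?thesis using c by (simp add: power_mult_distrib)
    qed
    have "(1 + b * R \<kappa>)\<^sup>2 = (y \<kappa>)\<^sup>2 * R \<kappa>" unfolding R_quadratic[OF k'] using K.rho by (simp add: power_mult_distrib)
    \<comment> \<open>The squared quadratic equation, solved for y^2; the terms after 1/\<rho> are
      at most 3 b.\<close>
    then have "(y \<kappa>)\<^sup>2 = 1 / R \<kappa> + 2 * b + b * (b * R \<kappa>)"
      using K.rho by (simp add: power2_eq_square field_simps)
    moreover have "b * (b * R \<kappa>) \<le> b * 1" using b2 small by (intro mult_left_mono) auto
    ultimately have "(y \<kappa>)\<^sup>2 - 3 * b \<le> 1 / R \<kappa>" by simp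
    then have "c * ((y \<kappa>)\<^sup>2 - 3 * b) \<le> c * (1 / R \<kappa>)" using c by (intro mult_left_mono) auto
    moreover have "crit_root b (R \<kappa>) \<ge> c / R \<kappa> - (c + 2 * C)"
      using K.crit_root_ge small unfolding C_def c_def by blast
    ultimately have "crit_root b (R \<kappa>) \<ge> c * (y \<kappa>)\<^sup>2 - (c + 2 * C + 3 * b * c)"
      by (simp add: algebra_simps)
    moreover have "3 * b * c \<ge> 0" using b2 c by simp
    ultimately show ?thesis using upper c C k by (simp add: alpha_c_above)
  qed
  have "eventually (\<lambda>\<kappa>. \<kappa> > kappa_c d \<and> \<kappa> \<ge> 0 \<and> \<kappa> \<ge> 8 * (b + C)) at_top"
    by (intro eventually_conj eventually_gt_at_top eventually_ge_at_top)
  then have "eventually (\<lambda>\<kappa>. norm (alpha_c d \<kappa> - (real d)\<^sup>2 * ln (b / (real d - 2)) * (1 + \<kappa>)\<^sup>2) \<le> (c + 2 * C + 3 * b * c) * norm (1 :: real)) at_top"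
  proof eventually_elim
    case (elim \<kappa>)
    have "1 * (1 + \<kappa>) \<le> y \<kappa>" unfolding inv_weight_def using elim d3 by (subst mult.commute, intro mult_right_mono) auto
    with elim have "\<bar>alpha_c d \<kappa> - c * (y \<kappa>)\<^sup>2\<bar> \<le> c + 2 * C + 3 * b * c" by (intro bound) auto
    moreover have "c * (y \<kappa>)\<^sup>2 = (real d)\<^sup>2 * ln (b / (real d - 2)) * (1 + \<kappa>)\<^sup>2"
      by (simp add: c_def inv_weight_def power_mult_distrib)
    ultimately show ?case by simp
  qed
  then show ?thesis by (rule bigoI)
qed

lemma continuous_alpha_c: "continuous_on {-1<..} (alpha_c d)"
proof -
  have "isCont (alpha_c d) \<kappa>" if k: "\<kappa> > -1" for \<kappa>
  proof -
    consider "\<kappa> < kappa_c d" | "\<kappa> = kappa_c d" | "\<kappa> > kappa_c d" by linarith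
    then show ?thesis
    proof cases
      case 1
      then show ?thesis using differentiable_alpha_c_below[OF k] differentiable_imp_continuous_within by blast
    next
      case 3
      then show ?thesis using differentiable_alpha_c_above differentiable_imp_continuous_within by blast
    next
      case 2
      \<comment> \<open>To the left of \<open>kappa_c d\<close> the function is 0; the right limit
        follows from the expansion, whose leading term vanishes there.\<close>
      have z: "alpha_c d (kappa_c d) = 0" by (rule alpha_c_below) (use kappa_c_gt in auto)
      have "(alpha_c d \<longlongrightarrow> 0) (at_left (kappa_c d))"
      proof (rule tendsto_eventually)
        have "eventually (\<lambda>x. x \<in> {-1<..<kappa_c d}) (at_left (kappa_c d))"
          by (rule eventually_at_left_real) (rule kappa_c_gt)
        then show "eventually (\<lambda>x. alpha_c d x = 0) (at_left (kappa_c d))"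
          by eventually_elim (simp add: alpha_c_below)
      qed
      moreover have "(alpha_c d \<longlongrightarrow> 0) (at_right (kappa_c d))"
      proof -
        define f where "f \<kappa> = 2 * sqrt (real d) * b powr (3/4) / (real d - 2) * sqrt (\<kappa> - kappa_c d)" for \<kappa>
        have "((\<lambda>\<kappa>. \<kappa> - kappa_c d) \<longlongrightarrow> kappa_c d - kappa_c d) (at_right (kappa_c d))"
          by (intro tendsto_intros)
        then have x: "((\<lambda>\<kappa>. \<kappa> - kappa_c d) \<longlongrightarrow> 0) (at_right (kappa_c d))" by simp
        obtain C where "eventually (\<lambda>\<kappa>. norm (alpha_c d \<kappa> - f \<kappa>) \<le> C * norm (\<kappa> - kappa_c d)) (at_right (kappa_c d))"
          using landau_o.bigE[OF alpha_c_asymp_critical] unfolding f_def by blast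
        moreover have "((\<lambda>\<kappa>. C * norm (\<kappa> - kappa_c d)) \<longlongrightarrow> 0) (at_right (kappa_c d))"
          using x by (intro tendsto_mult_right_zero tendsto_norm_zero)
        ultimately have "((\<lambda>\<kappa>. alpha_c d \<kappa> - f \<kappa>) \<longlongrightarrow> 0) (at_right (kappa_c d))"
          by (rule Lim_null_comparison)
        moreover have "(f \<longlongrightarrow> 2 * sqrt (real d) * b powr (3/4) / (real d - 2) * sqrt 0) (at_right (kappa_c d))"
          unfolding f_def[abs_def] by (intro tendsto_mult tendsto_real_sqrt x tendsto_const)
        ultimately have "((\<lambda>\<kappa>. (alpha_c d \<kappa> - f \<kappa>) + f \<kappa>) \<longlongrightarrow> 0 + 2 * sqrt (real d) * b powr (3/4) / (real d - 2) * sqrt 0) (at_right (kappa_c d))"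
          by (rule tendsto_add)
        then show ?thesis by simp
      qed
      ultimately show ?thesis unfolding isCont_def 2 z
        by (simp add: filterlim_at_split)
    qed
  qed
  then show ?thesis by (intro continuous_at_imp_continuous_on) auto
qed

end

theorem theorem1p3:
  fixes d :: nat
  assumes "d \<ge> 3"
  shows "continuous_on {-1<..} (alpha_c d)
    \<and> (\<forall>\<kappa>>-1. \<kappa> \<noteq> kappa_c d \<longrightarrow> alpha_c d differentiable (at \<kappa>))
    \<and> strict_mono_on {kappa_c d..} (alpha_c d)
    \<and> (\<lambda>\<kappa>. alpha_c d \<kappa> -
          2 * sqrt (real d) * (real d - 1) powr (3/4) / (real d - 2) * sqrt (\<kappa> - kappa_c d))
        \<in> O[at_right (kappa_c d)](\<lambda>\<kappa>. \<kappa> - kappa_c d)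
    \<and> (\<lambda>\<kappa>. alpha_c d \<kappa> -
          (real d)\<^sup>2 * ln ((real d - 1) / (real d - 2)) * (1 + \<kappa>)\<^sup>2)
        \<in> O[at_top](\<lambda>_. 1)"
proof -
  interpret tree_degree d by unfold_locales fact
  show ?thesis
    using continuous_alpha_c differentiable_alpha_c_above differentiable_alpha_c_below strict_mono_alpha_c
      alpha_c_asymp_critical alpha_c_asymp_infinity
    by (meson linorder_neqE)
qed

end
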